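(* The assignment $$\begin{array}{ll} \delta_R(x_1)=x_1\otimes\alpha+q\,x_2\otimes\gamma, & \delta_R(\bar x^1)=q\,\bar x^2\otimes\bar\gamma+\bar x^1\otimes\bar\alpha,\\ \delta_R(x_2)=-x_1\otimes\bar\gamma+x_2\otimes\bar\alpha, & \delta_R(\bar x^2)=\bar x^2\otimes\alpha-\bar x^1\otimes\gamma,\\ \delta_R(x_3)=x_3\otimes\alpha-q\,x_4\otimes\gamma, & \delta_R(\bar x^3)=-q\,\bar x^4\otimes\bar\gamma+\bar x^3\otimes\bar\alpha,\\ \delta_R(x_4)=x_3\otimes\bar\gamma+x_4\otimes\bar\alpha, & \delta_R(\bar x^4)=\bar x^4\otimes\alpha+\bar x^3\otimes\gamma, \end{array}$$ extended as an algebra homomorphism, is a (well-defined) right coaction of the quantum group $SU_q(2)$ on the quantum sphere $S^7_q$, $$\delta_R:A(S^7_q)\to A(S^7_q)\otimes A(SU_q(2)).$$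
   Context: Fix $q\in\mathbb{R}$, $q\neq 0$; algebras are unital and over $\mathbb{C}$. For $i\in\{1,2,3,4\}$ put $i'=5-i$, $(\varepsilon_1,\varepsilon_2,\varepsilon_3,\varepsilon_4)=(1,1,-1,-1)$, $(\rho_1,\rho_2,\rho_3,\rho_4)=(2,1,-1,-2)$. Let $e_i^{\,j}\in M_4(\mathbb{C})$ be the matrix unit with $1$ in row $i$, column $j$, and let $$R=q\sum_{i}e_i^{\,i}\otimes e_i^{\,i}+\sum_{i\neq j,j'}e_i^{\,i}\otimes e_j^{\,j}+q^{-1}\sum_i e_{i'}^{\,i'}\otimes e_i^{\,i}+(q-q^{-1})\sum_{i>j}e_i^{\,j}\otimes e_j^{\,i}-(q-q^{-1})\sum_{i>j}q^{\rho_i-\rho_j}\varepsilon_i\varepsilon_j\,e_i^{\,j}\otimes e_{i'}^{\,j'},$$ with $i,j$ ranging over $1,\dots,4$. Let $C$ be the matrix $C_i^{\,j}=q^{\rho_j}\varepsilon_i\delta_{ij'}$. $A(Sp_q(2))$ is the algebra generated by the entries $T_i^{\,j}$ (row $i$, column $j$, $1\le i,j\le 4$) of a matrix $T$ with relations $R\,T_1T_2=T_2T_1R$ (where $T_1=T\otimes 1$, $T_2=1\otimes T$), and $TCT^tC^{-1}=CT^tC^{-1}T=1$. It is a Hopf $*$-algebra with $\Delta(T_i^{\,j})=\sum_kT_i^{\,k}\otimes T_k^{\,j}$, $\varepsilon(T_i^{\,j})=\delta_{ij}$, $S(T)=CT^tC^{-1}$, i.e. $S(T)_i^{\,j}=-q^{\rho_{i'}+\rho_j}\varepsilon_i\varepsilon_{j'}T_{j'}^{\,i'}$,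 and antilinear anti-involution (denoted by a bar) $\overline{T}=S(T)^t$, i.e. $\overline{T_i^{\,j}}=S(T)_j^{\,i}$. $A(S^7_q)$ is the subalgebra of $A(Sp_q(2))$ generated by $x_i=T_i^{\,4}$ and $\bar x^i=\overline{x_i}=S(T)_4^{\,i}=q^{2+\rho_i}\varepsilon_{i'}T_{i'}^{\,1}$, $i=1,\dots,4$. $A(SU_q(2))$ is the Hopf $*$-algebra generated by $\alpha,\gamma,\bar\alpha=\alpha^*,\bar\gamma=\gamma^*$ with relations $\alpha\gamma=q\gamma\alpha$, $\alpha\bar\gamma=q\bar\gamma\alpha$, $\gamma\bar\gamma=\bar\gamma\gamma$, $\alpha\bar\alpha+q^2\bar\gamma\gamma=1$, $\bar\alpha\alpha+\bar\gamma\gamma=1$ (and their conjugates), with Hopf structure such that the matrix $u=\begin{pmatrix}\alpha&-q\bar\gamma\\ \gamma&\bar\alpha\end{pmatrix}$ satisfies $\Delta(u_{ij})=\sum_ku_{ik}\otimes u_{kj}$, $\varepsilon(u_{ij})=\delta_{ij}$, $S(u_{ij})=(u_{ji})^*$. *)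

theory Defs
  imports Complex_Main "HOL-Library.Poly_Mapping" "HOL-Algebra.QuotRing" "HOL-Algebra.Module"
begin

section \<open>Unital associative algebras over the complex numbers\<close>

text \<open>
  The locale \<^locale>\<open>algebra\<close> of HOL-Algebra is restricted to commutative algebras, so noncommutative
  complex algebras are represented by bare records of type \<open>(complex, 'a) module\<close>; their
  multiplication need not be commutative.
\<close>

definition complex_alg :: "(complex, complex) module" where
  "complex_alg = \<lparr>carrier = UNIV, monoid.mult = (*), one = 1, zero = 0, add = (+), smult = (*)\<rparr>"

definition alg_hom :: "(complex, 'a) module \<Rightarrow> (complex, 'b) module \<Rightarrow> ('a \<Rightarrow> 'b) set" where
  "alg_hom A B = {h \<in> ring_hom A B. \<forall>c. \<forall>a\<in>carrier A. h (c \<odot>\<^bsub>A\<^esub> a) = c \<odot>\<^bsub>B\<^esub> h a}"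

inductive_set gen_subalg :: "(complex, 'a) module \<Rightarrow> 'a set \<Rightarrow> 'a set"
  for A and X where
  incl: "x \<in> X \<Longrightarrow> x \<in> gen_subalg A X"
| one: "\<one>\<^bsub>A\<^esub> \<in> gen_subalg A X"
| add: "x \<in> gen_subalg A X \<Longrightarrow> y \<in> gen_subalg A X \<Longrightarrow> x \<oplus>\<^bsub>A\<^esub> y \<in> gen_subalg A X"
| mult: "x \<in> gen_subalg A X \<Longrightarrow> y \<in> gen_subalg A X \<Longrightarrow> x \<otimes>\<^bsub>A\<^esub> y \<in> gen_subalg A X"
| smult: "x \<in> gen_subalg A X \<Longrightarrow> c \<odot>\<^bsub>A\<^esub> x \<in> gen_subalg A X"

definition monoid_alg :: "('m, 'x) monoid_scheme \<Rightarrow> (complex, 'm \<Rightarrow>\<^sub>0 complex) module" where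
  "monoid_alg M = \<lparr>carrier = {f. Poly_Mapping.keys f \<subseteq> carrier M},
     monoid.mult = (\<lambda>f g. \<Sum>x\<in>Poly_Mapping.keys f. \<Sum>y\<in>Poly_Mapping.keys g.
       Poly_Mapping.single (x \<otimes>\<^bsub>M\<^esub> y) (Poly_Mapping.lookup f x * Poly_Mapping.lookup g y)),
     one = Poly_Mapping.single \<one>\<^bsub>M\<^esub> 1, zero = 0, add = (+),
     smult = (\<lambda>c. Poly_Mapping.map ((*) c))\<rparr>"

text \<open>The free algebra on \<open>S\<close>: a word \<open>[s\<^sub>1, \<dots>, s\<^sub>n]\<close> stands for the monomial \<open>s\<^sub>1 \<cdots> s\<^sub>n\<close>.\<close>

definition free_alg :: "'s set \<Rightarrow> (complex, 's list \<Rightarrow>\<^sub>0 complex) module" where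
  "free_alg S = monoid_alg \<lparr>carrier = lists S, monoid.mult = (@), one = []\<rparr>"

text \<open>
  The quotient by the two-sided ideal generated by \<open>X\<close>. In an algebra this ideal is closed under
  scalars, and the union below is the single coset of \<open>c \<odot> y\<close>.
\<close>

definition quot_alg :: "(complex, 'a) module \<Rightarrow> 'a set \<Rightarrow> (complex, 'a set) module" where
  "quot_alg A X = ring.extend (A Quot (Idl\<^bsub>A\<^esub> X))
     (module.fields (\<lambda>c Y. \<Union>y\<in>Y. (Idl\<^bsub>A\<^esub> X) +>\<^bsub>A\<^esub> (c \<odot>\<^bsub>A\<^esub> y)))"

definition quot_class :: "(complex, 'a) module \<Rightarrow> 'a set \<Rightarrow> 'a \<Rightarrow> 'a set" where
  "quot_class A X a = (Idl\<^bsub>A\<^esub> X) +>\<^bsub>A\<^esub> a"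

text \<open>
  The linear map to \<open>V\<close> induced by \<open>\<beta>\<close> on a quotient of \<open>monoid_alg M\<close>: the common value of the
  linear extension of \<open>\<beta>\<close> at all representatives of \<open>Y\<close>.
\<close>

definition quot_lift :: "(complex, 'v) module \<Rightarrow> ('m \<Rightarrow> 'v) \<Rightarrow> ('m \<Rightarrow>\<^sub>0 complex) set \<Rightarrow> 'v" where
  "quot_lift V \<beta> Y = the_elem ((\<lambda>f. \<Oplus>\<^bsub>V\<^esub>w\<in>Poly_Mapping.keys f. Poly_Mapping.lookup f w \<odot>\<^bsub>V\<^esub> \<beta> w) ` Y)"


section \<open>Tensor products of algebras\<close>

text \<open>
  The free vector space on \<open>A \<times> B\<close> modulo bilinearity. As \<open>monoid_alg (A \<times>\<times> B)\<close>, this space carries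
  the product \<open>(a, b) (a', b') = (a a', b b')\<close>; multiplying a
  bilinearity relation by a pair gives another one, so their linear span is already a two-sided ideal.
\<close>

definition bilinearity_rels ::
    "(complex, 'a) module \<Rightarrow> (complex, 'b) module \<Rightarrow> ('a \<times> 'b \<Rightarrow>\<^sub>0 complex) set" where
  "bilinearity_rels A B =
     {Poly_Mapping.single (a \<oplus>\<^bsub>A\<^esub> a', b) 1 - Poly_Mapping.single (a, b) 1 - Poly_Mapping.single (a', b) 1
        | a a' b. a \<in> carrier A \<and> a' \<in> carrier A \<and> b \<in> carrier B}
   \<union> {Poly_Mapping.single (a, b \<oplus>\<^bsub>B\<^esub> b') 1 - Poly_Mapping.single (a, b) 1 - Poly_Mapping.single (a, b') 1
        | a b b'. a \<in> carrier A \<and> b \<in> carrier B \<and> b' \<in> carrier B}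
   \<union> {Poly_Mapping.single (c \<odot>\<^bsub>A\<^esub> a, b) 1 - Poly_Mapping.single (a, b) c
        | c a b. a \<in> carrier A \<and> b \<in> carrier B}
   \<union> {Poly_Mapping.single (a, c \<odot>\<^bsub>B\<^esub> b) 1 - Poly_Mapping.single (a, b) c
        | c a b. a \<in> carrier A \<and> b \<in> carrier B}"

definition tensor_alg ::
    "(complex, 'a) module \<Rightarrow> (complex, 'b) module \<Rightarrow> (complex, ('a \<times> 'b \<Rightarrow>\<^sub>0 complex) set) module" where
  "tensor_alg A B = quot_alg (monoid_alg (A \<times>\<times> B)) (bilinearity_rels A B)"

definition tens ::
    "(complex, 'a) module \<Rightarrow> (complex, 'b) module \<Rightarrow> 'a \<Rightarrow> 'b \<Rightarrow> ('a \<times> 'b \<Rightarrow>\<^sub>0 complex) set" where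
  "tens A B a b =
     quot_class (monoid_alg (A \<times>\<times> B)) (bilinearity_rels A B) (Poly_Mapping.single (a, b) 1)"

text \<open>The map \<open>f \<otimes> g\<close> with values in \<open>A \<otimes> B\<close>, for linear maps \<open>f\<close>, \<open>g\<close> with values in \<open>A\<close>, \<open>B\<close>.\<close>

definition tensor_map :: "(complex, 'a) module \<Rightarrow> (complex, 'b) module \<Rightarrow> ('c \<Rightarrow> 'a) \<Rightarrow> ('d \<Rightarrow> 'b)
    \<Rightarrow> ('c \<times> 'd \<Rightarrow>\<^sub>0 complex) set \<Rightarrow> ('a \<times> 'b \<Rightarrow>\<^sub>0 complex) set" where
  "tensor_map A B f g = quot_lift (tensor_alg A B) (\<lambda>(c, d). tens A B (f c) (g d))"

text \<open>The canonical isomorphism from \<open>(A \<otimes> B) \<otimes> C\<close> to \<open>A \<otimes> (B \<otimes> C)\<close>.\<close>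

definition tensor_assoc ::
    "(complex, 'a) module \<Rightarrow> (complex, 'b) module \<Rightarrow> (complex, 'c) module
     \<Rightarrow> (('a \<times> 'b \<Rightarrow>\<^sub>0 complex) set \<times> 'c \<Rightarrow>\<^sub>0 complex) set
     \<Rightarrow> ('a \<times> ('b \<times> 'c \<Rightarrow>\<^sub>0 complex) set \<Rightarrow>\<^sub>0 complex) set" where
  "tensor_assoc A B C = quot_lift (tensor_alg A (tensor_alg B C))
     (\<lambda>(t, c). quot_lift (tensor_alg A (tensor_alg B C))
       (\<lambda>(a, b). tens A (tensor_alg B C) a (tens B C b c)) t)"

text \<open>The canonical isomorphism from the tensor product of \<open>A\<close> with the scalars to \<open>A\<close>.\<close>

definition tensor_runit :: "(complex, 'a) module \<Rightarrow> ('a \<times> complex \<Rightarrow>\<^sub>0 complex) set \<Rightarrow> 'a" where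
  "tensor_runit A = quot_lift A (\<lambda>(a, c). c \<odot>\<^bsub>A\<^esub> a)"

text \<open>
  Right coactions, by algebra homomorphisms, of a bialgebra \<open>H\<close> with coproduct \<open>\<Delta>\<close> and counit \<open>\<epsilon>\<close> on
  an algebra \<open>A\<close>.
\<close>

definition right_coaction ::
    "(complex, 'a) module \<Rightarrow> (complex, 'h) module \<Rightarrow> ('h \<Rightarrow> ('h \<times> 'h \<Rightarrow>\<^sub>0 complex) set) \<Rightarrow> ('h \<Rightarrow> complex)
     \<Rightarrow> ('a \<Rightarrow> ('a \<times> 'h \<Rightarrow>\<^sub>0 complex) set) \<Rightarrow> bool" where
  "right_coaction A H \<Delta> \<epsilon> \<delta> \<longleftrightarrow>
     \<delta> \<in> alg_hom A (tensor_alg A H) \<and>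
     (\<forall>a\<in>carrier A. tensor_assoc A H H (tensor_map (tensor_alg A H) H \<delta> id (\<delta> a))
                     = tensor_map A (tensor_alg H H) id \<Delta> (\<delta> a)) \<and>
     (\<forall>a\<in>carrier A. tensor_runit A (tensor_map A complex_alg id \<epsilon> (\<delta> a)) = a)"


section \<open>The algebra of the quantum symplectic group\<close>

definition conj_idx :: "nat \<Rightarrow> nat" where
  "conj_idx i = 5 - i"

definition sp_eps :: "nat \<Rightarrow> complex" where
  "sp_eps i = (if i \<le> 2 then 1 else -1)"

definition sp_rho :: "nat \<Rightarrow> int" where
  "sp_rho i = (if i = 1 then 2 else if i = 2 then 1 else if i = 3 then -1 else -2)"

definition mat_unit :: "nat \<Rightarrow> nat \<Rightarrow> nat \<Rightarrow> nat \<Rightarrow> complex" where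
  "mat_unit i j a b = (if a = i \<and> b = j then 1 else 0)"

text \<open>
  \<open>unit_tens i j k l\<close> is the matrix of \<open>e\<^sub>i\<^sup>j \<otimes> e\<^sub>k\<^sup>l\<close>; its entry at \<open>a c b d\<close> is the one in row \<open>(a, c)\<close> and
  column \<open>(b, d)\<close>. The same argument order is used for \<open>sp_R\<close>.
\<close>

definition unit_tens ::
    "nat \<Rightarrow> nat \<Rightarrow> nat \<Rightarrow> nat \<Rightarrow> nat \<Rightarrow> nat \<Rightarrow> nat \<Rightarrow> nat \<Rightarrow> complex" where
  "unit_tens i j k l a c b d = mat_unit i j a b * mat_unit k l c d"

definition sp_R :: "real \<Rightarrow> nat \<Rightarrow> nat \<Rightarrow> nat \<Rightarrow> nat \<Rightarrow> complex" where
  "sp_R q a c b d = (let q = complex_of_real q in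
     q * (\<Sum>i\<in>{1..4}. unit_tens i i i i a c b d)
     + (\<Sum>(i, j)\<in>{(i, j). i \<in> {1..4} \<and> j \<in> {1..4} \<and> i \<noteq> j \<and> i \<noteq> conj_idx j}. unit_tens i i j j a c b d)
     + inverse q * (\<Sum>i\<in>{1..4}. unit_tens (conj_idx i) (conj_idx i) i i a c b d)
     + (q - inverse q) * (\<Sum>(i, j)\<in>{(i, j). i \<in> {1..4} \<and> j \<in> {1..4} \<and> i > j}.
         unit_tens i j j i a c b d)
     - (q - inverse q) * (\<Sum>(i, j)\<in>{(i, j). i \<in> {1..4} \<and> j \<in> {1..4} \<and> i > j}.
         q powi (sp_rho i - sp_rho j) * sp_eps i * sp_eps j
           * unit_tens i j (conj_idx i) (conj_idx j) a c b d))"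

definition sp_C :: "real \<Rightarrow> nat \<Rightarrow> nat \<Rightarrow> complex" where
  "sp_C q i j = (if i = conj_idx j then complex_of_real q powi sp_rho j * sp_eps i else 0)"

text \<open>The inverse matrix of \<open>C\<close> is \<open>- C\<close>.\<close>

definition sp_C_inv :: "real \<Rightarrow> nat \<Rightarrow> nat \<Rightarrow> complex" where
  "sp_C_inv q i j = - sp_C q i j"

lemma atLeastAtMost_1_4: "{1..4::nat} = {1, 2, 3, 4}"
  by auto

lemma sp_C_inverse:
  assumes "q \<noteq> 0" "i \<in> {1..4}" "j \<in> {1..4}"
  shows "(\<Sum>k\<in>{1..4}. sp_C q i k * sp_C_inv q k j) = (if i = j then 1 else 0)"
    and "(\<Sum>k\<in>{1..4}. sp_C_inv q i k * sp_C q k j) = (if i = j then 1 else 0)"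
proof -
  have i: "i = 1 \<or> i = 2 \<or> i = 3 \<or> i = 4" and j: "j = 1 \<or> j = 2 \<or> j = 3 \<or> j = 4"
    using assms(2,3) by auto
  show "(\<Sum>k\<in>{1..4}. sp_C q i k * sp_C_inv q k j) = (if i = j then 1 else 0)"
    "(\<Sum>k\<in>{1..4}. sp_C_inv q i k * sp_C q k j) = (if i = j then 1 else 0)"
    using i j assms(1)
    by (elim disjE; simp add: atLeastAtMost_1_4 sp_C_inv_def sp_C_def conj_idx_def sp_rho_def sp_eps_def
      power_int_minus del: One_nat_def)+
qed

definition sp_gens :: "(nat \<times> nat) set" where
  "sp_gens = {1..4} \<times> {1..4}"

text \<open>
  The generator \<open>(i, j)\<close> is the entry \<open>T\<^sub>i\<^sup>j\<close>. The \<open>((i, k), (j, l))\<close> entries of \<open>T\<^sub>1 T\<^sub>2\<close> and \<open>T\<^sub>2 T\<^sub>1\<close> are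
  \<open>T\<^sub>i\<^sup>j T\<^sub>k\<^sup>l\<close> and \<open>T\<^sub>k\<^sup>l T\<^sub>i\<^sup>j\<close>; the three sets below are the entries of \<open>R T\<^sub>1 T\<^sub>2 - T\<^sub>2 T\<^sub>1 R\<close>,
  of \<open>T C T\<^sup>t C\<inverse> - 1\<close> and of \<open>C T\<^sup>t C\<inverse> T - 1\<close>, where \<open>C\<inverse>\<close> is the inverse matrix.
\<close>

definition sp_rels :: "real \<Rightarrow> ((nat \<times> nat) list \<Rightarrow>\<^sub>0 complex) set" where
  "sp_rels q =
     {(\<Sum>a\<in>{1..4}. \<Sum>b\<in>{1..4}. Poly_Mapping.single [(a, j), (b, l)] (sp_R q i k a b))
      - (\<Sum>a\<in>{1..4}. \<Sum>b\<in>{1..4}. Poly_Mapping.single [(k, b), (i, a)] (sp_R q a b j l))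
        | i k j l. i \<in> {1..4} \<and> k \<in> {1..4} \<and> j \<in> {1..4} \<and> l \<in> {1..4}}
   \<union> {(\<Sum>a\<in>{1..4}. \<Sum>b\<in>{1..4}. \<Sum>c\<in>{1..4}.
         Poly_Mapping.single [(i, a), (c, b)] (sp_C q a b * sp_C_inv q c j))
      - Poly_Mapping.single [] (if i = j then 1 else 0)
        | i j. i \<in> {1..4} \<and> j \<in> {1..4}}
   \<union> {(\<Sum>a\<in>{1..4}. \<Sum>b\<in>{1..4}. \<Sum>c\<in>{1..4}.
         Poly_Mapping.single [(b, a), (c, j)] (sp_C q i a * sp_C_inv q b c))
      - Poly_Mapping.single [] (if i = j then 1 else 0)
        | i j. i \<in> {1..4} \<and> j \<in> {1..4}}"

definition Sp_alg :: "real \<Rightarrow> (complex, ((nat \<times> nat) list \<Rightarrow>\<^sub>0 complex) set) module" where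
  "Sp_alg q = quot_alg (free_alg sp_gens) (sp_rels q)"

definition Sp_T :: "real \<Rightarrow> nat \<Rightarrow> nat \<Rightarrow> ((nat \<times> nat) list \<Rightarrow>\<^sub>0 complex) set" where
  "Sp_T q i j = quot_class (free_alg sp_gens) (sp_rels q) (Poly_Mapping.single [(i, j)] 1)"

text \<open>The entries of the matrix \<open>S(T) = C T\<^sup>t C\<inverse>\<close>.\<close>

definition Sp_ST :: "real \<Rightarrow> nat \<Rightarrow> nat \<Rightarrow> ((nat \<times> nat) list \<Rightarrow>\<^sub>0 complex) set" where
  "Sp_ST q i j = quot_class (free_alg sp_gens) (sp_rels q)
     (\<Sum>a\<in>{1..4}. \<Sum>b\<in>{1..4}. Poly_Mapping.single [(b, a)] (sp_C q i a * sp_C_inv q b j))"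

lemma Sp_ST_eq:
  assumes "q \<noteq> 0" "i \<in> {1..4}" "j \<in> {1..4}"
  shows "Sp_ST q i j = quot_class (free_alg sp_gens) (sp_rels q)
    (Poly_Mapping.single [(conj_idx j, conj_idx i)]
      (- (complex_of_real q powi (sp_rho (conj_idx i) + sp_rho j) * sp_eps i * sp_eps (conj_idx j))))"
proof -
  have i: "i = 1 \<or> i = 2 \<or> i = 3 \<or> i = 4" and j: "j = 1 \<or> j = 2 \<or> j = 3 \<or> j = 4"
    using assms(2,3) by auto
  have "(\<Sum>a\<in>{1..4}. \<Sum>b\<in>{1..4}. Poly_Mapping.single [(b, a)] (sp_C q i a * sp_C_inv q b j)) =
    Poly_Mapping.single [(conj_idx j, conj_idx i)]
      (- (complex_of_real q powi (sp_rho (conj_idx i) + sp_rho j) * sp_eps i * sp_eps (conj_idx j)))"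
    using i j assms(1)
    by (elim disjE; simp add: atLeastAtMost_1_4 sp_C_inv_def sp_C_def conj_idx_def sp_rho_def sp_eps_def
      power_int_add[symmetric] power_int_add_1 power_int_minus power2_eq_square power3_eq_cube power_int_minus del: One_nat_def; simp add: field_simps power4_eq_xxxx)
  then show ?thesis
    by (simp only: Sp_ST_def)
qed


section \<open>The algebra of the quantum seven-sphere\<close>

definition S7_x :: "real \<Rightarrow> nat \<Rightarrow> ((nat \<times> nat) list \<Rightarrow>\<^sub>0 complex) set" where
  "S7_x q i = Sp_T q i 4"

text \<open>
  The involution of \<open>Sp_alg q\<close> sends \<open>T\<^sub>i\<^sup>j\<close> to \<open>S(T)\<^sub>j\<^sup>i\<close>, so the conjugate of \<open>x\<^sub>i = T\<^sub>i\<^sup>4\<close> is \<open>S(T)\<^sub>4\<^sup>i\<close>.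
\<close>

definition S7_xbar :: "real \<Rightarrow> nat \<Rightarrow> ((nat \<times> nat) list \<Rightarrow>\<^sub>0 complex) set" where
  "S7_xbar q i = Sp_ST q 4 i"

lemma S7_xbar_eq:
  assumes "q \<noteq> 0" "i \<in> {1..4}"
  shows "S7_xbar q i = quot_class (free_alg sp_gens) (sp_rels q)
    (Poly_Mapping.single [(conj_idx i, 1)]
      (complex_of_real q powi (2 + sp_rho i) * sp_eps (conj_idx i)))"
  using assms unfolding S7_xbar_def
  by (simp add: Sp_ST_eq conj_idx_def sp_rho_def sp_eps_def)

definition S7_alg :: "real \<Rightarrow> (complex, ((nat \<times> nat) list \<Rightarrow>\<^sub>0 complex) set) module" where
  "S7_alg q = (Sp_alg q)\<lparr>carrier := gen_subalg (Sp_alg q) (S7_x q ` {1..4} \<union> S7_xbar q ` {1..4})\<rparr>"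


section \<open>The quantum group SU(2)\<close>

datatype su_gen = Alpha | Gamma | AlphaBar | GammaBar

text \<open>
  The last two relations are the conjugates of the first two; the other three are self-conjugate.
\<close>

definition su_rels :: "real \<Rightarrow> (su_gen list \<Rightarrow>\<^sub>0 complex) set" where
  "su_rels q = (let q = complex_of_real q; m = Poly_Mapping.single in
     {m [Alpha, Gamma] 1 - m [Gamma, Alpha] q,
      m [Alpha, GammaBar] 1 - m [GammaBar, Alpha] q,
      m [Gamma, GammaBar] 1 - m [GammaBar, Gamma] 1,
      m [Alpha, AlphaBar] 1 + m [GammaBar, Gamma] (q\<^sup>2) - m [] 1,
      m [AlphaBar, Alpha] 1 + m [GammaBar, Gamma] 1 - m [] 1,
      m [GammaBar, AlphaBar] 1 - m [AlphaBar, GammaBar] q,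
      m [Gamma, AlphaBar] 1 - m [AlphaBar, Gamma] q})"

definition SU_alg :: "real \<Rightarrow> (complex, (su_gen list \<Rightarrow>\<^sub>0 complex) set) module" where
  "SU_alg q = quot_alg (free_alg UNIV) (su_rels q)"

definition SU_gen :: "real \<Rightarrow> su_gen \<Rightarrow> (su_gen list \<Rightarrow>\<^sub>0 complex) set" where
  "SU_gen q g = quot_class (free_alg UNIV) (su_rels q) (Poly_Mapping.single [g] 1)"

definition SU_u :: "real \<Rightarrow> nat \<Rightarrow> nat \<Rightarrow> (su_gen list \<Rightarrow>\<^sub>0 complex) set" where
  "SU_u q i j =
     (if i = 1 then
        (if j = 1 then SU_gen q Alpha else (- complex_of_real q) \<odot>\<^bsub>SU_alg q\<^esub> SU_gen q GammaBar)
      else (if j = 1 then SU_gen q Gamma else SU_gen q AlphaBar))"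

text \<open>
  For nonzero \<open>q\<close> the entries of \<open>u\<close> generate the algebra, so that coproduct and counit are determined on
  the carrier by their values on these entries.
\<close>

definition SU_comult ::
    "real \<Rightarrow> (su_gen list \<Rightarrow>\<^sub>0 complex) set
     \<Rightarrow> ((su_gen list \<Rightarrow>\<^sub>0 complex) set \<times> (su_gen list \<Rightarrow>\<^sub>0 complex) set \<Rightarrow>\<^sub>0 complex) set" where
  "SU_comult q = (SOME \<Delta>. \<Delta> \<in> alg_hom (SU_alg q) (tensor_alg (SU_alg q) (SU_alg q)) \<and>
     (\<forall>i\<in>{1, 2}. \<forall>j\<in>{1, 2}. \<Delta> (SU_u q i j) =
        (\<Oplus>\<^bsub>tensor_alg (SU_alg q) (SU_alg q)\<^esub>k\<in>{1, 2}.
           tens (SU_alg q) (SU_alg q) (SU_u q i k) (SU_u q k j))))"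

definition SU_counit :: "real \<Rightarrow> (su_gen list \<Rightarrow>\<^sub>0 complex) set \<Rightarrow> complex" where
  "SU_counit q = (SOME \<epsilon>. \<epsilon> \<in> alg_hom (SU_alg q) complex_alg \<and>
     (\<forall>i\<in>{1, 2}. \<forall>j\<in>{1, 2}. \<epsilon> (SU_u q i j) = (if i = j then 1 else 0)))"


section \<open>The prescribed values of the coaction on generators\<close>

definition deltaR_values ::
    "real \<Rightarrow> (((nat \<times> nat) list \<Rightarrow>\<^sub>0 complex) set
       \<Rightarrow> (((nat \<times> nat) list \<Rightarrow>\<^sub>0 complex) set \<times> (su_gen list \<Rightarrow>\<^sub>0 complex) set \<Rightarrow>\<^sub>0 complex) set) \<Rightarrow> bool" where
  "deltaR_values q \<delta> \<longleftrightarrow>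
    (let P = tensor_alg (S7_alg q) (SU_alg q);
         t = tens (S7_alg q) (SU_alg q);
         x = S7_x q; y = S7_xbar q;
         \<alpha> = SU_gen q Alpha; \<gamma> = SU_gen q Gamma;
         \<alpha>' = SU_gen q AlphaBar; \<gamma>' = SU_gen q GammaBar;
         q = complex_of_real q
     in \<delta> (x 1) = t (x 1) \<alpha> \<oplus>\<^bsub>P\<^esub> q \<odot>\<^bsub>P\<^esub> t (x 2) \<gamma> \<and>
        \<delta> (x 2) = (\<ominus>\<^bsub>P\<^esub> t (x 1) \<gamma>') \<oplus>\<^bsub>P\<^esub> t (x 2) \<alpha>' \<and>
        \<delta> (x 3) = t (x 3) \<alpha> \<ominus>\<^bsub>P\<^esub> (q \<odot>\<^bsub>P\<^esub> t (x 4) \<gamma>) \<and>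
        \<delta> (x 4) = t (x 3) \<gamma>' \<oplus>\<^bsub>P\<^esub> t (x 4) \<alpha>' \<and>
        \<delta> (y 1) = q \<odot>\<^bsub>P\<^esub> t (y 2) \<gamma>' \<oplus>\<^bsub>P\<^esub> t (y 1) \<alpha>' \<and>
        \<delta> (y 2) = t (y 2) \<alpha> \<ominus>\<^bsub>P\<^esub> t (y 1) \<gamma> \<and>
        \<delta> (y 3) = (\<ominus>\<^bsub>P\<^esub> (q \<odot>\<^bsub>P\<^esub> t (y 4) \<gamma>')) \<oplus>\<^bsub>P\<^esub> t (y 3) \<alpha>' \<and>
        \<delta> (y 4) = t (y 4) \<alpha> \<oplus>\<^bsub>P\<^esub> t (y 3) \<gamma>)"

end

theory Submission
  imports Defs
begin

text \<open>
  Put \<open>w\<close> for the block diagonal matrix over \<open>A(SU\<^sub>q(2))\<close> with diagonal blocks \<open>(\<alpha>, q \<gamma>; - \<gamma>', \<alpha>')\<close> and \<open>(\<alpha>, -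
  q \<gamma>; \<gamma>', \<alpha>')\<close>, where a prime denotes the conjugate. The algebra of the sphere is generated by the last
  column \<open>x\<^sub>i = T\<^sub>i\<^sup>4\<close> of \<open>T\<close> and, since the conjugate of \<open>x\<^sub>i\<close> is a nonzero multiple of \<open>T\<^sub>i\<^sub>'\<^sup>1\<close>, by its first
  column. On both columns the prescribed assignment reads \<open>T\<^sub>i\<^sup>j \<mapsto> \<Sum>\<^sub>k T\<^sub>k\<^sup>j \<otimes> w\<^sub>i\<^sup>k\<close>; it multiplies \<open>T\<close> from the
  left by a matrix whose entries commute with those of \<open>T\<close>.

  The sphere comes as a subalgebra, without a presentation, so the homomorphism is constructed on the larger
  algebra \<open>A(Sp\<^sub>q(2))\<close> and then restricted. The matrix \<open>w\<close> satisfies the defining relations of \<open>A(Sp\<^sub>q(2))\<close>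
  (\<open>levi_point\<close>): up to a reversal of the coproduct it exhibits \<open>SU\<^sub>q(2)\<close> as a block diagonal quantum
  subgroup. The product of two matrices that satisfy these relations and have mutually commuting entries
  satisfies them again (\<open>sp_point_tensor\<close>), so the formula defines a homomorphism from \<open>A(Sp\<^sub>q(2))\<close> to
  \<open>A(Sp\<^sub>q(2)) \<otimes> A(SU\<^sub>q(2))\<close>. It maps the generators of the sphere into the image of \<open>A(S\<^sup>7\<^sub>q) \<otimes> A(SU\<^sub>q(2))\<close>. A
  linear subspace is a linear retract, hence this tensor product embeds into the larger one
  (\<open>subalg_tensor_inj\<close>), and the homomorphism restricts to one with the required codomain.

  Coassociativity and counitality are equalities of algebra homomorphisms on the sphere, so they only have to
  be compared on the first and last columns of \<open>T\<close>. There they say that \<open>\<Delta>(w\<^sub>i\<^sup>m) = \<Sum>\<^sub>k w\<^sub>k\<^sup>m \<otimes> w\<^sub>i\<^sup>k\<close> and that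
  \<open>\<epsilon>(w)\<close> is the identity matrix (\<open>levi_comult\<close>, \<open>levi_counit\<close>). The factors in the coproduct occur in the
  order opposite to that of a matrix product, which is why multiplication of \<open>T\<close> from the left is a coaction
  on the right. Uniqueness holds because the values on generators determine a homomorphism.

  The relations that enter are quadratic. Each is decided by expanding products of two generators of
  \<open>A(SU\<^sub>q(2))\<close> in ordered monomials (\<open>su_point_mult\<close>), after which only identities between complex
  coefficients remain. The first half of the development provides the universal properties of the algebras
  involved. The delicate one is that of the tensor product: it is a quotient by a two-sided ideal, whereas
  the maps to be induced on it are in general only bilinear (\<open>bilin_kills_ideal\<close>).
\<close>

section \<open>Noncommutative complex algebras and their linear maps\<close>

locale calg = ring A for A :: "(complex, 'a) module" (structure) +
  assumes smult_closed [simp, intro]: "x \<in> carrier A \<Longrightarrow> c \<odot> x \<in> carrier A"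
    and smult_l_distr: "x \<in> carrier A \<Longrightarrow> (c + d) \<odot> x = c \<odot> x \<oplus> d \<odot> x"
    and smult_r_distr: "x \<in> carrier A \<Longrightarrow> y \<in> carrier A \<Longrightarrow> c \<odot> (x \<oplus> y) = c \<odot> x \<oplus> c \<odot> y"
    and smult_smult [simp]: "x \<in> carrier A \<Longrightarrow> c \<odot> (d \<odot> x) = (c * d) \<odot> x"
    and smult_one [simp]: "x \<in> carrier A \<Longrightarrow> 1 \<odot> x = x"
    and smult_mult_left: "x \<in> carrier A \<Longrightarrow> y \<in> carrier A \<Longrightarrow> (c \<odot> x) \<otimes> y = c \<odot> (x \<otimes> y)"
    and smult_mult_right: "x \<in> carrier A \<Longrightarrow> y \<in> carrier A \<Longrightarrow> x \<otimes> (c \<odot> y) = c \<odot> (x \<otimes> y)"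
begin

lemma smult_zero_left [simp]:
  assumes "x \<in> carrier A"
  shows "0 \<odot> x = \<zero>"
proof -
  have "0 \<odot> x \<oplus> 0 \<odot> x = 0 \<odot> x"
    using smult_l_distr[OF assms, of 0 0] by simp
  then show ?thesis
    using assms by (simp add: add.l_cancel_one)
qed

lemma smult_zero_right [simp]: "c \<odot> \<zero> = \<zero>"
  using smult_smult[of \<zero> c 0] by simp

lemma smult_minus_one: "x \<in> carrier A \<Longrightarrow> (- 1) \<odot> x = \<ominus> x"
  using smult_l_distr[of x "- 1" 1] by (intro minus_equality[symmetric]) auto

lemma smult_uminus: "x \<in> carrier A \<Longrightarrow> (- c) \<odot> x = \<ominus> (c \<odot> x)"
  using smult_smult[of x "- 1" c] smult_minus_one[of "c \<odot> x"] by (simp del: smult_smult)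

lemma diff_eq_zero_iff [simp]:
  assumes "x \<in> carrier A" "y \<in> carrier A"
  shows "x \<ominus> y = \<zero> \<longleftrightarrow> x = y"
  using assms by (metis a_minus_def a_inv_closed minus_equality minus_minus r_neg)

lemma smult_finsum:
  "f \<in> S \<rightarrow> carrier A \<Longrightarrow> c \<odot> (\<Oplus>i\<in>S. f i) = (\<Oplus>i\<in>S. c \<odot> f i)"
proof (induction S rule: infinite_finite_induct)
  case (insert x F)
  then show ?case
    by (simp add: Pi_def smult_r_distr)
qed (simp_all add: finsum_infinite)

lemma finsum_smult_left:
  "x \<in> carrier A \<Longrightarrow> (\<Oplus>i\<in>S. c i \<odot> x) = (\<Sum>i\<in>S. c i) \<odot> x"
  by (induction S rule: infinite_finite_induct) (simp_all add: finsum_infinite smult_l_distr)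

lemma finsum_swap:
  assumes "finite S" "finite T" "\<And>i j. i \<in> S \<Longrightarrow> j \<in> T \<Longrightarrow> f i j \<in> carrier A"
  shows "(\<Oplus>i\<in>S. \<Oplus>j\<in>T. f i j) = (\<Oplus>j\<in>T. \<Oplus>i\<in>S. f i j)"
  using assms(1,3)
proof (induction S)
  case (insert x F)
  have "(\<Oplus>j\<in>T. \<Oplus>i\<in>insert x F. f i j) = (\<Oplus>j\<in>T. f x j \<oplus> (\<Oplus>i\<in>F. f i j))"
    using insert by (intro finsum_cong') (auto intro!: finsum_closed finsum_insert)
  also have "\<dots> = (\<Oplus>j\<in>T. f x j) \<oplus> (\<Oplus>j\<in>T. \<Oplus>i\<in>F. f i j)"
    using insert by (intro finsum_addf) (auto intro!: finsum_closed)
  finally show ?case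
    using insert by (simp add: Pi_def finsum_closed)
qed simp

lemma finsum_subset:
  assumes "finite T" "S \<subseteq> T" "f \<in> T \<rightarrow> carrier A" "\<And>i. i \<in> T - S \<Longrightarrow> f i = \<zero>"
  shows "(\<Oplus>i\<in>S. f i) = (\<Oplus>i\<in>T. f i)"
  using assms by (intro add.finprod_mono_neutral_cong_left) auto

lemma finsum_delta:
  assumes "finite S" "f \<in> S \<rightarrow> carrier A" "i \<in> S" "\<And>j. j \<in> S \<Longrightarrow> j \<noteq> i \<Longrightarrow> f j = \<zero>"
  shows "(\<Oplus>j\<in>S. f j) = f i"
  using finsum_subset[of S "{i}" f] assms by (auto simp: Pi_def)

end

definition lin :: "(complex, 'a) module \<Rightarrow> (complex, 'b) module \<Rightarrow> ('a \<Rightarrow> 'b) set" where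
  "lin A B = {h \<in> carrier A \<rightarrow> carrier B.
     (\<forall>x\<in>carrier A. \<forall>y\<in>carrier A. h (x \<oplus>\<^bsub>A\<^esub> y) = h x \<oplus>\<^bsub>B\<^esub> h y) \<and>
     (\<forall>c. \<forall>x\<in>carrier A. h (c \<odot>\<^bsub>A\<^esub> x) = c \<odot>\<^bsub>B\<^esub> h x)}"

lemma linI:
  assumes "\<And>x. x \<in> carrier A \<Longrightarrow> h x \<in> carrier B"
    and "\<And>x y. x \<in> carrier A \<Longrightarrow> y \<in> carrier A \<Longrightarrow> h (x \<oplus>\<^bsub>A\<^esub> y) = h x \<oplus>\<^bsub>B\<^esub> h y"
    and "\<And>c x. x \<in> carrier A \<Longrightarrow> h (c \<odot>\<^bsub>A\<^esub> x) = c \<odot>\<^bsub>B\<^esub> h x"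
  shows "h \<in> lin A B"
  using assms by (auto simp: lin_def)

lemma lin_closed: "h \<in> lin A B \<Longrightarrow> x \<in> carrier A \<Longrightarrow> h x \<in> carrier B"
  and lin_add: "h \<in> lin A B \<Longrightarrow> x \<in> carrier A \<Longrightarrow> y \<in> carrier A \<Longrightarrow> h (x \<oplus>\<^bsub>A\<^esub> y) = h x \<oplus>\<^bsub>B\<^esub> h y"
  and lin_smult: "h \<in> lin A B \<Longrightarrow> x \<in> carrier A \<Longrightarrow> h (c \<odot>\<^bsub>A\<^esub> x) = c \<odot>\<^bsub>B\<^esub> h x"
  by (auto simp: lin_def)

lemma lin_zero:
  assumes "calg A" "calg B" "h \<in> lin A B"
  shows "h \<zero>\<^bsub>A\<^esub> = \<zero>\<^bsub>B\<^esub>"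
proof -
  interpret A: calg A by fact
  interpret B: calg B by fact
  show ?thesis
    using lin_smult[OF assms(3), of "\<zero>\<^bsub>A\<^esub>" 0] lin_closed[OF assms(3)] by simp
qed

lemma lin_uminus:
  assumes "calg A" "calg B" "h \<in> lin A B" "x \<in> carrier A"
  shows "h (\<ominus>\<^bsub>A\<^esub> x) = \<ominus>\<^bsub>B\<^esub> h x"
proof -
  interpret A: calg A by fact
  interpret B: calg B by fact
  show ?thesis
    using lin_smult[OF assms(3,4), of "- 1"] lin_closed[OF assms(3,4)] assms(4)
    by (simp add: A.smult_minus_one B.smult_minus_one)
qed

lemma lin_finsum:
  assumes "calg A" "calg B" "h \<in> lin A B" "f \<in> S \<rightarrow> carrier A"
  shows "h (\<Oplus>\<^bsub>A\<^esub>i\<in>S. f i) = (\<Oplus>\<^bsub>B\<^esub>i\<in>S. h (f i))"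
proof -
  interpret A: calg A by fact
  interpret B: calg B by fact
  show ?thesis
    using assms(4)
  proof (induction S rule: infinite_finite_induct)
    case (insert x F)
    then show ?case
      using lin_closed[OF assms(3)] by (simp add: Pi_def lin_add[OF assms(3)])
  qed (simp_all add: A.finsum_infinite B.finsum_infinite lin_zero[OF assms(1-3)])
qed

lemma lin_comp: "g \<in> lin B C \<Longrightarrow> f \<in> lin A B \<Longrightarrow> (\<lambda>x. g (f x)) \<in> lin A C"
  by (auto simp: lin_def Pi_def)

lemma alg_hom_iff:
  "h \<in> alg_hom A B \<longleftrightarrow> h \<in> lin A B \<and>
     (\<forall>x\<in>carrier A. \<forall>y\<in>carrier A. h (x \<otimes>\<^bsub>A\<^esub> y) = h x \<otimes>\<^bsub>B\<^esub> h y) \<and> h \<one>\<^bsub>A\<^esub> = \<one>\<^bsub>B\<^esub>"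
  by (auto simp: alg_hom_def lin_def ring_hom_def)

lemma alg_hom_lin: "h \<in> alg_hom A B \<Longrightarrow> h \<in> lin A B"
  and alg_hom_mult:
    "h \<in> alg_hom A B \<Longrightarrow> x \<in> carrier A \<Longrightarrow> y \<in> carrier A \<Longrightarrow> h (x \<otimes>\<^bsub>A\<^esub> y) = h x \<otimes>\<^bsub>B\<^esub> h y"
  and alg_hom_one: "h \<in> alg_hom A B \<Longrightarrow> h \<one>\<^bsub>A\<^esub> = \<one>\<^bsub>B\<^esub>"
  by (auto simp: alg_hom_iff)

lemma alg_homI:
  assumes "h \<in> lin A B"
    and "\<And>x y. x \<in> carrier A \<Longrightarrow> y \<in> carrier A \<Longrightarrow> h (x \<otimes>\<^bsub>A\<^esub> y) = h x \<otimes>\<^bsub>B\<^esub> h y"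
    and "h \<one>\<^bsub>A\<^esub> = \<one>\<^bsub>B\<^esub>"
  shows "h \<in> alg_hom A B"
  using assms by (auto simp: alg_hom_iff)

lemma alg_hom_comp:
  assumes "g \<in> alg_hom B C" "f \<in> alg_hom A B"
  shows "(\<lambda>x. g (f x)) \<in> alg_hom A C"
  using assms lin_comp[of g B C f A] lin_closed[of f A B] by (auto simp: alg_hom_iff)

lemma id_lin: "id \<in> lin A A"
  by (auto simp: lin_def)

lemma id_alg_hom: "id \<in> alg_hom A A"
  by (auto simp: alg_hom_iff id_lin)

lemma complex_alg_simps [simp]:
  "carrier complex_alg = UNIV" "x \<otimes>\<^bsub>complex_alg\<^esub> y = x * y" "\<one>\<^bsub>complex_alg\<^esub> = 1"
  "x \<oplus>\<^bsub>complex_alg\<^esub> y = x + y" "\<zero>\<^bsub>complex_alg\<^esub> = 0" "x \<odot>\<^bsub>complex_alg\<^esub> y = x * y"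
  by (simp_all add: complex_alg_def)

lemma complex_calg: "calg complex_alg"
proof -
  have "ring complex_alg"
  proof (rule ringI)
    show "abelian_group complex_alg"
    proof (rule abelian_groupI)
      fix x :: complex
      show "\<exists>y\<in>carrier complex_alg. y \<oplus>\<^bsub>complex_alg\<^esub> x = \<zero>\<^bsub>complex_alg\<^esub>"
        by (rule bexI[of _ "- x"]) auto
    qed auto
    show "monoid complex_alg"
      by (rule monoidI) auto
  qed (auto simp: algebra_simps)
  then show ?thesis
    by (intro calg.intro calg_axioms.intro) (auto simp: algebra_simps)
qed


section \<open>Linear extension and monoid algebras\<close>

abbreviation (input) "supp \<equiv> Poly_Mapping.keys"
abbreviation (input) "coef \<equiv> Poly_Mapping.lookup"
abbreviation (input) "monom \<equiv> Poly_Mapping.single"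

lemma poly_mapping_eq_sum:
  fixes f :: "'m \<Rightarrow>\<^sub>0 complex"
  shows "f = (\<Sum>w\<in>supp f. monom w (coef f w))"
proof (rule poly_mapping_eqI)
  fix x
  show "coef f x =
    coef (\<Sum>w\<in>supp f. monom w (coef f w)) x"
    by (simp add: lookup_sum lookup_single when_def in_keys_iff)
qed

text \<open>
  Monomials span, so an additive property of formal linear combinations has to be checked on monomials only.
\<close>

lemma poly_mapping_span_induct:
  fixes f :: "'m \<Rightarrow>\<^sub>0 complex"
  assumes "supp f \<subseteq> K"
    and "P 0"
    and "\<And>w c. w \<in> K \<Longrightarrow> P (monom w c)"
    and "\<And>f g. supp f \<subseteq> K \<Longrightarrow> supp g \<subseteq> K \<Longrightarrow> P f \<Longrightarrow> P g \<Longrightarrow> P (f + g)"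
  shows "P f"
proof -
  have "supp (\<Sum>w\<in>S. monom w (coef f w)) \<subseteq> K \<and>
     P (\<Sum>w\<in>S. monom w (coef f w))" if "finite S" "S \<subseteq> K" for S
    using that
  proof (induction S)
    case empty
    then show ?case using assms(2) by simp
  next
    case (insert w S)
    have "supp (monom w (coef f w)) \<subseteq> K"
      using insert by auto
    then show ?case
      using insert keys_add[of "monom w (coef f w)"
          "\<Sum>w\<in>S. monom w (coef f w)"]
      by (auto intro!: assms(3,4) simp del: keys_single)
  qed
  from this[OF finite_keys assms(1)] show ?thesis
    using poly_mapping_eq_sum[of f] by simp
qed

abbreviation scale_pm :: "complex \<Rightarrow> ('m \<Rightarrow>\<^sub>0 complex) \<Rightarrow> ('m \<Rightarrow>\<^sub>0 complex)" where
  "scale_pm c \<equiv> Poly_Mapping.map ((*) c)"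

lemma lookup_scale_pm [simp]: "coef (scale_pm c f) w = c * coef f w"
  by (simp add: Poly_Mapping.map.rep_eq when_def)

lemma keys_scale_pm: "supp (scale_pm c f) \<subseteq> supp f"
  by (auto simp: in_keys_iff)

lemma scale_pm_zero [simp]: "scale_pm c 0 = 0"
  by (rule poly_mapping_eqI) simp

lemma scale_pm_minus_one: "scale_pm (- 1) f = - f"
  by (rule poly_mapping_eqI) simp

lemma scale_pm_add: "scale_pm c (f + g) = scale_pm c f + scale_pm c g"
  by (rule poly_mapping_eqI) (simp add: lookup_add algebra_simps)

lemma keys_add_subset: "supp f \<subseteq> K \<Longrightarrow> supp g \<subseteq> K \<Longrightarrow> supp (f + g) \<subseteq> K"
  using keys_add[of f g] by blast

lemma keys_minus_subset:
  fixes f g :: "'m \<Rightarrow>\<^sub>0 complex"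
  assumes "supp f \<subseteq> K" "supp g \<subseteq> K"
  shows "supp (f - g) \<subseteq> K"
  using assms keys_diff[of f g] by blast

lemma keys_sum_subset:
  fixes f :: "'i \<Rightarrow> 'm \<Rightarrow>\<^sub>0 complex"
  assumes "\<And>i. i \<in> I \<Longrightarrow> supp (f i) \<subseteq> K"
  shows "supp (\<Sum>i\<in>I. f i) \<subseteq> K"
  using assms keys_sum[of f I] by blast

text \<open>
  The linear extension of \<open>\<beta>\<close>; \<^const>\<open>quot_lift\<close> takes its common value on a coset (\<open>quot_lift_eq\<close>).
\<close>

definition lin_ext :: "(complex, 'v) module \<Rightarrow> ('m \<Rightarrow> 'v) \<Rightarrow> ('m \<Rightarrow>\<^sub>0 complex) \<Rightarrow> 'v" where
  "lin_ext V \<beta> f = (\<Oplus>\<^bsub>V\<^esub>w\<in>supp f. coef f w \<odot>\<^bsub>V\<^esub> \<beta> w)"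

lemma quot_lift_eq: "quot_lift V \<beta> Y = the_elem (lin_ext V \<beta> ` Y)"
  by (simp add: quot_lift_def lin_ext_def[abs_def])

context calg
begin

text \<open>
  Enlarging the index set lets linear combinations with different supports be added term by term.
\<close>

lemma lin_ext_superset:
  assumes "finite S" "supp f \<subseteq> S" "\<beta> \<in> S \<rightarrow> carrier A"
  shows "lin_ext A \<beta> f = (\<Oplus>w\<in>S. coef f w \<odot> \<beta> w)"
  unfolding lin_ext_def using assms
  by (intro finsum_subset) (auto simp: in_keys_iff Pi_def)

context
  fixes \<beta> :: "'m \<Rightarrow> 'a" and K
  assumes \<beta>: "\<beta> \<in> K \<rightarrow> carrier A"
begin

lemma lin_ext_closed: "supp f \<subseteq> K \<Longrightarrow> lin_ext A \<beta> f \<in> carrier A"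
  unfolding lin_ext_def using \<beta> by (intro finsum_closed) auto

lemma lin_ext_add:
  assumes "supp f \<subseteq> K" "supp g \<subseteq> K"
  shows "lin_ext A \<beta> (f + g) = lin_ext A \<beta> f \<oplus> lin_ext A \<beta> g"
proof -
  let ?S = "supp f \<union> supp g"
  have S: "finite ?S" "\<beta> \<in> ?S \<rightarrow> carrier A"
    using assms \<beta> by auto
  have "lin_ext A \<beta> (f + g) = (\<Oplus>w\<in>?S. coef (f + g) w \<odot> \<beta> w)"
    using S keys_add[of f g] by (intro lin_ext_superset) auto
  also have "\<dots> = (\<Oplus>w\<in>?S. coef f w \<odot> \<beta> w \<oplus> coef g w \<odot> \<beta> w)"
    using S by (intro finsum_cong') (auto simp: lookup_add smult_l_distr Pi_def)
  also have "\<dots> = (\<Oplus>w\<in>?S. coef f w \<odot> \<beta> w) \<oplus> (\<Oplus>w\<in>?S. coef g w \<odot> \<beta> w)"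
    using S by (intro finsum_addf) auto
  also have "\<dots> = lin_ext A \<beta> f \<oplus> lin_ext A \<beta> g"
    using S by (simp add: lin_ext_superset[of ?S])
  finally show ?thesis .
qed

lemma lin_ext_smult:
  assumes "supp f \<subseteq> K"
  shows "lin_ext A \<beta> (scale_pm c f) = c \<odot> lin_ext A \<beta> f"
proof -
  have S: "\<beta> \<in> supp f \<rightarrow> carrier A"
    using assms \<beta> by auto
  have "lin_ext A \<beta> (scale_pm c f) = (\<Oplus>w\<in>supp f. c \<odot> (coef f w \<odot> \<beta> w))"
    using S keys_scale_pm[of c f] lin_ext_superset[of "supp f" "scale_pm c f" \<beta>]
    by (auto simp: Pi_def intro!: finsum_cong')
  also have "\<dots> = c \<odot> lin_ext A \<beta> f"
    unfolding lin_ext_def using S by (intro smult_finsum[symmetric]) auto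
  finally show ?thesis .
qed

lemma lin_ext_single: "w \<in> K \<Longrightarrow> lin_ext A \<beta> (monom w c) = c \<odot> \<beta> w"
  using \<beta> lin_ext_superset[of "{w}" "monom w c" \<beta>] by (auto simp: Pi_def)

lemma lin_ext_zero [simp]: "lin_ext A \<beta> 0 = \<zero>"
  by (simp add: lin_ext_def)

lemma lin_ext_diff:
  assumes "supp f \<subseteq> K" "supp g \<subseteq> K"
  shows "lin_ext A \<beta> (f - g) = lin_ext A \<beta> f \<ominus> lin_ext A \<beta> g"
proof -
  have "lin_ext A \<beta> (f + scale_pm (- 1) g) = lin_ext A \<beta> f \<oplus> (- 1) \<odot> lin_ext A \<beta> g"
    using assms keys_scale_pm[of "- 1" g] by (subst lin_ext_add) (auto simp: lin_ext_smult)
  then show ?thesis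
    using assms by (simp add: scale_pm_minus_one smult_minus_one lin_ext_closed a_minus_def)
qed

lemma lin_ext_sum:
  assumes "\<And>i. i \<in> I \<Longrightarrow> supp (f i) \<subseteq> K"
  shows "lin_ext A \<beta> (\<Sum>i\<in>I. f i) = (\<Oplus>i\<in>I. lin_ext A \<beta> (f i))"
  using assms
proof (induction I rule: infinite_finite_induct)
  case (insert i F)
  then have "lin_ext A \<beta> (\<Sum>i\<in>insert i F. f i) = lin_ext A \<beta> (f i) \<oplus> lin_ext A \<beta> (\<Sum>i\<in>F. f i)"
    using keys_sum_subset[of F f K] by (simp add: lin_ext_add)
  then show ?case
    using insert by (simp add: Pi_def lin_ext_closed)
qed (simp_all add: finsum_infinite)

end

end

lemma monoid_alg_simps [simp]:
  "carrier (monoid_alg M) = {f. supp f \<subseteq> carrier M}"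
  "\<one>\<^bsub>monoid_alg M\<^esub> = monom \<one>\<^bsub>M\<^esub> 1"
  "\<zero>\<^bsub>monoid_alg M\<^esub> = 0"
  "f \<oplus>\<^bsub>monoid_alg M\<^esub> g = f + g"
  "c \<odot>\<^bsub>monoid_alg M\<^esub> f = scale_pm c f"
  by (simp_all add: monoid_alg_def)

lemma monoid_alg_mult_superset:
  assumes "finite S" "finite T" "supp f \<subseteq> S" "supp g \<subseteq> T"
  shows "f \<otimes>\<^bsub>monoid_alg M\<^esub> g = (\<Sum>x\<in>S. \<Sum>y\<in>T.
    monom (x \<otimes>\<^bsub>M\<^esub> y) (coef f x * coef g y))"
proof -
  have "f \<otimes>\<^bsub>monoid_alg M\<^esub> g = (\<Sum>x\<in>supp f. \<Sum>y\<in>supp g.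
    monom (x \<otimes>\<^bsub>M\<^esub> y) (coef f x * coef g y))"
    by (simp add: monoid_alg_def)
  also have "\<dots> = (\<Sum>x\<in>supp f. \<Sum>y\<in>T.
    monom (x \<otimes>\<^bsub>M\<^esub> y) (coef f x * coef g y))"
    using assms by (intro sum.cong sum.mono_neutral_left refl) (auto simp: in_keys_iff)
  also have "\<dots> = (\<Sum>x\<in>S. \<Sum>y\<in>T.
    monom (x \<otimes>\<^bsub>M\<^esub> y) (coef f x * coef g y))"
    using assms by (intro sum.mono_neutral_left) (auto simp: in_keys_iff)
  finally show ?thesis .
qed

lemma monoid_alg_mult_single [simp]:
  "monom x a \<otimes>\<^bsub>monoid_alg M\<^esub> monom y b = monom (x \<otimes>\<^bsub>M\<^esub> y) (a * b)"
  by (subst monoid_alg_mult_superset[of "{x}" "{y}"]) auto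

lemma monoid_alg_add_left:
  "(f + f') \<otimes>\<^bsub>monoid_alg M\<^esub> g = f \<otimes>\<^bsub>monoid_alg M\<^esub> g + f' \<otimes>\<^bsub>monoid_alg M\<^esub> g"
  using keys_add[of f f']
  by (simp add: monoid_alg_mult_superset[of "supp f \<union> supp f'" "supp g"]
      lookup_add algebra_simps single_add sum.distrib)

lemma monoid_alg_add_right:
  "f \<otimes>\<^bsub>monoid_alg M\<^esub> (g + g') = f \<otimes>\<^bsub>monoid_alg M\<^esub> g + f \<otimes>\<^bsub>monoid_alg M\<^esub> g'"
  using keys_add[of g g']
  by (simp add: monoid_alg_mult_superset[of "supp f" "supp g \<union> supp g'"]
      lookup_add algebra_simps single_add sum.distrib)

lemma monoid_alg_mult_zero [simp]: "0 \<otimes>\<^bsub>monoid_alg M\<^esub> g = 0" "g \<otimes>\<^bsub>monoid_alg M\<^esub> 0 = 0"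
  by (simp_all add: monoid_alg_def)

lemma scale_pm_sum: "scale_pm c (\<Sum>i\<in>I. f i) = (\<Sum>i\<in>I. scale_pm c (f i))"
  by (induction I rule: infinite_finite_induct) (auto simp: scale_pm_add)

lemma scale_pm_single [simp]: "scale_pm c (monom w d) = monom w (c * d)"
  by (rule poly_mapping_eqI) (simp add: lookup_single when_def)

lemma monoid_alg_scale_left:
  "scale_pm c f \<otimes>\<^bsub>monoid_alg M\<^esub> g = scale_pm c (f \<otimes>\<^bsub>monoid_alg M\<^esub> g)"
  using keys_scale_pm[of c f]
  by (simp add: monoid_alg_mult_superset[of "supp f" "supp g"] scale_pm_sum mult_ac)

lemma monoid_alg_scale_right:
  "f \<otimes>\<^bsub>monoid_alg M\<^esub> scale_pm c g = scale_pm c (f \<otimes>\<^bsub>monoid_alg M\<^esub> g)"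
  using keys_scale_pm[of c g]
  by (simp add: monoid_alg_mult_superset[of "supp f" "supp g"] scale_pm_sum mult_ac)

text \<open>
  Associativity and the unit laws are multilinear, and for monomials they are the laws of the monoid.
\<close>

lemma monoid_alg_calg:
  assumes "monoid M"
  shows "calg (monoid_alg M)"
proof -
  interpret monoid M by fact
  let ?A = "monoid_alg M"
  have closed: "supp (f \<otimes>\<^bsub>?A\<^esub> g) \<subseteq> carrier M"
    if "supp f \<subseteq> carrier M" "supp g \<subseteq> carrier M" for f g
    unfolding monoid_alg_mult_superset[OF finite_keys finite_keys order_refl order_refl]
    using that by (intro keys_sum_subset) auto
  have "ring ?A"
  proof (rule ringI)
    show "abelian_group ?A"
    proof (rule abelian_groupI)
      fix f
      assume "f \<in> carrier ?A"
      then show "\<exists>g\<in>carrier ?A. g \<oplus>\<^bsub>?A\<^esub> f = \<zero>\<^bsub>?A\<^esub>"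
        by (intro bexI[of _ "- f"]) auto
    qed (auto simp: keys_add_subset add_ac dest: subsetD[OF keys_add])
    show "monoid ?A"
    proof (rule monoidI)
      fix f g h
      assume fgh: "f \<in> carrier ?A" "g \<in> carrier ?A" "h \<in> carrier ?A"
      show "f \<otimes>\<^bsub>?A\<^esub> g \<in> carrier ?A"
        using closed fgh by auto
      show "f \<otimes>\<^bsub>?A\<^esub> g \<otimes>\<^bsub>?A\<^esub> h = f \<otimes>\<^bsub>?A\<^esub> (g \<otimes>\<^bsub>?A\<^esub> h)"
      proof (rule poly_mapping_span_induct[of f "carrier M"])
        fix x and a :: complex assume x: "x \<in> carrier M"
        let ?f = "monom x a"
        show "?f \<otimes>\<^bsub>?A\<^esub> g \<otimes>\<^bsub>?A\<^esub> h = ?f \<otimes>\<^bsub>?A\<^esub> (g \<otimes>\<^bsub>?A\<^esub> h)"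
        proof (rule poly_mapping_span_induct[of g "carrier M"])
          fix y and b :: complex assume y: "y \<in> carrier M"
          let ?g = "monom y b"
          show "?f \<otimes>\<^bsub>?A\<^esub> ?g \<otimes>\<^bsub>?A\<^esub> h = ?f \<otimes>\<^bsub>?A\<^esub> (?g \<otimes>\<^bsub>?A\<^esub> h)"
            by (rule poly_mapping_span_induct[of h "carrier M"])
              (use fgh x y in \<open>auto simp: monoid_alg_add_right m_assoc mult_ac\<close>)
        qed (use fgh in \<open>auto simp: monoid_alg_add_left monoid_alg_add_right\<close>)
      qed (use fgh in \<open>auto simp: monoid_alg_add_left\<close>)
      show "\<one>\<^bsub>?A\<^esub> \<otimes>\<^bsub>?A\<^esub> f = f" "f \<otimes>\<^bsub>?A\<^esub> \<one>\<^bsub>?A\<^esub> = f"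
        by (rule poly_mapping_span_induct[of f "carrier M"];
            use fgh in \<open>auto simp: monoid_alg_add_right monoid_alg_add_left\<close>)+
    qed auto
  qed (auto simp: monoid_alg_add_left monoid_alg_add_right)
  moreover have "scale_pm (c + d) f = scale_pm c f + scale_pm d f" for c d and f :: "'a \<Rightarrow>\<^sub>0 complex"
    by (rule poly_mapping_eqI) (simp add: lookup_add algebra_simps)
  moreover have "scale_pm c (scale_pm d f) = scale_pm (c * d) f" "scale_pm 1 f = f"
    for c d and f :: "'a \<Rightarrow>\<^sub>0 complex"
    by (rule poly_mapping_eqI; simp add: algebra_simps)+
  ultimately show ?thesis
    by (intro calg.intro calg_axioms.intro)
      (auto simp: scale_pm_add monoid_alg_scale_left monoid_alg_scale_right dest: subsetD[OF keys_scale_pm])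
qed

lemma lin_ext_lin:
  assumes "calg V" "\<beta> \<in> carrier M \<rightarrow> carrier V"
  shows "lin_ext V \<beta> \<in> lin (monoid_alg M) V"
  using calg.lin_ext_closed[OF assms] calg.lin_ext_add[OF assms] calg.lin_ext_smult[OF assms]
  by (intro linI) auto

lemma lin_ext_alg_hom:
  assumes V: "calg V" and M: "monoid M" and \<beta>: "\<beta> \<in> carrier M \<rightarrow> carrier V"
    and mult: "\<And>x y. x \<in> carrier M \<Longrightarrow> y \<in> carrier M \<Longrightarrow> \<beta> (x \<otimes>\<^bsub>M\<^esub> y) = \<beta> x \<otimes>\<^bsub>V\<^esub> \<beta> y"
    and one: "\<beta> \<one>\<^bsub>M\<^esub> = \<one>\<^bsub>V\<^esub>"
  shows "lin_ext V \<beta> \<in> alg_hom (monoid_alg M) V"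
proof (rule alg_homI)
  interpret V: calg V by fact
  interpret M: monoid M by fact
  interpret A: calg "monoid_alg M" by (rule monoid_alg_calg) fact
  note ext [simp] = V.lin_ext_add[OF \<beta>] V.lin_ext_single[OF \<beta>] V.lin_ext_closed[OF \<beta>]
  show "lin_ext V \<beta> \<in> lin (monoid_alg M) V"
    by (rule lin_ext_lin) fact+
  show "lin_ext V \<beta> \<one>\<^bsub>monoid_alg M\<^esub> = \<one>\<^bsub>V\<^esub>"
    by (simp add: one)
  fix f g
  assume fg: "f \<in> carrier (monoid_alg M)" "g \<in> carrier (monoid_alg M)"
  have closed: "supp (f \<otimes>\<^bsub>monoid_alg M\<^esub> g) \<subseteq> carrier M"
    if "supp f \<subseteq> carrier M" "supp g \<subseteq> carrier M" for f g
    using A.m_closed[of f g] that by simp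
  show "lin_ext V \<beta> (f \<otimes>\<^bsub>monoid_alg M\<^esub> g) = lin_ext V \<beta> f \<otimes>\<^bsub>V\<^esub> lin_ext V \<beta> g"
  proof (rule poly_mapping_span_induct[of f "carrier M"])
    fix x and a :: complex assume x: "x \<in> carrier M"
    let ?f = "monom x a"
    have kf: "supp ?f \<subseteq> carrier M" using x by auto
    show "lin_ext V \<beta> (?f \<otimes>\<^bsub>monoid_alg M\<^esub> g) = lin_ext V \<beta> ?f \<otimes>\<^bsub>V\<^esub> lin_ext V \<beta> g"
    proof (rule poly_mapping_span_induct[of g "carrier M"])
      fix y and b :: complex assume y: "y \<in> carrier M"
      then show "lin_ext V \<beta> (?f \<otimes>\<^bsub>monoid_alg M\<^esub> monom y b) =
          lin_ext V \<beta> ?f \<otimes>\<^bsub>V\<^esub> lin_ext V \<beta> (monom y b)"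
        using x \<beta> by (simp add: mult V.smult_mult_left V.smult_mult_right Pi_def mult.commute[of a b])
    qed (use fg x \<beta> kf closed in \<open>auto simp: monoid_alg_add_right V.r_distr V.lin_ext_zero[OF \<beta>] Pi_def\<close>)
  qed (use fg closed in \<open>auto simp: monoid_alg_add_left V.l_distr V.lin_ext_zero[OF \<beta>]\<close>)
qed

section \<open>Quotient algebras\<close>

lemma quot_alg_fields:
  "carrier (quot_alg A X) = a_rcosets\<^bsub>A\<^esub> (Idl\<^bsub>A\<^esub> X)"
  "Y \<otimes>\<^bsub>quot_alg A X\<^esub> Z = rcoset_mult A (Idl\<^bsub>A\<^esub> X) Y Z"
  "\<one>\<^bsub>quot_alg A X\<^esub> = quot_class A X \<one>\<^bsub>A\<^esub>"
  "\<zero>\<^bsub>quot_alg A X\<^esub> = Idl\<^bsub>A\<^esub> X"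
  "Y \<oplus>\<^bsub>quot_alg A X\<^esub> Z = Y <+>\<^bsub>A\<^esub> Z"
  "c \<odot>\<^bsub>quot_alg A X\<^esub> Y = (\<Union>y\<in>Y. quot_class A X (c \<odot>\<^bsub>A\<^esub> y))"
  by (simp_all add: quot_alg_def quot_class_def FactRing_def ring.defs module.defs)

context calg
begin

context
  fixes X
  assumes X: "X \<subseteq> carrier A"
begin

interpretation I: ideal "Idl X" A
  by (rule genideal_ideal[OF X])

text \<open>
  Scalars act through multiples of the unit: \<open>c x = (c 1) x\<close>.
\<close>

lemma genideal_smult: "x \<in> Idl X \<Longrightarrow> c \<odot> x \<in> Idl X"
  using I.I_l_closed[of x "c \<odot> \<one>"] I.a_Hcarr[of x] by (simp add: smult_mult_left)

lemma quot_class_eqI: "x \<in> carrier A \<Longrightarrow> y \<in> carrier A \<Longrightarrow> x \<ominus> y \<in> Idl X \<Longrightarrow> quot_class A X x = quot_class A X y"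
  unfolding quot_class_def
  using I.a_rcos_module_rev[of y x] a_repr_independence[of x "Idl X" y] I.a_subgroup
  by (simp add: a_minus_def)

lemma quot_class_self: "x \<in> carrier A \<Longrightarrow> x \<in> quot_class A X x"
  unfolding quot_class_def by (rule I.a_rcos_self)

lemma quot_class_memD: "x \<in> carrier A \<Longrightarrow> y \<in> quot_class A X x \<Longrightarrow> y \<in> carrier A \<and> y \<ominus> x \<in> Idl X"
  unfolding quot_class_def
  using I.a_rcos_module_imp[of x y] I.a_elemrcos_carrier[of x y] by (simp add: a_minus_def)

lemma quot_carrier: "carrier (quot_alg A X) = quot_class A X ` carrier A"
  by (auto simp: quot_alg_fields A_RCOSETS_def' quot_class_def)

lemma quot_class_mult:
  "x \<in> carrier A \<Longrightarrow> y \<in> carrier A \<Longrightarrow>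
   quot_class A X x \<otimes>\<^bsub>quot_alg A X\<^esub> quot_class A X y = quot_class A X (x \<otimes> y)"
  by (simp add: quot_alg_fields quot_class_def I.rcoset_mult_add)

lemma quot_class_add:
  "x \<in> carrier A \<Longrightarrow> y \<in> carrier A \<Longrightarrow>
   quot_class A X x \<oplus>\<^bsub>quot_alg A X\<^esub> quot_class A X y = quot_class A X (x \<oplus> y)"
  by (simp add: quot_alg_fields quot_class_def I.a_rcos_sum)

lemma quot_class_smult:
  assumes "x \<in> carrier A"
  shows "c \<odot>\<^bsub>quot_alg A X\<^esub> quot_class A X x = quot_class A X (c \<odot> x)"
proof -
  have "quot_class A X (c \<odot> y) = quot_class A X (c \<odot> x)" if y: "y \<in> quot_class A X x" for y
  proof (rule quot_class_eqI)
    have *: "y \<in> carrier A" "y \<ominus> x \<in> Idl X"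
      using quot_class_memD[OF assms y] by auto
    then have "c \<odot> (y \<ominus> x) = c \<odot> y \<ominus> c \<odot> x"
      using assms smult_uminus[of x c] smult_smult[of x c "- 1"]
      by (simp add: a_minus_def smult_r_distr smult_minus_one)
    then show "c \<odot> y \<ominus> c \<odot> x \<in> Idl X"
      using genideal_smult[OF *(2), of c] by simp
  qed (use assms quot_class_memD[OF assms y] in auto)
  then have "(\<Union>y\<in>quot_class A X x. quot_class A X (c \<odot> y)) = (\<Union>y\<in>quot_class A X x. quot_class A X (c \<odot> x))"
    by (rule SUP_cong[OF refl])
  then show ?thesis
    unfolding quot_alg_fields using quot_class_self[OF assms] by blast
qed

lemma quot_class_zero: "quot_class A X \<zero> = \<zero>\<^bsub>quot_alg A X\<^esub>"
  unfolding quot_alg_fields quot_class_def by (rule I.a_rcos_const) (rule I.zero_closed)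

lemma quot_class_rel:
  assumes "x \<in> X"
  shows "quot_class A X x = \<zero>\<^bsub>quot_alg A X\<^esub>"
  unfolding quot_alg_fields quot_class_def
  using genideal_self[OF X] assms by (intro I.a_rcos_const) auto

end

context
  fixes X
  assumes X: "X \<subseteq> carrier A"
begin

lemmas quot_facts = quot_carrier[OF X] quot_class_mult[OF X] quot_class_add[OF X] quot_class_smult[OF X]
  quot_class_zero[OF X, symmetric] quot_alg_fields(3)

lemma quot_calg: "calg (quot_alg A X)"
proof -
  let ?Q = "quot_alg A X"
  have "ring ?Q"
  proof (rule ringI)
    show "abelian_group ?Q"
    proof (rule abelian_groupI)
      fix Y
      assume "Y \<in> carrier ?Q"
      then obtain y where y: "y \<in> carrier A" "Y = quot_class A X y"
        by (auto simp: quot_facts)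
      then show "\<exists>Z\<in>carrier ?Q. Z \<oplus>\<^bsub>?Q\<^esub> Y = \<zero>\<^bsub>?Q\<^esub>"
        by (intro bexI[of _ "quot_class A X (\<ominus> y)"]) (auto simp: quot_facts l_neg)
    qed (auto simp: quot_facts a_ac)
    show "monoid ?Q"
      by (rule monoidI) (auto simp: quot_facts m_assoc)
  qed (auto simp: quot_facts l_distr r_distr)
  then show ?thesis
    by (intro calg.intro calg_axioms.intro)
      (auto simp: quot_facts smult_l_distr smult_r_distr smult_mult_left smult_mult_right)
qed

lemma quot_class_alg_hom: "quot_class A X \<in> alg_hom A (quot_alg A X)"
  by (intro alg_homI linI)
    (auto simp: quot_facts)

text \<open>
  A linear map that vanishes on the ideal is constant on each coset, with the value at any representative.
\<close>

lemma quot_lift_class: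
  assumes V: "calg V" and h: "h \<in> lin A V" and ker: "\<And>x. x \<in> Idl X \<Longrightarrow> h x = \<zero>\<^bsub>V\<^esub>" and x: "x \<in> carrier A"
  shows "the_elem (h ` quot_class A X x) = h x"
proof -
  interpret V: calg V by fact
  have "h y = h x" if y: "y \<in> quot_class A X x" for y
  proof -
    have *: "y \<in> carrier A" "y \<ominus> x \<in> Idl X"
      using quot_class_memD[OF X x y] by auto
    have "h ((y \<ominus> x) \<oplus> x) = h (y \<ominus> x) \<oplus>\<^bsub>V\<^esub> h x"
      using * x by (intro lin_add[OF h]) auto
    moreover have "(y \<ominus> x) \<oplus> x = y"
      using * x by (simp add: a_minus_def a_assoc l_neg)
    ultimately have "h y = \<zero>\<^bsub>V\<^esub> \<oplus>\<^bsub>V\<^esub> h x"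
      using ker[OF *(2)] by metis
    then show ?thesis
      using V.l_zero[OF lin_closed[OF h x]] by metis
  qed
  then have "h ` quot_class A X x = (\<lambda>y. h x) ` quot_class A X x"
    by (rule image_cong[OF refl])
  then have "h ` quot_class A X x = {h x}"
    using quot_class_self[OF X x] by blast
  then show ?thesis
    by simp
qed

lemma quot_lift_lin:
  assumes V: "calg V" and h: "h \<in> lin A V" and ker: "\<And>x. x \<in> Idl X \<Longrightarrow> h x = \<zero>\<^bsub>V\<^esub>"
  shows "(\<lambda>Y. the_elem (h ` Y)) \<in> lin (quot_alg A X) V"
  by (intro linI)
    (auto simp: quot_facts quot_lift_class[OF assms]
      lin_closed[OF h] lin_add[OF h] lin_smult[OF h])

lemma quot_lift_alg_hom:
  assumes V: "calg V" and h: "h \<in> alg_hom A V" and ker: "\<And>x. x \<in> Idl X \<Longrightarrow> h x = \<zero>\<^bsub>V\<^esub>"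
  shows "(\<lambda>Y. the_elem (h ` Y)) \<in> alg_hom (quot_alg A X) V"
  using quot_lift_lin[OF V alg_hom_lin[OF h] ker] quot_lift_class[OF V alg_hom_lin[OF h] ker]
  by (intro alg_homI)
    (auto simp: quot_facts alg_hom_mult[OF h] alg_hom_one[OF h])

text \<open>
  For a homomorphism the kernel is an ideal, so it is enough to kill the generators.
\<close>

lemma alg_hom_kills_genideal:
  assumes V: "calg V" and h: "h \<in> alg_hom A V" and ker: "\<And>x. x \<in> X \<Longrightarrow> h x = \<zero>\<^bsub>V\<^esub>" and x: "x \<in> Idl X"
  shows "h x = \<zero>\<^bsub>V\<^esub>"
proof -
  interpret V: calg V by fact
  note l = alg_hom_lin[OF h]
  let ?K = "{x \<in> carrier A. h x = \<zero>\<^bsub>V\<^esub>}"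
  have "ideal ?K A"
  proof (rule idealI)
    show "subgroup ?K (add_monoid A)"
      by (rule add.subgroupI)
        (auto simp: lin_add[OF l] lin_zero[OF calg_axioms V l] lin_uminus[OF calg_axioms V l]
          simp flip: a_inv_def intro!: exI[of _ \<zero>])
  qed (auto simp: ring_axioms alg_hom_mult[OF h] lin_closed[OF l])
  then have "Idl X \<subseteq> ?K"
    by (rule genideal_minimal) (use X ker in auto)
  with x show ?thesis
    by auto
qed

end

end


section \<open>Tensor products\<close>

definition bilin :: "(complex, 'a) module \<Rightarrow> (complex, 'b) module \<Rightarrow> (complex, 'v) module \<Rightarrow> ('a \<Rightarrow> 'b \<Rightarrow> 'v) set" where
  "bilin A B V = {\<beta>. (\<forall>a\<in>carrier A. \<beta> a \<in> lin B V) \<and> (\<forall>b\<in>carrier B. (\<lambda>a. \<beta> a b) \<in> lin A V)}"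

lemma bilinI:
  assumes "\<And>a. a \<in> carrier A \<Longrightarrow> \<beta> a \<in> lin B V" "\<And>b. b \<in> carrier B \<Longrightarrow> (\<lambda>a. \<beta> a b) \<in> lin A V"
  shows "\<beta> \<in> bilin A B V"
  using assms by (simp add: bilin_def)

lemma bilin_right: "\<beta> \<in> bilin A B V \<Longrightarrow> a \<in> carrier A \<Longrightarrow> \<beta> a \<in> lin B V"
  and bilin_left: "\<beta> \<in> bilin A B V \<Longrightarrow> b \<in> carrier B \<Longrightarrow> (\<lambda>a. \<beta> a b) \<in> lin A V"
  by (simp_all add: bilin_def)

lemma (in calg) lin_mult:
  "p \<in> carrier A \<Longrightarrow> (\<lambda>x. p \<otimes> x) \<in> lin A A" "p \<in> carrier A \<Longrightarrow> (\<lambda>x. x \<otimes> p) \<in> lin A A"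
  by (auto intro!: linI simp: r_distr l_distr smult_mult_left smult_mult_right)

lemma lin_scale:
  assumes "calg V" "h \<in> lin A V"
  shows "(\<lambda>x. c \<odot>\<^bsub>V\<^esub> h x) \<in> lin A V"
proof -
  interpret calg V by fact
  show ?thesis
    using assms(2) by (intro linI) (auto simp: lin_closed lin_add lin_smult smult_r_distr mult.commute)
qed

text \<open>
  Multiplication by a monomial translates the argument of \<open>\<beta>\<close>; this is how linear functionals see the ideal
  structure.
\<close>

lemma lin_ext_mult_single:
  assumes V: "calg V" and M: "monoid M" and \<beta>: "\<beta> \<in> carrier M \<rightarrow> carrier V"
    and p: "p \<in> carrier M" and f: "supp f \<subseteq> carrier M"
  shows "lin_ext V \<beta> (monom p c \<otimes>\<^bsub>monoid_alg M\<^esub> f) = lin_ext V (\<lambda>m. c \<odot>\<^bsub>V\<^esub> \<beta> (p \<otimes>\<^bsub>M\<^esub> m)) f"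
    and "lin_ext V \<beta> (f \<otimes>\<^bsub>monoid_alg M\<^esub> monom p c) = lin_ext V (\<lambda>m. c \<odot>\<^bsub>V\<^esub> \<beta> (m \<otimes>\<^bsub>M\<^esub> p)) f"
proof -
  interpret V: calg V by fact
  interpret M: monoid M by fact
  interpret A: calg "monoid_alg M" by (rule monoid_alg_calg) fact
  let ?p = "monom p c"
  have \<beta>': "(\<lambda>m. c \<odot>\<^bsub>V\<^esub> \<beta> (p \<otimes>\<^bsub>M\<^esub> m)) \<in> carrier M \<rightarrow> carrier V"
    "(\<lambda>m. c \<odot>\<^bsub>V\<^esub> \<beta> (m \<otimes>\<^bsub>M\<^esub> p)) \<in> carrier M \<rightarrow> carrier V"
    using \<beta> p by auto
  have keys: "supp (?p \<otimes>\<^bsub>monoid_alg M\<^esub> g) \<subseteq> carrier M"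
    "supp (g \<otimes>\<^bsub>monoid_alg M\<^esub> ?p) \<subseteq> carrier M" if "supp g \<subseteq> carrier M" for g
    using A.m_closed[of ?p g] A.m_closed[of g ?p] that p by auto
  show "lin_ext V \<beta> (?p \<otimes>\<^bsub>monoid_alg M\<^esub> f) = lin_ext V (\<lambda>m. c \<odot>\<^bsub>V\<^esub> \<beta> (p \<otimes>\<^bsub>M\<^esub> m)) f"
    by (rule poly_mapping_span_induct[OF f])
      (use p \<beta> in \<open>auto simp: V.lin_ext_zero[OF \<beta>] V.lin_ext_zero[OF \<beta>'(1)] V.lin_ext_single[OF \<beta>]
        V.lin_ext_single[OF \<beta>'(1)] monoid_alg_add_right V.lin_ext_add[OF \<beta>] V.lin_ext_add[OF \<beta>'(1)] keys
        mult.commute Pi_def\<close>)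
  show "lin_ext V \<beta> (f \<otimes>\<^bsub>monoid_alg M\<^esub> ?p) = lin_ext V (\<lambda>m. c \<odot>\<^bsub>V\<^esub> \<beta> (m \<otimes>\<^bsub>M\<^esub> p)) f"
    by (rule poly_mapping_span_induct[OF f])
      (use p \<beta> in \<open>auto simp: V.lin_ext_zero[OF \<beta>] V.lin_ext_zero[OF \<beta>'(2)] V.lin_ext_single[OF \<beta>]
        V.lin_ext_single[OF \<beta>'(2)] monoid_alg_add_left V.lin_ext_add[OF \<beta>] V.lin_ext_add[OF \<beta>'(2)] keys
        mult.commute Pi_def\<close>)
qed

locale two_calgs = A: calg A + B: calg B for A :: "(complex, 'a) module" and B :: "(complex, 'b) module"
begin

abbreviation (input) "AB \<equiv> A \<times>\<times> B"
abbreviation (input) "rels \<equiv> bilinearity_rels A B"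
abbreviation (input) "AT \<equiv> tensor_alg A B"

lemma monoid_AB: "monoid AB"
  by (rule DirProd_monoid) (rule A.is_monoid B.is_monoid)+

sublocale M: calg "monoid_alg AB"
  by (rule monoid_alg_calg) (rule monoid_AB)

lemma rels_closed: "rels \<subseteq> carrier (monoid_alg AB)"
  unfolding bilinearity_rels_def
  by (auto dest!: subsetD[OF keys_diff] split: if_splits)

sublocale T: calg "AT"
  unfolding tensor_alg_def by (rule M.quot_calg) (rule rels_closed)

lemma class_hom: "quot_class (monoid_alg AB) rels \<in> alg_hom (monoid_alg AB) AT"
  unfolding tensor_alg_def by (rule M.quot_class_alg_hom) (rule rels_closed)

lemma tens_closed [simp, intro]: "a \<in> carrier A \<Longrightarrow> b \<in> carrier B \<Longrightarrow> tens A B a b \<in> carrier AT"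
  unfolding tens_def by (rule lin_closed[OF alg_hom_lin[OF class_hom]]) auto

lemma class_eqI:
  assumes "x \<in> carrier (monoid_alg AB)" "y \<in> carrier (monoid_alg AB)" "x - y \<in> rels"
  shows "quot_class (monoid_alg AB) rels x = quot_class (monoid_alg AB) rels y"
proof -
  have "\<ominus>\<^bsub>monoid_alg AB\<^esub> y = - y"
    using M.smult_minus_one[OF assms(2)] by (simp add: scale_pm_minus_one)
  then have "x \<ominus>\<^bsub>monoid_alg AB\<^esub> y = x - y"
    by (simp add: a_minus_def)
  then show ?thesis
    using assms M.genideal_self[OF rels_closed] by (intro M.quot_class_eqI rels_closed) auto
qed

lemma tens_bilin: "tens A B \<in> bilin A B AT"
proof -
  note l = alg_hom_lin[OF class_hom]
  let ?s = "\<lambda>a b. monom (a, b) (1::complex)" and ?q = "quot_class (monoid_alg AB) rels"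
  have add: "?q x \<oplus>\<^bsub>AT\<^esub> ?q y = ?q (x + y)"
    if "x \<in> carrier (monoid_alg AB)" "y \<in> carrier (monoid_alg AB)" for x y
    using lin_add[OF l that] by simp
  have smult: "c \<odot>\<^bsub>AT\<^esub> ?q x = ?q (scale_pm c x)" if "x \<in> carrier (monoid_alg AB)" for x c
    using lin_smult[OF l that] by simp
  have closed: "?s a b + ?s a' b' \<in> carrier (monoid_alg AB)" "monom (a, b) c \<in> carrier (monoid_alg AB)"
    if "a \<in> carrier A" "b \<in> carrier B" "a' \<in> carrier A" "b' \<in> carrier B" for a b a' b' c
    using that keys_add_subset[of "?s a b" "carrier AB" "?s a' b'"] by auto
  show ?thesis
  proof (intro bilinI linI)
    fix a b b' assume *: "a \<in> carrier A" "b \<in> carrier B" "b' \<in> carrier B"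
    have "?q (?s a (b \<oplus>\<^bsub>B\<^esub> b')) = ?q (?s a b + ?s a b')"
      using * by (intro class_eqI closed) (auto simp: bilinearity_rels_def diff_diff_eq)
    then show "tens A B a (b \<oplus>\<^bsub>B\<^esub> b') = tens A B a b \<oplus>\<^bsub>AT\<^esub> tens A B a b'"
      using * by (simp add: tens_def add)
  next
    fix a a' b assume *: "a \<in> carrier A" "a' \<in> carrier A" "b \<in> carrier B"
    have "?q (?s (a \<oplus>\<^bsub>A\<^esub> a') b) = ?q (?s a b + ?s a' b)"
      using * by (intro class_eqI closed) (auto simp: bilinearity_rels_def diff_diff_eq)
    then show "tens A B (a \<oplus>\<^bsub>A\<^esub> a') b = tens A B a b \<oplus>\<^bsub>AT\<^esub> tens A B a' b"
      using * by (simp add: tens_def add)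
  next
    fix a b c assume *: "a \<in> carrier A" "b \<in> carrier B"
    have "?q (?s a (c \<odot>\<^bsub>B\<^esub> b)) = ?q (monom (a, b) c)"
      using * by (intro class_eqI closed) (auto simp: bilinearity_rels_def)
    then show "tens A B a (c \<odot>\<^bsub>B\<^esub> b) = c \<odot>\<^bsub>AT\<^esub> tens A B a b"
      using * by (simp add: tens_def smult)
  next
    fix a b c assume *: "a \<in> carrier A" "b \<in> carrier B"
    have "?q (?s (c \<odot>\<^bsub>A\<^esub> a) b) = ?q (monom (a, b) c)"
      using * by (intro class_eqI closed) (auto simp: bilinearity_rels_def)
    then show "tens A B (c \<odot>\<^bsub>A\<^esub> a) b = c \<odot>\<^bsub>AT\<^esub> tens A B a b"
      using * by (simp add: tens_def smult)
  qed auto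
qed

lemmas tens_lin_right = bilin_right[OF tens_bilin]
  and tens_lin_left = bilin_left[OF tens_bilin]

lemma tens_mult:
  assumes "a \<in> carrier A" "b \<in> carrier B" "a' \<in> carrier A" "b' \<in> carrier B"
  shows "tens A B a b \<otimes>\<^bsub>AT\<^esub> tens A B a' b' = tens A B (a \<otimes>\<^bsub>A\<^esub> a') (b \<otimes>\<^bsub>B\<^esub> b')"
  unfolding tens_def using assms by (subst alg_hom_mult[OF class_hom, symmetric]) auto

lemma tens_one: "tens A B \<one>\<^bsub>A\<^esub> \<one>\<^bsub>B\<^esub> = \<one>\<^bsub>AT\<^esub>"
  unfolding tens_def using alg_hom_one[OF class_hom] by simp

text \<open>
  Scalars can be absorbed into a factor, so pure tensors span the tensor product already additively.
\<close>

lemma tensor_induct: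
  assumes t: "t \<in> carrier AT"
    and tens: "\<And>a b. a \<in> carrier A \<Longrightarrow> b \<in> carrier B \<Longrightarrow> P (tens A B a b)"
    and add: "\<And>t t'. t \<in> carrier AT \<Longrightarrow> t' \<in> carrier AT \<Longrightarrow> P t \<Longrightarrow> P t' \<Longrightarrow>
      P (t \<oplus>\<^bsub>AT\<^esub> t')"
  shows "P t"
proof -
  note l = alg_hom_lin[OF class_hom]
  let ?q = "quot_class (monoid_alg AB) rels"
  obtain f where f: "f \<in> carrier (monoid_alg AB)" and t': "t = ?q f"
    using t M.quot_carrier[OF rels_closed] by (auto simp: tensor_alg_def)
  have single: "P (?q (monom w c))" if w': "w \<in> carrier AB" for w c
  proof -
    obtain a b where w: "w = (a, b)" "a \<in> carrier A" "b \<in> carrier B"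
      using w' by auto
    have "?q (monom w c) = tens A B (c \<odot>\<^bsub>A\<^esub> a) b"
      using w lin_smult[OF l, of "monom (a, b) 1" c] lin_smult[OF tens_lin_left, of b a c]
      by (simp add: tens_def)
    then show ?thesis
      using w tens by simp
  qed
  have "P (?q f)"
  proof (rule poly_mapping_span_induct[of f "carrier AB" "\<lambda>f. P (?q f)"])
    show "P (?q 0)"
      using single[of "(\<one>\<^bsub>A\<^esub>, \<one>\<^bsub>B\<^esub>)" 0] by simp
    show "P (?q (f + g))"
      if "supp f \<subseteq> carrier AB" "supp g \<subseteq> carrier AB" "P (?q f)" "P (?q g)" for f g
      using add[of "?q f" "?q g"] lin_add[OF l, of f g] lin_closed[OF l] that by simp
  qed (use f single in auto)
  then show ?thesis
    using t' by simp
qed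

lemma bilin_maps: "\<beta> \<in> bilin A B V \<Longrightarrow> (\<lambda>(a, b). \<beta> a b) \<in> carrier AB \<rightarrow> carrier V"
  using lin_closed[OF bilin_right, of \<beta> A B V] by auto

lemma bilin_kills_rels:
  assumes V: "calg V" and \<beta>: "\<beta> \<in> bilin A B V" and r: "r \<in> rels"
  shows "lin_ext V (\<lambda>(a, b). \<beta> a b) r = \<zero>\<^bsub>V\<^esub>"
proof -
  interpret V: calg V by fact
  note b = bilin_maps[OF \<beta>]
  have ext: "lin_ext V (\<lambda>(a, b). \<beta> a b) (monom (a, b) c) = c \<odot>\<^bsub>V\<^esub> \<beta> a b"
    if "a \<in> carrier A" "b \<in> carrier B" for a b c
    using V.lin_ext_single[OF b, of "(a, b)" c] that by auto
  have \<beta>_closed: "\<beta> a b \<in> carrier V" if "a \<in> carrier A" "b \<in> carrier B" for a b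
    using lin_closed[OF bilin_right[OF \<beta>]] that .
  note diff = V.lin_ext_diff[OF b] keys_minus_subset
  have cancel: "x \<oplus>\<^bsub>V\<^esub> (y \<oplus>\<^bsub>V\<^esub> (\<ominus>\<^bsub>V\<^esub> x \<oplus>\<^bsub>V\<^esub> \<ominus>\<^bsub>V\<^esub> y)) = \<zero>\<^bsub>V\<^esub>"
    if "x \<in> carrier V" "y \<in> carrier V" for x y
    using that V.r_neg[of "x \<oplus>\<^bsub>V\<^esub> y"] by (simp add: V.minus_add V.a_assoc)
  from r show ?thesis
    unfolding bilinearity_rels_def
    by (elim UnE CollectE exE conjE; hypsubst_thin)
      (simp_all add: diff ext \<beta>_closed lin_add[OF bilin_right[OF \<beta>]] lin_add[OF bilin_left[OF \<beta>]]
        lin_smult[OF bilin_right[OF \<beta>]] lin_smult[OF bilin_left[OF \<beta>]] a_minus_def V.a_assoc cancel V.r_neg)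
qed

text \<open>
  The tensor product divides by the two-sided ideal generated by the bilinearity relations, not by their
  linear span. The common kernel of the linear extensions of all bilinear maps is itself an ideal: if \<open>\<beta>\<close> is
  bilinear then so are \<open>(a, b) \<mapsto> \<beta> (p a) (r b)\<close> and \<open>(a, b) \<mapsto> \<beta> (a p) (b r)\<close>. As it contains the relations,
  it contains the ideal generated by them.
\<close>

lemma bilin_kills_ideal:
  assumes V: "calg V" and \<beta>: "\<beta> \<in> bilin A B V" and x: "x \<in> Idl\<^bsub>monoid_alg AB\<^esub> rels"
  shows "lin_ext V (\<lambda>(a, b). \<beta> a b) x = \<zero>\<^bsub>V\<^esub>"
proof -
  interpret V: calg V by fact
  let ?L = "\<lambda>\<beta>. lin_ext V (\<lambda>(a, b). \<beta> a b)"
  let ?K = "{f \<in> carrier (monoid_alg AB). \<forall>\<beta>\<in>bilin A B V. ?L \<beta> f = \<zero>\<^bsub>V\<^esub>}"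
  have L: "?L \<beta> \<in> lin (monoid_alg AB) V" if "\<beta> \<in> bilin A B V" for \<beta>
    by (rule lin_ext_lin[OF V bilin_maps[OF that]])
  note Ls = lin_zero[OF M.calg_axioms V L] lin_uminus[OF M.calg_axioms V L]
  have shift: "(\<lambda>a b. c \<odot>\<^bsub>V\<^esub> \<beta> (p \<otimes>\<^bsub>A\<^esub> a) (r \<otimes>\<^bsub>B\<^esub> b)) \<in> bilin A B V"
    "(\<lambda>a b. c \<odot>\<^bsub>V\<^esub> \<beta> (a \<otimes>\<^bsub>A\<^esub> p) (b \<otimes>\<^bsub>B\<^esub> r)) \<in> bilin A B V"
    if "\<beta> \<in> bilin A B V" "p \<in> carrier A" "r \<in> carrier B" for \<beta> c p r
    using that
    by (auto intro!: bilinI lin_scale[OF V] lin_comp[OF bilin_right[OF that(1)]]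
        lin_comp[OF bilin_left[OF that(1)]] A.lin_mult B.lin_mult)
  have closed: "supp (f \<otimes>\<^bsub>monoid_alg AB\<^esub> g) \<subseteq> carrier AB"
    if "supp f \<subseteq> carrier AB" "supp g \<subseteq> carrier AB" for f g
    using M.m_closed[of f g] that by simp
  have mult: "?L \<beta> (g \<otimes>\<^bsub>monoid_alg AB\<^esub> f) = \<zero>\<^bsub>V\<^esub>" "?L \<beta> (f \<otimes>\<^bsub>monoid_alg AB\<^esub> g) = \<zero>\<^bsub>V\<^esub>"
    if f: "f \<in> ?K" and g: "supp g \<subseteq> carrier AB" and \<beta>: "\<beta> \<in> bilin A B V" for f g \<beta>
  proof -
    have f': "supp f \<subseteq> carrier AB"
      using f by simp
    note b = bilin_maps[OF \<beta>]
    have single: "?L \<beta> (monom w c \<otimes>\<^bsub>monoid_alg AB\<^esub> f) = \<zero>\<^bsub>V\<^esub>"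
      "?L \<beta> (f \<otimes>\<^bsub>monoid_alg AB\<^esub> monom w c) = \<zero>\<^bsub>V\<^esub>" if w: "w \<in> carrier AB" for w c
    proof -
      obtain p r where pr: "w = (p, r)" "p \<in> carrier A" "r \<in> carrier B"
        using w by auto
      have *: "(\<lambda>m. c \<odot>\<^bsub>V\<^esub> (case w \<otimes>\<^bsub>AB\<^esub> m of (a, b) \<Rightarrow> \<beta> a b)) = (\<lambda>(a, b). c \<odot>\<^bsub>V\<^esub> \<beta> (p \<otimes>\<^bsub>A\<^esub> a) (r \<otimes>\<^bsub>B\<^esub> b))"
        "(\<lambda>m. c \<odot>\<^bsub>V\<^esub> (case m \<otimes>\<^bsub>AB\<^esub> w of (a, b) \<Rightarrow> \<beta> a b)) = (\<lambda>(a, b). c \<odot>\<^bsub>V\<^esub> \<beta> (a \<otimes>\<^bsub>A\<^esub> p) (b \<otimes>\<^bsub>B\<^esub> r))"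
        using pr by (auto simp: fun_eq_iff)
      show "?L \<beta> (monom w c \<otimes>\<^bsub>monoid_alg AB\<^esub> f) = \<zero>\<^bsub>V\<^esub>"
        "?L \<beta> (f \<otimes>\<^bsub>monoid_alg AB\<^esub> monom w c) = \<zero>\<^bsub>V\<^esub>"
        unfolding lin_ext_mult_single[OF V monoid_AB b w f'] *
        using f shift[OF \<beta> pr(2,3), of c] by auto
    qed
    show "?L \<beta> (g \<otimes>\<^bsub>monoid_alg AB\<^esub> f) = \<zero>\<^bsub>V\<^esub>"
      by (rule poly_mapping_span_induct[OF g])
        (use f' single in \<open>auto simp: monoid_alg_add_left closed V.lin_ext_add[OF b] V.lin_ext_zero[OF b]
          simp del: carrier_DirProd\<close>)
    show "?L \<beta> (f \<otimes>\<^bsub>monoid_alg AB\<^esub> g) = \<zero>\<^bsub>V\<^esub>"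
      by (rule poly_mapping_span_induct[OF g])
        (use f' single in \<open>auto simp: monoid_alg_add_right closed V.lin_ext_add[OF b] V.lin_ext_zero[OF b]
          simp del: carrier_DirProd\<close>)
  qed
  have "ideal ?K (monoid_alg AB)"
  proof (rule idealI)
    show "subgroup ?K (add_monoid (monoid_alg AB))"
    proof (rule M.add.subgroupI)
      show "?K \<noteq> {}"
        using M.zero_closed Ls(1) by blast
      fix f assume f: "f \<in> ?K"
      then have f': "f \<in> carrier (monoid_alg AB)"
        by blast
      have "?L \<beta> (\<ominus>\<^bsub>monoid_alg AB\<^esub> f) = \<zero>\<^bsub>V\<^esub>" if "\<beta> \<in> bilin A B V" for \<beta>
        using Ls(2)[OF that f'] f that by auto
      then show "\<ominus>\<^bsub>monoid_alg AB\<^esub> f \<in> ?K"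
        using M.a_inv_closed[OF f'] by blast
    next
      fix f g assume f: "f \<in> ?K" and g: "g \<in> ?K"
      then have fg: "f \<in> carrier (monoid_alg AB)" "g \<in> carrier (monoid_alg AB)"
        by blast+
      have "?L \<beta> (f \<oplus>\<^bsub>monoid_alg AB\<^esub> g) = \<zero>\<^bsub>V\<^esub>" if "\<beta> \<in> bilin A B V" for \<beta>
        using lin_add[OF L[OF that] fg] f g that by auto
      then show "f \<oplus>\<^bsub>monoid_alg AB\<^esub> g \<in> ?K"
        using M.a_closed[OF fg] by blast
    qed auto
  next
    fix f g assume f: "f \<in> ?K" and g: "g \<in> carrier (monoid_alg AB)"
    then have fg: "f \<in> carrier (monoid_alg AB)" "supp g \<subseteq> carrier AB"
      by auto
    show "g \<otimes>\<^bsub>monoid_alg AB\<^esub> f \<in> ?K" "f \<otimes>\<^bsub>monoid_alg AB\<^esub> g \<in> ?K"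
      using mult[OF f fg(2)] M.m_closed[OF g fg(1)] M.m_closed[OF fg(1) g] by blast+
  qed (rule M.ring_axioms)
  moreover have "rels \<subseteq> ?K"
    using bilin_kills_rels[OF V] rels_closed by blast
  ultimately have "Idl\<^bsub>monoid_alg AB\<^esub> rels \<subseteq> ?K"
    by (rule M.genideal_minimal)
  then show ?thesis
    using x \<beta> by blast
qed

text \<open>
  The universal property of the tensor product for bilinear maps.
\<close>

lemma tensor_lift:
  assumes V: "calg V" and \<beta>: "\<beta> \<in> bilin A B V"
  shows "quot_lift V (\<lambda>(a, b). \<beta> a b) \<in> lin AT V"
    and "a \<in> carrier A \<Longrightarrow> b \<in> carrier B \<Longrightarrow> quot_lift V (\<lambda>(a, b). \<beta> a b) (tens A B a b) = \<beta> a b"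
proof -
  interpret V: calg V by fact
  note b = bilin_maps[OF \<beta>]
  note q = M.quot_lift_lin[OF rels_closed V lin_ext_lin[OF V b] bilin_kills_ideal[OF V \<beta>]]
    M.quot_lift_class[OF rels_closed V lin_ext_lin[OF V b] bilin_kills_ideal[OF V \<beta>]]
  show "quot_lift V (\<lambda>(a, b). \<beta> a b) \<in> lin AT V"
    using q(1) by (simp add: quot_lift_eq[abs_def] tensor_alg_def)
  assume ab: "a \<in> carrier A" "b \<in> carrier B"
  then have "quot_lift V (\<lambda>(a, b). \<beta> a b) (tens A B a b) =
      lin_ext V (\<lambda>(a, b). \<beta> a b) (monom (a, b) 1)"
    unfolding quot_lift_eq tens_def by (intro q(2)) auto
  also have "\<dots> = \<beta> a b"
    using V.lin_ext_single[OF b, of "(a, b)" 1] ab lin_closed[OF bilin_right[OF \<beta> ab(1)] ab(2)] by auto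
  finally show "quot_lift V (\<lambda>(a, b). \<beta> a b) (tens A B a b) = \<beta> a b" .
qed

lemma tensor_lin_eqI:
  assumes "f \<in> lin AT V" "g \<in> lin AT V"
    and "\<And>a b. a \<in> carrier A \<Longrightarrow> b \<in> carrier B \<Longrightarrow> f (tens A B a b) = g (tens A B a b)"
    and "t \<in> carrier AT"
  shows "f t = g t"
  using assms(4) by (rule tensor_induct) (simp_all add: assms(3) lin_add[OF assms(1)] lin_add[OF assms(2)])

text \<open>
  Multiplicativity is a bilinear condition, so it can be tested on pure tensors.
\<close>

lemma tensor_alg_homI:
  assumes V: "calg V" and h: "h \<in> lin AT V"
    and mult: "\<And>a b a' b'. a \<in> carrier A \<Longrightarrow> b \<in> carrier B \<Longrightarrow> a' \<in> carrier A \<Longrightarrow> b' \<in> carrier B \<Longrightarrow>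
      h (tens A B (a \<otimes>\<^bsub>A\<^esub> a') (b \<otimes>\<^bsub>B\<^esub> b')) = h (tens A B a b) \<otimes>\<^bsub>V\<^esub> h (tens A B a' b')"
    and one: "h (tens A B \<one>\<^bsub>A\<^esub> \<one>\<^bsub>B\<^esub>) = \<one>\<^bsub>V\<^esub>"
  shows "h \<in> alg_hom AT V"
proof (rule alg_homI)
  interpret V: calg V by fact
  note [simp] = lin_closed[OF h]
  fix t t' assume t: "t \<in> carrier AT" and t': "t' \<in> carrier AT"
  from t show "h (t \<otimes>\<^bsub>AT\<^esub> t') = h t \<otimes>\<^bsub>V\<^esub> h t'"
  proof (rule tensor_induct)
    fix a b assume ab: "a \<in> carrier A" "b \<in> carrier B"
    from t' show "h (tens A B a b \<otimes>\<^bsub>AT\<^esub> t') = h (tens A B a b) \<otimes>\<^bsub>V\<^esub> h t'"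
      by (rule tensor_induct) (use ab in \<open>simp_all add: tens_mult mult T.r_distr V.r_distr lin_add[OF h]\<close>)
  qed (use t' in \<open>simp_all add: T.l_distr V.l_distr lin_add[OF h]\<close>)
qed (use h one tens_one in simp_all)

end

section \<open>Maps between tensor products\<close>

context
  fixes A :: "(complex, 'a) module" and B :: "(complex, 'b) module"
    and C :: "(complex, 'c) module" and D :: "(complex, 'd) module" and f g
  assumes calgs: "calg A" "calg B" "calg C" "calg D"
    and f: "f \<in> lin C A" and g: "g \<in> lin D B"
begin

interpretation AB: two_calgs A B by (rule two_calgs.intro) (rule calgs)+
interpretation CD: two_calgs C D by (rule two_calgs.intro) (rule calgs)+

lemma tensor_map_bilin: "(\<lambda>c d. tens A B (f c) (g d)) \<in> bilin C D (tensor_alg A B)"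
  using lin_comp[OF AB.tens_lin_right g] lin_comp[OF AB.tens_lin_left f] lin_closed[OF f] lin_closed[OF g]
  by (intro bilinI) auto

lemma tensor_map_lin: "tensor_map A B f g \<in> lin (tensor_alg C D) (tensor_alg A B)"
  and tensor_map_tens: "c \<in> carrier C \<Longrightarrow> d \<in> carrier D \<Longrightarrow> tensor_map A B f g (tens C D c d) = tens A B (f c) (g d)"
  unfolding tensor_map_def by (rule CD.tensor_lift[OF AB.T.calg_axioms tensor_map_bilin]; assumption)+

lemma tensor_map_alg_hom:
  assumes "f \<in> alg_hom C A" "g \<in> alg_hom D B"
  shows "tensor_map A B f g \<in> alg_hom (tensor_alg C D) (tensor_alg A B)"
  by (rule CD.tensor_alg_homI[OF AB.T.calg_axioms tensor_map_lin])
    (simp_all add: tensor_map_tens AB.tens_mult lin_closed[OF f] lin_closed[OF g] alg_hom_mult[OF assms(1)]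
      alg_hom_mult[OF assms(2)] alg_hom_one[OF assms(1)] alg_hom_one[OF assms(2)] AB.tens_one)

end

context
  fixes A :: "(complex, 'a) module" and B :: "(complex, 'b) module" and C :: "(complex, 'c) module"
  assumes calgs: "calg A" "calg B" "calg C"
begin

interpretation AB: two_calgs A B by (rule two_calgs.intro) (rule calgs)+
interpretation BC: two_calgs B C by (rule two_calgs.intro) (rule calgs)+
interpretation AB_C: two_calgs "tensor_alg A B" C by (rule two_calgs.intro) (rule calgs AB.T.calg_axioms)+
interpretation A_BC: two_calgs A "tensor_alg B C" by (rule two_calgs.intro) (rule calgs BC.T.calg_axioms)+

private abbreviation (input) "W \<equiv> tensor_alg A (tensor_alg B C)"
private abbreviation (input) "L \<equiv> \<lambda>t c. quot_lift W (\<lambda>(a, b). tens A (tensor_alg B C) a (tens B C b c)) t"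

text \<open>
  For fixed \<open>c\<close>, the inner lift in \<^const>\<open>tensor_assoc\<close> is the linear map \<open>a \<otimes> b \<mapsto> a \<otimes> (b \<otimes> c)\<close>.
\<close>

lemma tensor_assoc_inner:
  assumes "c \<in> carrier C"
  shows "(\<lambda>t. L t c) \<in> lin (tensor_alg A B) W"
    and "a \<in> carrier A \<Longrightarrow> b \<in> carrier B \<Longrightarrow> L (tens A B a b) c = tens A (tensor_alg B C) a (tens B C b c)"
proof -
  have "(\<lambda>a b. tens A (tensor_alg B C) a (tens B C b c)) \<in> bilin A B W"
    using assms by (auto intro!: bilinI A_BC.tens_lin_left lin_comp[OF A_BC.tens_lin_right BC.tens_lin_left])
  from AB.tensor_lift[OF A_BC.T.calg_axioms this]
  show "(\<lambda>t. L t c) \<in> lin (tensor_alg A B) W"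
    and "a \<in> carrier A \<Longrightarrow> b \<in> carrier B \<Longrightarrow> L (tens A B a b) c = tens A (tensor_alg B C) a (tens B C b c)"
    by auto
qed

lemma tensor_assoc_bilin: "L \<in> bilin (tensor_alg A B) C W"
proof (rule bilinI)
  fix t assume t: "t \<in> carrier (tensor_alg A B)"
  note inner = lin_closed[OF tensor_assoc_inner(1)] lin_add[OF tensor_assoc_inner(1)]
  have r: "(\<lambda>c. tens A (tensor_alg B C) a (tens B C b c)) \<in> lin C W"
    if "a \<in> carrier A" "b \<in> carrier B" for a b
    using that by (intro lin_comp[OF A_BC.tens_lin_right BC.tens_lin_right])
  show "L t \<in> lin C W"
  proof (rule linI)
    fix c c' assume c: "c \<in> carrier C" "c' \<in> carrier C"
    then have cc: "c \<oplus>\<^bsub>C\<^esub> c' \<in> carrier C"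
      by simp
    have *: "(\<lambda>t. L t c \<oplus>\<^bsub>W\<^esub> L t c') \<in> lin (tensor_alg A B) W"
      using c by (intro linI)
        (simp_all add: inner lin_smult[OF tensor_assoc_inner(1)] A_BC.T.smult_r_distr A_BC.T.a_ac)
    show "L t (c \<oplus>\<^bsub>C\<^esub> c') = L t c \<oplus>\<^bsub>W\<^esub> L t c'"
    proof (rule AB.tensor_lin_eqI[OF tensor_assoc_inner(1)[OF cc] * _ t])
      fix a b assume ab: "a \<in> carrier A" "b \<in> carrier B"
      show "L (tens A B a b) (c \<oplus>\<^bsub>C\<^esub> c') = L (tens A B a b) c \<oplus>\<^bsub>W\<^esub> L (tens A B a b) c'"
        using lin_add[OF r[OF ab] c] by (simp only: tensor_assoc_inner(2)[OF c(1) ab]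
          tensor_assoc_inner(2)[OF c(2) ab] tensor_assoc_inner(2)[OF cc ab])
    qed
  next
    fix c k assume c: "c \<in> carrier C"
    then have kc: "k \<odot>\<^bsub>C\<^esub> c \<in> carrier C"
      by simp
    show "L t (k \<odot>\<^bsub>C\<^esub> c) = k \<odot>\<^bsub>W\<^esub> L t c"
    proof (rule AB.tensor_lin_eqI[OF tensor_assoc_inner(1)[OF kc]
          lin_scale[OF A_BC.T.calg_axioms tensor_assoc_inner(1)[OF c]] _ t])
      fix a b assume ab: "a \<in> carrier A" "b \<in> carrier B"
      show "L (tens A B a b) (k \<odot>\<^bsub>C\<^esub> c) = k \<odot>\<^bsub>W\<^esub> L (tens A B a b) c"
        using lin_smult[OF r[OF ab] c] by (simp only: tensor_assoc_inner(2)[OF c ab] tensor_assoc_inner(2)[OF kc ab])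
    qed
  qed (rule lin_closed[OF tensor_assoc_inner(1) t])
qed (rule tensor_assoc_inner(1))

lemma tensor_assoc_tens:
  assumes "a \<in> carrier A" "b \<in> carrier B" "c \<in> carrier C"
  shows "tensor_assoc A B C (tens (tensor_alg A B) C (tens A B a b) c) = tens A (tensor_alg B C) a (tens B C b c)"
  unfolding tensor_assoc_def
  using AB_C.tensor_lift(2)[OF A_BC.T.calg_axioms tensor_assoc_bilin, of "tens A B a b" c] assms
    tensor_assoc_inner(2)[of c a b]
  by simp

text \<open>
  The inner lift is not multiplicative for a single \<open>c\<close>. What holds is \<open>L (t t') (c c') = L t c \<cdot> L t' c'\<close>,
  by two inductions over sums of pure tensors.
\<close>

lemma tensor_assoc_alg_hom: "tensor_assoc A B C \<in> alg_hom (tensor_alg (tensor_alg A B) C) W"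
  unfolding tensor_assoc_def
proof (rule AB_C.tensor_alg_homI)
  let ?h = "quot_lift W (\<lambda>(t, c). L t c)"
  note lift = AB_C.tensor_lift[OF A_BC.T.calg_axioms tensor_assoc_bilin]
  show "calg W" by (rule A_BC.T.calg_axioms)
  show "?h \<in> lin (tensor_alg (tensor_alg A B) C) W" by (rule lift(1))
  have "L \<one>\<^bsub>tensor_alg A B\<^esub> \<one>\<^bsub>C\<^esub> = \<one>\<^bsub>W\<^esub>"
    using tensor_assoc_inner(2)[of "\<one>\<^bsub>C\<^esub>" "\<one>\<^bsub>A\<^esub>" "\<one>\<^bsub>B\<^esub>"]
    by (simp add: AB.tens_one BC.tens_one A_BC.tens_one)
  then show "?h (tens (tensor_alg A B) C \<one>\<^bsub>tensor_alg A B\<^esub> \<one>\<^bsub>C\<^esub>) = \<one>\<^bsub>W\<^esub>"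
    by (subst lift(2)) simp_all
  fix t c t' c'
  assume t: "t \<in> carrier (tensor_alg A B)" "t' \<in> carrier (tensor_alg A B)"
    and c: "c \<in> carrier C" "c' \<in> carrier C"
  then have cc: "c \<otimes>\<^bsub>C\<^esub> c' \<in> carrier C"
    by simp
  note L = tensor_assoc_inner(1)[OF cc] tensor_assoc_inner(1)[OF c(1)] tensor_assoc_inner(1)[OF c(2)]
  note L_closed = L[THEN lin_closed]
  note L_add = L[THEN lin_add]
  note L_tens = tensor_assoc_inner(2)[OF cc] tensor_assoc_inner(2)[OF c(1)] tensor_assoc_inner(2)[OF c(2)]
  have "L (t \<otimes>\<^bsub>tensor_alg A B\<^esub> t') (c \<otimes>\<^bsub>C\<^esub> c') = L t c \<otimes>\<^bsub>W\<^esub> L t' c'"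
    using t(1)
  proof (rule AB.tensor_induct)
    fix a b assume ab: "a \<in> carrier A" "b \<in> carrier B"
    show "L (tens A B a b \<otimes>\<^bsub>tensor_alg A B\<^esub> t') (c \<otimes>\<^bsub>C\<^esub> c') = L (tens A B a b) c \<otimes>\<^bsub>W\<^esub> L t' c'"
      using t(2)
    proof (rule AB.tensor_induct)
      fix a' b' assume ab': "a' \<in> carrier A" "b' \<in> carrier B"
      show "L (tens A B a b \<otimes>\<^bsub>tensor_alg A B\<^esub> tens A B a' b') (c \<otimes>\<^bsub>C\<^esub> c') =
        L (tens A B a b) c \<otimes>\<^bsub>W\<^esub> L (tens A B a' b') c'"
        using ab ab' c by (simp add: AB.tens_mult L_tens A_BC.tens_mult BC.tens_mult)
    qed (use ab in \<open>simp_all add: AB.T.r_distr L_add L_closed A_BC.T.r_distr\<close>)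
  qed (use t(2) in \<open>simp_all add: AB.T.l_distr L_add L_closed A_BC.T.l_distr\<close>)
  then show "?h (tens (tensor_alg A B) C (t \<otimes>\<^bsub>tensor_alg A B\<^esub> t') (c \<otimes>\<^bsub>C\<^esub> c')) =
      ?h (tens (tensor_alg A B) C t c) \<otimes>\<^bsub>W\<^esub> ?h (tens (tensor_alg A B) C t' c')"
    using t c by (subst (1 2 3) lift(2)) simp_all
qed

end

context calg
begin

interpretation A_C: two_calgs A complex_alg
  by (rule two_calgs.intro) (rule calg_axioms complex_calg)+

lemma tensor_runit_tens: "a \<in> carrier A \<Longrightarrow> tensor_runit A (tens A complex_alg a c) = c \<odot> a"
  and tensor_runit_alg_hom: "tensor_runit A \<in> alg_hom (tensor_alg A complex_alg) A"
proof -
  have b: "(\<lambda>a c. c \<odot> a) \<in> bilin A complex_alg A"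
    by (auto intro!: bilinI linI simp: smult_l_distr smult_r_distr mult.commute)
  note lift = A_C.tensor_lift[OF calg_axioms b, folded tensor_runit_def]
  show "tensor_runit A (tens A complex_alg a c) = c \<odot> a" if "a \<in> carrier A" for a c
    using lift(2)[of a c] that by simp
  show "tensor_runit A \<in> alg_hom (tensor_alg A complex_alg) A"
    by (rule A_C.tensor_alg_homI[OF calg_axioms lift(1)])
      (auto simp: lift(2) smult_mult_left smult_mult_right mult.commute)
qed

end


section \<open>Subalgebras\<close>

abbreviation (input) subalg :: "(complex, 'a) module \<Rightarrow> 'a set \<Rightarrow> (complex, 'a) module" where
  "subalg A X \<equiv> A\<lparr>carrier := gen_subalg A X\<rparr>"

context calg
begin

context
  fixes X
  assumes X: "X \<subseteq> carrier A"
begin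

lemma gen_subalg_closed: "x \<in> gen_subalg A X \<Longrightarrow> x \<in> carrier A"
  by (induction rule: gen_subalg.induct) (use X in auto)

lemma gen_subalg_uminus: "x \<in> gen_subalg A X \<Longrightarrow> \<ominus> x \<in> gen_subalg A X"
  using gen_subalg.smult[where A = A and X = X and x = x and c = "- 1"] gen_subalg_closed[of x] by (simp add: smult_minus_one)

lemma gen_subalg_zero: "\<zero> \<in> gen_subalg A X"
  using gen_subalg.smult[OF gen_subalg.one, where A = A and X = X and c = 0] by simp

lemma subalg_calg: "calg (subalg A X)"
proof -
  let ?S = "subalg A X"
  note [simp] = gen_subalg_closed
  have "ring ?S"
  proof (rule ringI)
    show "abelian_group ?S"
    proof (rule abelian_groupI)
      fix x assume "x \<in> carrier ?S"
      then show "\<exists>y\<in>carrier ?S. y \<oplus>\<^bsub>?S\<^esub> x = \<zero>\<^bsub>?S\<^esub>"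
        by (intro bexI[of _ "\<ominus> x"]) (auto simp: l_neg gen_subalg_uminus)
    qed (auto simp: gen_subalg_zero a_ac intro: gen_subalg.add)
    show "monoid ?S"
      by (rule monoidI) (auto simp: m_assoc intro: gen_subalg.mult gen_subalg.one)
  qed (auto simp: l_distr r_distr)
  then show ?thesis
    by (intro calg.intro calg_axioms.intro)
      (auto simp: smult_l_distr smult_r_distr smult_mult_left smult_mult_right intro: gen_subalg.smult)
qed

lemma subalg_incl: "id \<in> alg_hom (subalg A X) A"
  by (auto intro!: alg_homI linI gen_subalg_closed)

end

text \<open>
  The formal linear combinations of elements of the type of \<open>A\<close> form a vector space, and those with support
  in \<open>A\<close> can be evaluated in \<open>A\<close>. A linear projection onto the preimage of \<open>S\<close> fixes the kernel of the
  evaluation and hence descends to \<open>A\<close>.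
\<close>

lemma linear_retraction:
  assumes S: "S \<subseteq> carrier A" "\<zero> \<in> S" "\<And>x y. x \<in> S \<Longrightarrow> y \<in> S \<Longrightarrow> x \<oplus> y \<in> S" "\<And>c x. x \<in> S \<Longrightarrow> c \<odot> x \<in> S"
  shows "\<exists>r. r \<in> lin A (A\<lparr>carrier := S\<rparr>) \<and> (\<forall>s\<in>S. r s = s)"
proof -
  have ax: "scale_pm (c + d) f = scale_pm c f + scale_pm d f" "scale_pm c (scale_pm d f) = scale_pm (c * d) f"
    "scale_pm 1 f = f"
    for c d and f :: "'a \<Rightarrow>\<^sub>0 complex"
    by (rule poly_mapping_eqI; simp add: lookup_add algebra_simps)+
  interpret vs: vector_space "scale_pm :: complex \<Rightarrow> ('a \<Rightarrow>\<^sub>0 complex) \<Rightarrow> ('a \<Rightarrow>\<^sub>0 complex)"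
    by standard (auto simp: scale_pm_add ax)
  interpret vp: vector_space_pair "scale_pm :: complex \<Rightarrow> ('a \<Rightarrow>\<^sub>0 complex) \<Rightarrow> ('a \<Rightarrow>\<^sub>0 complex)"
    "scale_pm :: complex \<Rightarrow> ('a \<Rightarrow>\<^sub>0 complex) \<Rightarrow> ('a \<Rightarrow>\<^sub>0 complex)" ..
  let ?ev = "lin_ext A id"
  let ?U = "{f. supp f \<subseteq> carrier A \<and> ?ev f \<in> S}"
  have id: "id \<in> carrier A \<rightarrow> carrier A"
    by auto
  note ev = lin_ext_add[OF id] lin_ext_smult[OF id] lin_ext_single[OF id] lin_ext_zero[OF id]
  have U: "vs.subspace ?U"
    using S by (auto simp: vs.subspace_def ev keys_add_subset dest: subsetD[OF keys_scale_pm] subsetD[OF keys_add])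
  have "Vector_Spaces.linear scale_pm scale_pm (\<lambda>f :: 'a \<Rightarrow>\<^sub>0 complex. f)"
    by (rule vs.linear_ident)
  moreover have "inj_on (\<lambda>f. f) ?U"
    by (simp add: inj_on_def)
  ultimately obtain p where p: "range p \<subseteq> ?U" "Vector_Spaces.linear scale_pm scale_pm p" "\<And>f. f \<in> ?U \<Longrightarrow> p f = f"
    using vp.linear_exists_left_inverse_on[OF _ U, of "\<lambda>f. f"] by auto
  have pU: "p f \<in> ?U" for f
    using p(1) by blast
  have p_add: "p (f + g) = p f + p g" and p_scale: "p (scale_pm c f) = scale_pm c (p f)" for f g c
    using p(2) vp.linear_add vp.linear_scale by blast+
  \<comment> \<open>The retraction projects the formal monomial of an element and evaluates the result.\<close>
  let ?s = "\<lambda>a. monom a (1 :: complex)"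
  let ?r = "\<lambda>a. ?ev (p (?s a))"
  have evp: "?ev (p (f + g)) = ?ev (p f) \<oplus> ?ev (p g)" "?ev (p (scale_pm c f)) = c \<odot> ?ev (p f)" for f g c
    using pU[of f] pU[of g] by (simp_all add: p_add p_scale ev)
  have closed: "?ev (p f) \<in> carrier A" for f
    using pU[of f] S by auto
  have kernel: "?ev (p f) = \<zero>" if "supp f \<subseteq> carrier A" "?ev f = \<zero>" for f
    using p(3)[of f] that S by simp
  have eqI: "?ev (p f) = ?ev (p g)"
    if fg: "supp f \<subseteq> carrier A" "supp g \<subseteq> carrier A" and eq: "?ev f = ?ev g" for f g
  proof -
    have keys: "supp (scale_pm (- 1) g) \<subseteq> carrier A"
      using fg keys_scale_pm[of "- 1" g] by blast
    have "?ev (f + scale_pm (- 1) g) = \<zero>"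
      unfolding lin_ext_add[OF id fg(1) keys] lin_ext_smult[OF id fg(2)] eq
      using lin_ext_closed[OF id fg(2)] by (simp add: smult_minus_one r_neg)
    then have "?ev (p (f + scale_pm (- 1) g)) = \<zero>"
      using fg keys by (intro kernel keys_add_subset)
    then have "?ev (p f) \<ominus> ?ev (p g) = \<zero>"
      unfolding evp using closed by (simp add: smult_minus_one a_minus_def)
    then show ?thesis
      using closed by simp
  qed
  have "?r \<in> lin A (A\<lparr>carrier := S\<rparr>)"
  proof (rule linI)
    fix x y assume xy: "x \<in> carrier A" "y \<in> carrier A"
    have "?ev (p (?s (x \<oplus> y))) = ?ev (p (?s x + ?s y))"
      using xy by (intro eqI) (auto simp: ev intro!: keys_add_subset split: if_splits dest!: subsetD[OF keys_add])
    then show "?r (x \<oplus> y) = ?r x \<oplus>\<^bsub>A\<lparr>carrier := S\<rparr>\<^esub> ?r y"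
      by (simp add: evp)
  next
    fix x c assume x: "x \<in> carrier A"
    have "?ev (p (?s (c \<odot> x))) = ?ev (p (scale_pm c (?s x)))"
      using x by (intro eqI) (auto simp: ev split: if_splits)
    then show "?r (c \<odot> x) = c \<odot>\<^bsub>A\<lparr>carrier := S\<rparr>\<^esub> ?r x"
      by (simp only: evp) simp
  qed (use pU in auto)
  moreover have "?r s = s" if "s \<in> S" for s
    using that S p(3)[of "?s s"] by (auto simp: ev)
  ultimately show ?thesis
    by blast
qed

text \<open>
  Tensoring a linear retraction of \<open>A\<close> onto the subalgebra with the identity gives a left inverse.
\<close>

lemma subalg_tensor_inj:
  assumes X: "X \<subseteq> carrier A" and B: "calg B"
  shows "inj_on (tensor_map A B id id) (carrier (tensor_alg (subalg A X) B))"
proof -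
  let ?S = "subalg A X"
  interpret S: calg ?S by (rule subalg_calg[OF X])
  interpret B: calg B by fact
  interpret SB: two_calgs ?S B ..
  interpret AB: two_calgs A B ..
  obtain r where r: "r \<in> lin A ?S" "\<And>s. s \<in> gen_subalg A X \<Longrightarrow> r s = s"
    using linear_retraction[of "gen_subalg A X"] gen_subalg_closed[OF X] gen_subalg_zero[OF X]
    by (metis gen_subalg.add gen_subalg.smult subsetI)
  note incl = alg_hom_lin[OF subalg_incl[OF X]]
  note j = tensor_map_lin[OF calg_axioms B S.calg_axioms B incl id_lin]
    tensor_map_tens[OF calg_axioms B S.calg_axioms B incl id_lin]
  note \<rho> = tensor_map_lin[OF S.calg_axioms B calg_axioms B r(1) id_lin]
    tensor_map_tens[OF S.calg_axioms B calg_axioms B r(1) id_lin]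
  have "tensor_map ?S B r id (tensor_map A B id id t) = id t" if "t \<in> carrier (tensor_alg ?S B)" for t
    using lin_comp[OF \<rho>(1) j(1)] id_lin _ that
    by (rule SB.tensor_lin_eqI) (auto simp: j(2) \<rho>(2) r(2) gen_subalg_closed[OF X])
  then show ?thesis
    by (intro inj_on_inverseI[of _ "tensor_map ?S B r id"]) simp
qed

end

lemma alg_hom_corestrict:
  assumes calgs: "calg A" "calg C" "calg B"
    and h: "h \<in> alg_hom A B" and j: "j \<in> alg_hom C B" and inj: "inj_on j (carrier C)"
    and range: "\<And>a. a \<in> carrier A \<Longrightarrow> h a \<in> j ` carrier C"
  shows "(\<lambda>a. inv_into (carrier C) j (h a)) \<in> alg_hom A C"
    and "a \<in> carrier A \<Longrightarrow> c \<in> carrier C \<Longrightarrow> j c = h a \<Longrightarrow> inv_into (carrier C) j (h a) = c"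
proof -
  interpret A: calg A by fact
  interpret C: calg C by fact
  let ?k = "\<lambda>a. inv_into (carrier C) j (h a)"
  have k: "?k a \<in> carrier C" "j (?k a) = h a" if "a \<in> carrier A" for a
    using range[OF that] by (auto simp: inv_into_into f_inv_into_f)
  have eqI: "?k a = c" if "a \<in> carrier A" "c \<in> carrier C" "j c = h a" for a c
    using inv_into_f_f[OF inj that(2)] that(3) by simp
  show "a \<in> carrier A \<Longrightarrow> c \<in> carrier C \<Longrightarrow> j c = h a \<Longrightarrow> inv_into (carrier C) j (h a) = c"
    by (rule eqI)
  note jl = alg_hom_lin[OF j] and hl = alg_hom_lin[OF h]
  show "?k \<in> alg_hom A C"
  proof (intro alg_homI linI)
    fix x y assume "x \<in> carrier A" "y \<in> carrier A"
    then show "?k (x \<otimes>\<^bsub>A\<^esub> y) = ?k x \<otimes>\<^bsub>C\<^esub> ?k y" "?k (x \<oplus>\<^bsub>A\<^esub> y) = ?k x \<oplus>\<^bsub>C\<^esub> ?k y"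
      by (intro eqI; simp add: k alg_hom_mult[OF j] alg_hom_mult[OF h] lin_add[OF jl] lin_add[OF hl])+
  next
    fix c x assume "x \<in> carrier A"
    then show "?k (c \<odot>\<^bsub>A\<^esub> x) = c \<odot>\<^bsub>C\<^esub> ?k x"
      by (intro eqI; simp add: k lin_smult[OF jl] lin_smult[OF hl])
  next
    show "?k \<one>\<^bsub>A\<^esub> = \<one>\<^bsub>C\<^esub>"
      by (intro eqI; simp add: alg_hom_one[OF j] alg_hom_one[OF h])
  qed (rule k)
qed

lemma alg_hom_eq_on_subalg:
  assumes calgs: "calg A" "calg B" and X: "X \<subseteq> carrier A"
    and f: "f \<in> alg_hom (subalg A X) B" and g: "g \<in> alg_hom (subalg A X) B"
    and eq: "\<And>x. x \<in> X \<Longrightarrow> f x = g x" and x: "x \<in> gen_subalg A X"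
  shows "f x = g x"
proof -
  note hom = alg_hom_mult[OF f, simplified] alg_hom_mult[OF g, simplified] alg_hom_one[OF f, simplified]
    alg_hom_one[OF g, simplified] lin_add[OF alg_hom_lin[OF f], simplified] lin_add[OF alg_hom_lin[OF g], simplified]
    lin_smult[OF alg_hom_lin[OF f], simplified] lin_smult[OF alg_hom_lin[OF g], simplified]
  show ?thesis
    using x by (induction rule: gen_subalg.induct) (simp_all add: eq hom)
qed

lemma lin_image_smult:
  assumes "calg C" "j \<in> lin C B" "y \<in> j ` carrier C"
  shows "c \<odot>\<^bsub>B\<^esub> y \<in> j ` carrier C"
proof -
  interpret calg C by fact
  obtain z where "y = j z" "z \<in> carrier C"
    using assms(3) by blast
  then show ?thesis
    using lin_smult[OF assms(2), of z c] by (metis imageI smult_closed)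
qed

text \<open>
  The range of a homomorphism is a subalgebra, so it is enough to locate the images of the generators.
\<close>

lemma gen_subalg_image:
  assumes calgs: "calg A" "calg C" "calg B" and X: "X \<subseteq> carrier A"
    and h: "h \<in> alg_hom A B" and j: "j \<in> alg_hom C B"
    and gens: "\<And>x. x \<in> X \<Longrightarrow> h x \<in> j ` carrier C" and a: "a \<in> gen_subalg A X"
  shows "h a \<in> j ` carrier C"
proof -
  interpret A: calg A by fact
  interpret C: calg C by fact
  note hl = alg_hom_lin[OF h] and jl = alg_hom_lin[OF j]
  show ?thesis
    using a
  proof (induction rule: gen_subalg.induct)
    case one
    show ?case
      using alg_hom_one[OF h] alg_hom_one[OF j] by (metis imageI C.one_closed)
  next
    case (add x y)
    then obtain s t where "h x = j s" "s \<in> carrier C" "h y = j t" "t \<in> carrier C"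
      by blast
    then have "h (x \<oplus>\<^bsub>A\<^esub> y) = j (s \<oplus>\<^bsub>C\<^esub> t)"
      using add A.gen_subalg_closed[OF X] by (simp add: lin_add[OF hl] lin_add[OF jl])
    then show ?case
      using \<open>s \<in> carrier C\<close> \<open>t \<in> carrier C\<close> by blast
  next
    case (mult x y)
    then obtain s t where "h x = j s" "s \<in> carrier C" "h y = j t" "t \<in> carrier C"
      by blast
    then have "h (x \<otimes>\<^bsub>A\<^esub> y) = j (s \<otimes>\<^bsub>C\<^esub> t)"
      using mult A.gen_subalg_closed[OF X] by (simp add: alg_hom_mult[OF h] alg_hom_mult[OF j])
    then show ?case
      using \<open>s \<in> carrier C\<close> \<open>t \<in> carrier C\<close> by blast
  next
    case (smult x c)
    then show ?case
      using lin_image_smult[OF C.calg_axioms jl smult.IH] A.gen_subalg_closed[OF X] by (simp add: lin_smult[OF hl])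
  qed (rule gens)
qed


section \<open>Algebras presented by generators and relations\<close>

definition word_val :: "(complex, 'a) module \<Rightarrow> ('s \<Rightarrow> 'a) \<Rightarrow> 's list \<Rightarrow> 'a" where
  "word_val D \<phi> w = foldr (\<lambda>s. (\<otimes>\<^bsub>D\<^esub>) (\<phi> s)) w \<one>\<^bsub>D\<^esub>"

text \<open>
  A family \<open>\<phi>\<close> of elements of \<open>D\<close> that satisfies the relations \<open>X\<close>: a \<open>D\<close>-valued point of the algebra
  presented by \<open>S\<close> and \<open>X\<close>. Working with points avoids explicit elements of free algebras.
\<close>

definition solves :: "(complex, 'a) module \<Rightarrow> 's set \<Rightarrow> ('s list \<Rightarrow>\<^sub>0 complex) set \<Rightarrow> ('s \<Rightarrow> 'a) \<Rightarrow> bool" where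
  "solves D S X \<phi> \<longleftrightarrow> \<phi> \<in> S \<rightarrow> carrier D \<and> (\<forall>r\<in>X. lin_ext D (word_val D \<phi>) r = \<zero>\<^bsub>D\<^esub>)"

lemma free_monoid: "monoid \<lparr>carrier = lists S, monoid.mult = (@), one = []\<rparr>"
  by (rule monoidI) auto

lemma free_calg: "calg (free_alg S)"
  unfolding free_alg_def by (rule monoid_alg_calg) (rule free_monoid)

lemma free_alg_carrier: "carrier (free_alg S) = {f. supp f \<subseteq> lists S}"
  by (simp add: free_alg_def)

context calg
begin

context
  fixes S and \<phi> :: "'s \<Rightarrow> 'a"
  assumes \<phi>: "\<phi> \<in> S \<rightarrow> carrier A"
begin

lemma word_val_closed: "w \<in> lists S \<Longrightarrow> word_val A \<phi> w \<in> carrier A"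
  using \<phi> by (induction w) (auto simp: word_val_def)

lemma word_val_maps: "word_val A \<phi> \<in> lists S \<rightarrow> carrier A"
  by (auto intro: word_val_closed)

lemma word_val_append: "v \<in> lists S \<Longrightarrow> w \<in> lists S \<Longrightarrow> word_val A \<phi> (v @ w) = word_val A \<phi> v \<otimes> word_val A \<phi> w"
proof (induction v)
  case Nil
  then show ?case
    using word_val_closed[of w] by (simp add: word_val_def)
next
  case (Cons s v)
  then show ?case
    using \<phi> word_val_closed[of w] word_val_closed[of v] by (auto simp: word_val_def m_assoc Pi_def)
qed

lemma word_val_hom: "lin_ext A (word_val A \<phi>) \<in> alg_hom (free_alg S) A"
  unfolding free_alg_def
  by (rule lin_ext_alg_hom[OF calg_axioms free_monoid]) (auto simp: word_val_append word_val_closed, simp add: word_val_def)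

lemma word_val_Nil: "word_val A \<phi> [] = \<one>"
  and word_val_single: "s \<in> S \<Longrightarrow> word_val A \<phi> [s] = \<phi> s"
  and word_val_pair: "s \<in> S \<Longrightarrow> t \<in> S \<Longrightarrow> word_val A \<phi> [s, t] = \<phi> s \<otimes> \<phi> t"
  using \<phi> by (auto simp: word_val_def Pi_def)

end

lemma presented_hom:
  assumes X: "X \<subseteq> carrier (free_alg S)" and \<phi>: "solves A S X \<phi>"
  shows "\<exists>h. h \<in> alg_hom (quot_alg (free_alg S) X) A \<and>
    (\<forall>s\<in>S. h (quot_class (free_alg S) X (monom [s] 1)) = \<phi> s)"
proof -
  interpret F: calg "free_alg S" by (rule free_calg)
  have closed: "\<phi> \<in> S \<rightarrow> carrier A"
    using \<phi> by (simp add: solves_def)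
  let ?e = "lin_ext A (word_val A \<phi>)"
  note e = word_val_hom[OF closed]
  have ker: "?e x = \<zero>" if "x \<in> Idl\<^bsub>free_alg S\<^esub> X" for x
    by (rule F.alg_hom_kills_genideal[OF X calg_axioms e _ that]) (use \<phi> in \<open>auto simp: solves_def\<close>)
  have "the_elem (?e ` quot_class (free_alg S) X (monom [s] 1)) = \<phi> s" if s: "s \<in> S" for s
  proof -
    have "the_elem (?e ` quot_class (free_alg S) X (monom [s] 1)) = ?e (monom [s] 1)"
      using s by (intro F.quot_lift_class[OF X calg_axioms alg_hom_lin[OF e]] ker) (auto simp: free_alg_carrier)
    also have "\<dots> = \<phi> s"
      using lin_ext_single[OF word_val_maps[OF closed], of "[s]" 1] word_val_single[OF closed s] closed s
      by (auto simp: Pi_def)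
    finally show ?thesis .
  qed
  then show ?thesis
    using F.quot_lift_alg_hom[OF X calg_axioms e ker] by blast
qed

end

text \<open>
  The class map is the evaluation at the classes of the generators, since both are homomorphisms that agree
  on words.
\<close>

lemma presented_gens_solve:
  assumes X: "X \<subseteq> carrier (free_alg S)"
  shows "solves (quot_alg (free_alg S) X) S X (\<lambda>s. quot_class (free_alg S) X (monom [s] 1))"
proof -
  let ?F = "free_alg S"
  let ?Q = "quot_alg ?F X" and ?q = "quot_class ?F X"
  interpret F: calg ?F by (rule free_calg)
  interpret Q: calg ?Q by (rule F.quot_calg[OF X])
  note q = F.quot_class_alg_hom[OF X]
  let ?g = "\<lambda>s. ?q (monom [s] 1)"
  have g: "?g \<in> S \<rightarrow> carrier ?Q"
    by (auto intro!: lin_closed[OF alg_hom_lin[OF q]] simp: free_alg_carrier)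
  note e = lin_ext_lin[OF Q.calg_axioms]
  have word: "?q (monom w 1) = word_val ?Q ?g w" if "w \<in> lists S" for w
    using that
  proof (induction w)
    case Nil
    then show ?case
      using alg_hom_one[OF q] by (simp add: free_alg_def word_val_def)
  next
    case (Cons s w)
    then have "?q (monom [s] 1 \<otimes>\<^bsub>?F\<^esub> monom w 1) = ?g s \<otimes>\<^bsub>?Q\<^esub> word_val ?Q ?g w"
      by (subst alg_hom_mult[OF q]) (auto simp: free_alg_carrier)
    then show ?case
      by (simp add: free_alg_def word_val_def)
  qed
  note maps = Q.word_val_maps[OF g]
  have eq: "?q x = lin_ext ?Q (word_val ?Q ?g) x" if "x \<in> carrier ?F" for x
  proof (rule poly_mapping_span_induct[of x "lists S" "\<lambda>x. ?q x = lin_ext ?Q (word_val ?Q ?g) x"])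
    show "?q 0 = lin_ext ?Q (word_val ?Q ?g) 0"
      using lin_zero[OF F.calg_axioms Q.calg_axioms alg_hom_lin[OF q]] Q.lin_ext_zero[OF maps]
      by (simp add: free_alg_def)
    show "?q (monom w c) = lin_ext ?Q (word_val ?Q ?g) (monom w c)"
      if "w \<in> lists S" for w c
      using lin_smult[OF alg_hom_lin[OF q], of "monom w 1" c] word[OF that] that
        Q.lin_ext_single[OF maps that, of c] by (simp add: free_alg_def)
    show "?q (f + g) = lin_ext ?Q (word_val ?Q ?g) (f + g)"
      if "supp f \<subseteq> lists S" "supp g \<subseteq> lists S"
        "?q f = lin_ext ?Q (word_val ?Q ?g) f" "?q g = lin_ext ?Q (word_val ?Q ?g) g" for f g
      using lin_add[OF alg_hom_lin[OF q], of f g] Q.lin_ext_add[OF maps, of f g] that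
      by (simp add: free_alg_def)
  qed (use that in \<open>simp add: free_alg_carrier\<close>)
  show "solves ?Q S X ?g"
    unfolding solves_def
  proof (intro conjI ballI g)
    fix r assume r: "r \<in> X"
    then have "?q r = lin_ext ?Q (word_val ?Q ?g) r"
      using X by (intro eq) auto
    then show "lin_ext ?Q (word_val ?Q ?g) r = \<zero>\<^bsub>?Q\<^esub>"
      using F.quot_class_rel[OF X r] by simp
  qed
qed

lemma (in calg) finsum_Times:
  assumes "finite N" "finite M" "\<And>n m. n \<in> N \<Longrightarrow> m \<in> M \<Longrightarrow> f (n, m) \<in> carrier A"
  shows "(\<Oplus>n\<in>N. \<Oplus>m\<in>M. f (n, m)) = (\<Oplus>p\<in>N \<times> M. f p)"
  using assms(1,3)
proof (induction N)
  case (insert n F)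
  have "insert n F \<times> M = Pair n ` M \<union> F \<times> M"
    by auto
  moreover have "(\<Oplus>p\<in>Pair n ` M \<union> F \<times> M. f p) = (\<Oplus>p\<in>Pair n ` M. f p) \<oplus> (\<Oplus>p\<in>F \<times> M. f p)"
    using insert assms(2) by (intro finsum_Un_disjoint) auto
  moreover have "(\<Oplus>p\<in>Pair n ` M. f p) = (\<Oplus>m\<in>M. f (n, m))"
    using insert by (intro finsum_reindex) (auto simp: inj_on_def)
  moreover have "(\<Oplus>k\<in>insert n F. \<Oplus>m\<in>M. f (k, m)) = (\<Oplus>m\<in>M. f (n, m)) \<oplus> (\<Oplus>k\<in>F. \<Oplus>m\<in>M. f (k, m))"
    using insert by (intro finsum_insert) (auto intro!: finsum_closed)
  ultimately show ?case
    using insert by simp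
qed simp


section \<open>Linear combinations\<close>

text \<open>
  Elements are compared through their coefficients: two linear combinations of the same family agree as soon
  as the coefficient functions \<open>k\<close> do.
\<close>

definition lincomb :: "(complex, 'a) module \<Rightarrow> 'n set \<Rightarrow> ('n \<Rightarrow> 'a) \<Rightarrow> ('n \<Rightarrow> complex) \<Rightarrow> 'a" where
  "lincomb A N e k = (\<Oplus>\<^bsub>A\<^esub>n\<in>N. k n \<odot>\<^bsub>A\<^esub> e n)"

definition kdelta :: "'n \<Rightarrow> 'n \<Rightarrow> complex" where
  "kdelta a n = (if n = a then 1 else 0)"

context calg
begin

context
  fixes N :: "'n set" and e
  assumes N: "finite N" and e: "e \<in> N \<rightarrow> carrier A"
begin

lemma lincomb_closed [simp]: "lincomb A N e k \<in> carrier A"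
  unfolding lincomb_def using e by (intro finsum_closed) auto

lemma lincomb_add: "lincomb A N e k \<oplus> lincomb A N e l = lincomb A N e (\<lambda>n. k n + l n)"
proof -
  have "lincomb A N e (\<lambda>n. k n + l n) = (\<Oplus>n\<in>N. k n \<odot> e n \<oplus> l n \<odot> e n)"
    unfolding lincomb_def using e by (intro finsum_cong') (auto simp: smult_l_distr Pi_def)
  also have "\<dots> = lincomb A N e k \<oplus> lincomb A N e l"
    unfolding lincomb_def using e by (intro finsum_addf) auto
  finally show ?thesis by simp
qed

lemma lincomb_smult: "c \<odot> lincomb A N e k = lincomb A N e (\<lambda>n. c * k n)"
proof -
  have "c \<odot> lincomb A N e k = (\<Oplus>n\<in>N. c \<odot> (k n \<odot> e n))"
    unfolding lincomb_def using e by (intro smult_finsum) auto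
  also have "\<dots> = lincomb A N e (\<lambda>n. c * k n)"
    unfolding lincomb_def using e by (intro finsum_cong') (auto simp: Pi_def)
  finally show ?thesis .
qed

lemma lincomb_diff: "lincomb A N e (\<lambda>n. k n - l n) = lincomb A N e k \<oplus> (- 1) \<odot> lincomb A N e l"
  by (simp add: lincomb_smult lincomb_add)

lemma lincomb_kdelta: "a \<in> N \<Longrightarrow> lincomb A N e (kdelta a) = e a"
  unfolding lincomb_def using finsum_delta[OF N, of "\<lambda>n. kdelta a n \<odot> e n" a] e
  by (auto simp: kdelta_def Pi_def)

lemma lincomb_sum:
  "(\<Oplus>i\<in>I. lincomb A N e (k i)) = lincomb A N e (\<lambda>n. \<Sum>i\<in>I. k i n)"
proof (induction I rule: infinite_finite_induct)
  case (insert i I)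
  then show ?case
    by (simp add: lincomb_add)
next
  case empty
  show ?case
    using lincomb_smult[of 0 "\<lambda>n. 0"] by simp
next
  case (infinite I)
  then show ?case
    using lincomb_smult[of 0 "\<lambda>n. 0"] by (simp add: finsum_infinite)
qed

end

end

lemma bilin_lincomb:
  assumes calgs: "calg A" "calg B" "calg V" and \<beta>: "\<beta> \<in> bilin A B V"
    and N: "finite N" "e \<in> N \<rightarrow> carrier A" and M: "finite M" "f \<in> M \<rightarrow> carrier B"
  shows "\<beta> (lincomb A N e k) (lincomb B M f l) =
    lincomb V (N \<times> M) (\<lambda>(n, m). \<beta> (e n) (f m)) (\<lambda>(n, m). k n * l m)"
proof -
  interpret A: calg A by fact
  interpret B: calg B by fact
  interpret V: calg V by fact
  have [simp]: "\<beta> (e n) (f m) \<in> carrier V" if "n \<in> N" "m \<in> M" for n m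
    using lin_closed[OF bilin_right[OF \<beta>]] N M that by (auto simp: Pi_def)
  have "\<beta> (lincomb A N e k) (lincomb B M f l) = (\<Oplus>\<^bsub>V\<^esub>n\<in>N. k n \<odot>\<^bsub>V\<^esub> \<beta> (e n) (lincomb B M f l))"
    unfolding lincomb_def[of A]
    using lin_finsum[OF calgs(1,3) bilin_left[OF \<beta> B.lincomb_closed[OF M]], of "\<lambda>n. k n \<odot>\<^bsub>A\<^esub> e n" N]
      lin_smult[OF bilin_left[OF \<beta> B.lincomb_closed[OF M]]] lin_closed[OF bilin_left[OF \<beta> B.lincomb_closed[OF M]]] N
    by (auto simp: Pi_def intro!: V.finsum_cong')
  also have "\<dots> = (\<Oplus>\<^bsub>V\<^esub>n\<in>N. \<Oplus>\<^bsub>V\<^esub>m\<in>M. (k n * l m) \<odot>\<^bsub>V\<^esub> \<beta> (e n) (f m))"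
  proof (intro V.finsum_cong' refl)
    fix n assume n: "n \<in> N"
    then have en: "e n \<in> carrier A"
      using N by auto
    have "\<beta> (e n) (lincomb B M f l) = (\<Oplus>\<^bsub>V\<^esub>m\<in>M. l m \<odot>\<^bsub>V\<^esub> \<beta> (e n) (f m))"
      unfolding lincomb_def
      using lin_finsum[OF calgs(2,3) bilin_right[OF \<beta> en], of "\<lambda>m. l m \<odot>\<^bsub>B\<^esub> f m" M]
        lin_smult[OF bilin_right[OF \<beta> en]] lin_closed[OF bilin_right[OF \<beta> en]] M
      by (auto simp: Pi_def intro!: V.finsum_cong')
    then show "k n \<odot>\<^bsub>V\<^esub> \<beta> (e n) (lincomb B M f l) = (\<Oplus>\<^bsub>V\<^esub>m\<in>M. (k n * l m) \<odot>\<^bsub>V\<^esub> \<beta> (e n) (f m))"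
      using n by (auto simp: V.smult_finsum Pi_def intro!: V.finsum_cong')
  qed (auto intro!: V.finsum_closed)
  also have "\<dots> = (\<Oplus>\<^bsub>V\<^esub>p\<in>N \<times> M. (case p of (n, m) \<Rightarrow> k n * l m) \<odot>\<^bsub>V\<^esub> (case p of (n, m) \<Rightarrow> \<beta> (e n) (f m)))"
    using V.finsum_Times[OF N(1) M(1), of "\<lambda>(n, m). (k n * l m) \<odot>\<^bsub>V\<^esub> \<beta> (e n) (f m)"]
    by (simp add: case_prod_unfold)
  finally show ?thesis
    by (simp add: lincomb_def)
qed


section \<open>Points of the quantum group SU(2)\<close>

text \<open>
  The ordered monomials of degree zero and two that remain when the relations of \<open>A(SU\<^sub>q(2))\<close> are read as
  rewrite rules from left to right, as in \<open>su_nf\<close>.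
\<close>

definition su_words :: "su_gen list set" where
  "su_words = {[], [Gamma, Alpha], [GammaBar, Alpha], [GammaBar, Gamma], [AlphaBar, GammaBar],
     [AlphaBar, Gamma], [Alpha, Alpha], [Gamma, Gamma], [AlphaBar, AlphaBar], [GammaBar, GammaBar]}"

fun su_nf :: "complex \<Rightarrow> su_gen \<Rightarrow> su_gen \<Rightarrow> su_gen list \<Rightarrow> complex" where
  "su_nf q Alpha Gamma n = q * kdelta [Gamma, Alpha] n"
| "su_nf q Alpha GammaBar n = q * kdelta [GammaBar, Alpha] n"
| "su_nf q Gamma GammaBar n = kdelta [GammaBar, Gamma] n"
| "su_nf q Alpha AlphaBar n = kdelta [] n + (- (q\<^sup>2)) * kdelta [GammaBar, Gamma] n"
| "su_nf q AlphaBar Alpha n = kdelta [] n + (- 1) * kdelta [GammaBar, Gamma] n"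
| "su_nf q GammaBar AlphaBar n = q * kdelta [AlphaBar, GammaBar] n"
| "su_nf q Gamma AlphaBar n = q * kdelta [AlphaBar, Gamma] n"
| "su_nf q g h n = kdelta [g, h] n"

definition su_point :: "(complex, 'a) module \<Rightarrow> complex \<Rightarrow> (su_gen \<Rightarrow> 'a) \<Rightarrow> bool" where
  "su_point A q G \<longleftrightarrow> range G \<subseteq> carrier A \<and>
     G Alpha \<otimes>\<^bsub>A\<^esub> G Gamma = q \<odot>\<^bsub>A\<^esub> (G Gamma \<otimes>\<^bsub>A\<^esub> G Alpha) \<and>
     G Alpha \<otimes>\<^bsub>A\<^esub> G GammaBar = q \<odot>\<^bsub>A\<^esub> (G GammaBar \<otimes>\<^bsub>A\<^esub> G Alpha) \<and>
     G Gamma \<otimes>\<^bsub>A\<^esub> G GammaBar = G GammaBar \<otimes>\<^bsub>A\<^esub> G Gamma \<and>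
     G Alpha \<otimes>\<^bsub>A\<^esub> G AlphaBar \<oplus>\<^bsub>A\<^esub> (q\<^sup>2) \<odot>\<^bsub>A\<^esub> (G GammaBar \<otimes>\<^bsub>A\<^esub> G Gamma) = \<one>\<^bsub>A\<^esub> \<and>
     G AlphaBar \<otimes>\<^bsub>A\<^esub> G Alpha \<oplus>\<^bsub>A\<^esub> G GammaBar \<otimes>\<^bsub>A\<^esub> G Gamma = \<one>\<^bsub>A\<^esub> \<and>
     G GammaBar \<otimes>\<^bsub>A\<^esub> G AlphaBar = q \<odot>\<^bsub>A\<^esub> (G AlphaBar \<otimes>\<^bsub>A\<^esub> G GammaBar) \<and>
     G Gamma \<otimes>\<^bsub>A\<^esub> G AlphaBar = q \<odot>\<^bsub>A\<^esub> (G AlphaBar \<otimes>\<^bsub>A\<^esub> G Gamma)"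

lemma su_rels_closed: "su_rels q \<subseteq> carrier (free_alg UNIV)"
  by (auto simp: free_alg_carrier)

lemma su_words_finite: "finite su_words"
  by (simp add: su_words_def)

context calg
begin

lemma solves_su_iff: "solves A UNIV (su_rels q) G \<longleftrightarrow> su_point A (complex_of_real q) G"
proof (cases "range G \<subseteq> carrier A")
  case True
  then have G: "G \<in> UNIV \<rightarrow> carrier A"
    by auto
  have maps: "word_val A G \<in> UNIV \<rightarrow> carrier A"
    using word_val_maps[OF G] by simp
  have [simp]: "G g \<in> carrier A" for g
    using True by auto
  note ext = lin_ext_add[OF maps] lin_ext_diff[OF maps] lin_ext_single[OF maps]
    word_val_Nil[OF G] word_val_pair[OF G]
  show ?thesis
    using True
    by (simp add: solves_def su_rels_def Let_def ext su_point_def)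
qed (auto simp: solves_def su_point_def)

text \<open>
  The product of any two generators, expanded in ordered monomials. All later checks of quadratic relations
  rest on this table.
\<close>

lemma su_point_mult:
  assumes "su_point A q G"
  shows "G g \<otimes> G h = lincomb A su_words (word_val A G) (su_nf q g h)"
proof -
  have closed [simp]: "G g \<in> carrier A" for g
    using assms by (auto simp: su_point_def)
  then have G: "G \<in> UNIV \<rightarrow> carrier A"
    by auto
  have e: "word_val A G \<in> su_words \<rightarrow> carrier A"
    using word_val_maps[OF G] by auto
  note lc = lincomb_add[OF su_words_finite e, symmetric] lincomb_smult[OF su_words_finite e, symmetric]
    lincomb_diff[OF su_words_finite e] lincomb_kdelta[OF su_words_finite e] word_val_Nil[OF G] word_val_pair[OF G]
  have unit: "x = \<one> \<oplus> (- c) \<odot> y" if "x \<oplus> c \<odot> y = \<one>" "x \<in> carrier A" "y \<in> carrier A" for x y c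
    using that by (simp add: smult_uminus a_assoc r_neg flip: that(1))
  have unit1: "x = \<one> \<oplus> (- 1) \<odot> y" if "x \<oplus> y = \<one>" "x \<in> carrier A" "y \<in> carrier A" for x y
    using unit[of x 1 y] that by simp
  show ?thesis
    using assms unit[of "G Alpha \<otimes> G AlphaBar" "q\<^sup>2" "G GammaBar \<otimes> G Gamma"]
      unit1[of "G AlphaBar \<otimes> G Alpha" "G GammaBar \<otimes> G Gamma"]
    by (cases g; cases h; simp add: su_nf.simps[abs_def] lc su_words_def[THEN eqset_imp_iff] su_point_def)
qed

end

text \<open>
  The three tables below describe the product of two matrices of the form of \<open>u\<close>: the entry attached to the
  generator \<open>g\<close> is the sum of two terms \<open>cop_left g b \<cdot> cop_right g b\<close>, the second one (\<open>b = False\<close>) carrying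
  the coefficient \<open>cop_coef q g\<close>. The entry \<open>- q \<gamma>'\<close> of \<open>u\<close> has been divided by \<open>- q\<close>.
\<close>

fun cop_left :: "su_gen \<Rightarrow> bool \<Rightarrow> su_gen" where
  "cop_left Alpha b = (if b then Alpha else GammaBar)"
| "cop_left Gamma b = (if b then Gamma else AlphaBar)"
| "cop_left AlphaBar b = (if b then AlphaBar else Gamma)"
| "cop_left GammaBar b = (if b then GammaBar else Alpha)"

fun cop_right :: "su_gen \<Rightarrow> bool \<Rightarrow> su_gen" where
  "cop_right Alpha b = (if b then Alpha else Gamma)"
| "cop_right Gamma b = (if b then Alpha else Gamma)"
| "cop_right AlphaBar b = (if b then AlphaBar else GammaBar)"
| "cop_right GammaBar b = (if b then AlphaBar else GammaBar)"

fun cop_coef :: "complex \<Rightarrow> su_gen \<Rightarrow> complex" where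
  "cop_coef q Alpha = - q" | "cop_coef q Gamma = 1" | "cop_coef q AlphaBar = - q" | "cop_coef q GammaBar = 1"

definition su_cop :: "(complex, 'a) module \<Rightarrow> (complex, 'b) module \<Rightarrow> complex \<Rightarrow> (su_gen \<Rightarrow> 'a) \<Rightarrow> (su_gen \<Rightarrow> 'b)
    \<Rightarrow> su_gen \<Rightarrow> ('a \<times> 'b \<Rightarrow>\<^sub>0 complex) set" where
  "su_cop A B q G H g = tens A B (G (cop_left g True)) (H (cop_right g True)) \<oplus>\<^bsub>tensor_alg A B\<^esub>
     cop_coef q g \<odot>\<^bsub>tensor_alg A B\<^esub> tens A B (G (cop_left g False)) (H (cop_right g False))"

context two_calgs
begin

text \<open>
  Quantum matrices of \<open>SU\<^sub>q(2)\<close> with mutually commuting entries can be multiplied; for the generators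
  themselves this is the coproduct. Each product of two entries is a combination of tensors of ordered
  monomials, so every relation turns into an identity of coefficient functions on pairs of monomials.
\<close>

lemma su_cop_point:
  assumes G: "su_point A q G" and H: "su_point B q H"
  shows "su_point AT q (su_cop A B q G H)"
proof -
  have [simp]: "G g \<in> carrier A" "H g \<in> carrier B" for g
    using G H by (auto simp: su_point_def)
  have GH: "G \<in> UNIV \<rightarrow> carrier A" "H \<in> UNIV \<rightarrow> carrier B"
    by auto
  have e: "word_val A G \<in> su_words \<rightarrow> carrier A" "word_val B H \<in> su_words \<rightarrow> carrier B"
    using A.word_val_maps[OF GH(1)] B.word_val_maps[OF GH(2)] by auto
  let ?T = "AT"
  let ?N = "su_words \<times> su_words"
  let ?E = "\<lambda>(n, m). tens A B (word_val A G n) (word_val B H m)"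
  let ?lc = "lincomb ?T ?N ?E"
  have N: "finite ?N" "?E \<in> ?N \<rightarrow> carrier ?T"
    using e su_words_finite by (auto simp: Pi_def)
  note lc = T.lincomb_add[OF N] T.lincomb_smult[OF N]
  \<comment> \<open>\<open>?t g s h t\<close>: coefficients of the product of summand \<open>s\<close> for \<open>g\<close> and summand \<open>t\<close> for \<open>h\<close>.\<close>
  let ?t = "\<lambda>g s h t (n, m). su_nf q (cop_left g s) (cop_left h t) n * su_nf q (cop_right g s) (cop_right h t) m"
  have summand: "tens A B (G (cop_left g s)) (H (cop_right g s)) \<otimes>\<^bsub>?T\<^esub> tens A B (G (cop_left h t)) (H (cop_right h t)) =
    ?lc (?t g s h t)" for g s h t
    using bilin_lincomb[OF A.calg_axioms B.calg_axioms T.calg_axioms tens_bilin su_words_finite e(1) su_words_finite e(2)]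
    by (simp add: tens_mult A.su_point_mult[OF G] B.su_point_mult[OF H])
  let ?K = "\<lambda>g h p. ?t g True h True p + cop_coef q h * ?t g True h False p + cop_coef q g * ?t g False h True p
    + cop_coef q g * cop_coef q h * ?t g False h False p"
  have prod: "su_cop A B q G H g \<otimes>\<^bsub>?T\<^esub> su_cop A B q G H h = ?lc (?K g h)" for g h
  proof -
    have "su_cop A B q G H g \<otimes>\<^bsub>?T\<^esub> su_cop A B q G H h =
      ?lc (?t g True h True) \<oplus>\<^bsub>?T\<^esub> cop_coef q h \<odot>\<^bsub>?T\<^esub> ?lc (?t g True h False)
      \<oplus>\<^bsub>?T\<^esub> cop_coef q g \<odot>\<^bsub>?T\<^esub> ?lc (?t g False h True)
      \<oplus>\<^bsub>?T\<^esub> (cop_coef q g * cop_coef q h) \<odot>\<^bsub>?T\<^esub> ?lc (?t g False h False)"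
      unfolding summand[symmetric] su_cop_def
      by (simp add: T.l_distr T.r_distr T.smult_mult_left T.smult_mult_right T.smult_r_distr T.a_ac mult.commute)
    then show ?thesis
      by (simp only: lc)
  qed
  have one: "\<one>\<^bsub>?T\<^esub> = ?lc (\<lambda>(n, m). kdelta [] n * kdelta [] m)"
  proof -
    have "?lc (\<lambda>(n, m). kdelta [] n * kdelta [] m) =
      tens A B (lincomb A su_words (word_val A G) (kdelta [])) (lincomb B su_words (word_val B H) (kdelta []))"
      using bilin_lincomb[OF A.calg_axioms B.calg_axioms T.calg_axioms tens_bilin su_words_finite e(1) su_words_finite e(2)]
      by simp
    also have "\<dots> = \<one>\<^bsub>?T\<^esub>"
      by (simp add: A.lincomb_kdelta[OF su_words_finite e(1)] B.lincomb_kdelta[OF su_words_finite e(2)]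
          A.word_val_Nil[OF GH(1)] B.word_val_Nil[OF GH(2)] tens_one su_words_def[THEN eqset_imp_iff])
    finally show ?thesis ..
  qed
  have cong: "?lc k = ?lc l" if "\<And>n m. k (n, m) = l (n, m)" for k l
    using that by (metis ext surj_pair)
  show ?thesis
    unfolding su_point_def prod one lc
  proof (intro conjI cong)
    show "range (su_cop A B q G H) \<subseteq> carrier ?T"
      by (auto simp: su_cop_def)
  qed (simp_all add: algebra_simps power2_eq_square)
qed

end

lemma su_counit_point:
  "su_point complex_alg q (\<lambda>g. if g = Alpha \<or> g = AlphaBar then 1 else 0)"
  by (simp add: su_point_def)


section \<open>Coproduct and counit\<close>

lemma SU_calg: "calg (SU_alg q)"
  unfolding SU_alg_def by (rule calg.quot_calg[OF free_calg su_rels_closed])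

lemma SU_gen_point: "su_point (SU_alg q) (complex_of_real q) (SU_gen q)"
  using presented_gens_solve[OF su_rels_closed, of q] calg.solves_su_iff[OF SU_calg, of q q]
  by (simp add: SU_alg_def SU_gen_def[abs_def])

lemma SU_gen_closed [simp]: "SU_gen q g \<in> carrier (SU_alg q)"
  using SU_gen_point[of q] by (auto simp: su_point_def)

lemma SU_hom:
  assumes "calg A" "su_point A (complex_of_real q) G"
  shows "\<exists>h. h \<in> alg_hom (SU_alg q) A \<and> (\<forall>g. h (SU_gen q g) = G g)"
  using calg.presented_hom[OF assms(1) su_rels_closed, of q G] calg.solves_su_iff[OF assms(1), of q G] assms(2)
  by (simp add: SU_alg_def SU_gen_def)

context
  fixes q :: real
  assumes q: "q \<noteq> 0"
begin

private abbreviation (input) "SU \<equiv> SU_alg q"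
private abbreviation (input) "SUSU \<equiv> tensor_alg (SU_alg q) (SU_alg q)"

interpretation SU: calg SU by (rule SU_calg)
interpretation SUSU: two_calgs SU SU ..

text \<open>
  The defining property of the coproduct refers to the entries of \<open>u\<close>, among them \<open>- q \<gamma>'\<close>; dividing by the
  nonzero \<open>- q\<close> turns it into the values on the generators.
\<close>

lemma SU_comult_spec_iff:
  assumes "\<Delta> \<in> alg_hom SU SUSU"
  shows "(\<forall>i\<in>{1, 2}. \<forall>j\<in>{1, 2}. \<Delta> (SU_u q i j) = (\<Oplus>\<^bsub>SUSU\<^esub>k\<in>{1, 2}. tens SU SU (SU_u q i k) (SU_u q k j))) \<longleftrightarrow>
    (\<forall>g. \<Delta> (SU_gen q g) = su_cop SU SU (complex_of_real q) (SU_gen q) (SU_gen q) g)"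
proof -
  note \<Delta> = alg_hom_lin[OF assms]
  let ?q = "complex_of_real q"
  have [simp]: "SU_u q i j \<in> carrier SU" for i j
    by (simp add: SU_u_def)
  have sum: "(\<Oplus>\<^bsub>SUSU\<^esub>k\<in>{1::nat, 2}. tens SU SU (SU_u q i k) (SU_u q k j)) =
    tens SU SU (SU_u q i 1) (SU_u q 1 j) \<oplus>\<^bsub>SUSU\<^esub> tens SU SU (SU_u q i 2) (SU_u q 2 j)" for i j
    by (simp add: Pi_def)
  have tens_smult: "tens SU SU (c \<odot>\<^bsub>SU\<^esub> x) y = c \<odot>\<^bsub>SUSU\<^esub> tens SU SU x y" "tens SU SU x (c \<odot>\<^bsub>SU\<^esub> y) = c \<odot>\<^bsub>SUSU\<^esub> tens SU SU x y"
    if "x \<in> carrier SU" "y \<in> carrier SU" for c x y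
    using lin_smult[OF SUSU.tens_lin_left] lin_smult[OF SUSU.tens_lin_right] that by auto
  have cancel: "(- ?q) \<odot>\<^bsub>SUSU\<^esub> x = (- ?q) \<odot>\<^bsub>SUSU\<^esub> y \<longleftrightarrow> x = y" if "x \<in> carrier SUSU" "y \<in> carrier SUSU" for x y
  proof
    assume "(- ?q) \<odot>\<^bsub>SUSU\<^esub> x = (- ?q) \<odot>\<^bsub>SUSU\<^esub> y"
    then have "inverse (- ?q) \<odot>\<^bsub>SUSU\<^esub> ((- ?q) \<odot>\<^bsub>SUSU\<^esub> x) = inverse (- ?q) \<odot>\<^bsub>SUSU\<^esub> ((- ?q) \<odot>\<^bsub>SUSU\<^esub> y)"
      by simp
    then show "x = y"
      using that q by simp
  qed simp
  have bar: "\<Delta> (SU_u q 1 2) = (- ?q) \<odot>\<^bsub>SUSU\<^esub> \<Delta> (SU_gen q GammaBar)"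
    by (simp add: SU_u_def lin_smult[OF \<Delta>])
  have bar': "tens SU SU (SU_u q 1 1) (SU_u q 1 2) \<oplus>\<^bsub>SUSU\<^esub> tens SU SU (SU_u q 1 2) (SU_u q 2 2) =
    (- ?q) \<odot>\<^bsub>SUSU\<^esub> su_cop SU SU ?q (SU_gen q) (SU_gen q) GammaBar"
    by (simp add: SU_u_def su_cop_def tens_smult SUSU.T.smult_r_distr SUSU.T.a_ac)
  have gens: "(\<forall>g. P g) \<longleftrightarrow> P Alpha \<and> P Gamma \<and> P AlphaBar \<and> P GammaBar" for P
    by (metis su_gen.exhaust)
  have cop: "su_cop SU SU ?q (SU_gen q) (SU_gen q) g \<in> carrier SUSU" for g
    by (simp add: su_cop_def)
  have "(\<forall>i\<in>{1, 2}. \<forall>j\<in>{1, 2}. \<Delta> (SU_u q i j) = (\<Oplus>\<^bsub>SUSU\<^esub>k\<in>{1, 2}. tens SU SU (SU_u q i k) (SU_u q k j))) \<longleftrightarrow>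
      \<Delta> (SU_u q 1 1) = tens SU SU (SU_u q 1 1) (SU_u q 1 1) \<oplus>\<^bsub>SUSU\<^esub> tens SU SU (SU_u q 1 2) (SU_u q 2 1) \<and>
      \<Delta> (SU_u q 1 2) = tens SU SU (SU_u q 1 1) (SU_u q 1 2) \<oplus>\<^bsub>SUSU\<^esub> tens SU SU (SU_u q 1 2) (SU_u q 2 2) \<and>
      \<Delta> (SU_u q 2 1) = tens SU SU (SU_u q 2 1) (SU_u q 1 1) \<oplus>\<^bsub>SUSU\<^esub> tens SU SU (SU_u q 2 2) (SU_u q 2 1) \<and>
      \<Delta> (SU_u q 2 2) = tens SU SU (SU_u q 2 1) (SU_u q 1 2) \<oplus>\<^bsub>SUSU\<^esub> tens SU SU (SU_u q 2 2) (SU_u q 2 2)"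
    unfolding sum by blast
  also have "\<dots> \<longleftrightarrow> (\<forall>g. \<Delta> (SU_gen q g) = su_cop SU SU ?q (SU_gen q) (SU_gen q) g)"
    unfolding bar bar' cancel[OF lin_closed[OF \<Delta> SU_gen_closed] cop] gens
    by (simp add: SU_u_def su_cop_def tens_smult SUSU.T.a_ac conj_ac)
  finally show ?thesis .
qed

lemma SU_comult:
  shows "SU_comult q \<in> alg_hom SU SUSU"
    and "SU_comult q (SU_gen q g) = su_cop SU SU (complex_of_real q) (SU_gen q) (SU_gen q) g"
proof -
  let ?P = "\<lambda>\<Delta>. \<Delta> \<in> alg_hom SU SUSU \<and>
    (\<forall>i\<in>{1, 2}. \<forall>j\<in>{1, 2}. \<Delta> (SU_u q i j) = (\<Oplus>\<^bsub>SUSU\<^esub>k\<in>{1, 2}. tens SU SU (SU_u q i k) (SU_u q k j)))"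
  obtain \<Delta> where \<Delta>: "\<Delta> \<in> alg_hom SU SUSU"
    "\<forall>g. \<Delta> (SU_gen q g) = su_cop SU SU (complex_of_real q) (SU_gen q) (SU_gen q) g"
    using SU_hom[OF SUSU.T.calg_axioms SUSU.su_cop_point[OF SU_gen_point SU_gen_point]] by metis
  have "?P (SU_comult q)"
    unfolding SU_comult_def
    by (rule someI[of ?P \<Delta>]) (rule conjI[OF \<Delta>(1) iffD2[OF SU_comult_spec_iff[OF \<Delta>(1)] \<Delta>(2)]])
  then have \<Delta>': "SU_comult q \<in> alg_hom SU SUSU"
    "\<forall>g. SU_comult q (SU_gen q g) = su_cop SU SU (complex_of_real q) (SU_gen q) (SU_gen q) g"
    by (metis (mono_tags) SU_comult_spec_iff)+
  show "SU_comult q \<in> alg_hom SU SUSU"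
    "SU_comult q (SU_gen q g) = su_cop SU SU (complex_of_real q) (SU_gen q) (SU_gen q) g"
    by (rule \<Delta>'(1)) (rule spec[OF \<Delta>'(2)])
qed

lemma SU_counit:
  shows "SU_counit q \<in> alg_hom SU complex_alg"
    and "SU_counit q (SU_gen q g) = (if g = Alpha \<or> g = AlphaBar then 1 else 0)"
proof -
  let ?P = "\<lambda>\<epsilon>. \<epsilon> \<in> alg_hom SU complex_alg \<and> (\<forall>i\<in>{1, 2}. \<forall>j\<in>{1, 2}. \<epsilon> (SU_u q i j) = (if i = j then 1 else 0))"
  have iff: "(\<forall>i\<in>{1, 2}. \<forall>j\<in>{1, 2}. \<epsilon> (SU_u q i j) = (if i = j then 1 else 0)) \<longleftrightarrow>
    (\<forall>g. \<epsilon> (SU_gen q g) = (if g = Alpha \<or> g = AlphaBar then 1 else 0))" if "\<epsilon> \<in> alg_hom SU complex_alg" for \<epsilon>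
  proof -
    have gens: "(\<forall>g. P g) \<longleftrightarrow> P Alpha \<and> P Gamma \<and> P AlphaBar \<and> P GammaBar" for P
      by (metis su_gen.exhaust)
    have "\<epsilon> (SU_u q 1 2) = - complex_of_real q * \<epsilon> (SU_gen q GammaBar)"
      using lin_smult[OF alg_hom_lin[OF that], of "SU_gen q GammaBar" "- complex_of_real q"] by (simp add: SU_u_def)
    then show ?thesis
      unfolding gens using q by (auto simp: SU_u_def)
  qed
  obtain \<epsilon> where \<epsilon>: "\<epsilon> \<in> alg_hom SU complex_alg"
    "\<forall>g. \<epsilon> (SU_gen q g) = (if g = Alpha \<or> g = AlphaBar then 1 else 0)"
    using SU_hom[OF complex_calg su_counit_point, of q] by metis
  have "?P (SU_counit q)"
    unfolding SU_counit_def by (rule someI[of ?P \<epsilon>]) (rule conjI[OF \<epsilon>(1) iffD2[OF iff[OF \<epsilon>(1)] \<epsilon>(2)]])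
  then have \<epsilon>': "SU_counit q \<in> alg_hom SU complex_alg"
    "\<forall>g. SU_counit q (SU_gen q g) = (if g = Alpha \<or> g = AlphaBar then 1 else 0)"
    by (metis (mono_tags) iff)+
  show "SU_counit q \<in> alg_hom SU complex_alg"
    "SU_counit q (SU_gen q g) = (if g = Alpha \<or> g = AlphaBar then 1 else 0)"
    by (rule \<epsilon>'(1)) (rule spec[OF \<epsilon>'(2)])
qed

end

section \<open>The R-matrix relations in the quantum group SU(2)\<close>

abbreviation (input) "I4 \<equiv> {1..4::nat}"

lemma sum_single_support:
  fixes f :: "'i \<Rightarrow> complex"
  assumes "finite S" "\<And>p. p \<in> S \<Longrightarrow> p \<noteq> p0 \<Longrightarrow> f p = 0"
  shows "sum f S = (if p0 \<in> S then f p0 else 0)"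
  using assms sum.mono_neutral_right[of S "S \<inter> {p0}" f] by auto

text \<open>
  In every sum that defines \<open>R\<close> at most one summand contributes to a given entry, since the indices of the
  matrix units can be read off from the row and the column.
\<close>

lemma sp_R_eq:
  assumes "a \<in> I4" "b \<in> I4" "c \<in> I4" "d \<in> I4"
  shows "sp_R q a c b d =
    (if a = b \<and> c = d then
       (if a = c then complex_of_real q else if a = 5 - c then inverse (complex_of_real q) else 1) else 0)
    + (complex_of_real q - inverse (complex_of_real q)) * (if a = d \<and> b = c \<and> a > b then 1 else 0)
    - (complex_of_real q - inverse (complex_of_real q)) * (if a > b \<and> c = 5 - a \<and> d = 5 - b then
        complex_of_real q powi (sp_rho a - sp_rho b) * sp_eps a * sp_eps b else 0)"
proof -
  let ?q = "complex_of_real q"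
  let ?D = "{(i, j). i \<in> I4 \<and> j \<in> I4 \<and> i \<noteq> j \<and> i \<noteq> conj_idx j}"
  let ?L = "{(i, j). i \<in> I4 \<and> j \<in> I4 \<and> i > j}"
  have fin: "finite ?D" "finite ?L"
    by (rule finite_subset[of _ "I4 \<times> I4"]; auto)+
  have "(\<Sum>i\<in>I4. unit_tens i i i i a c b d) = (if a = b \<and> c = d \<and> a = c then 1 else 0)"
    using assms by (subst sum_single_support[of _ a]) (auto simp: unit_tens_def mat_unit_def split: if_splits)
  moreover have "(\<Sum>(i, j)\<in>?D. unit_tens i i j j a c b d) = (if a = b \<and> c = d \<and> a \<noteq> c \<and> a \<noteq> 5 - c then 1 else 0)"
    using assms fin by (subst sum_single_support[of _ "(a, c)"]) (auto simp: unit_tens_def mat_unit_def conj_idx_def split: if_splits)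
  moreover have "(\<Sum>i\<in>I4. unit_tens (conj_idx i) (conj_idx i) i i a c b d) = (if a = b \<and> c = d \<and> a = 5 - c then 1 else 0)"
    using assms by (subst sum_single_support[of _ c]) (auto simp: unit_tens_def mat_unit_def conj_idx_def split: if_splits)
  moreover have "(\<Sum>(i, j)\<in>?L. unit_tens i j j i a c b d) = (if a = d \<and> b = c \<and> a > b then 1 else 0)"
    using assms fin by (subst sum_single_support[of _ "(a, b)"]) (auto simp: unit_tens_def mat_unit_def split: if_splits)
  moreover have "(\<Sum>(i, j)\<in>?L. ?q powi (sp_rho i - sp_rho j) * sp_eps i * sp_eps j
      * unit_tens i j (conj_idx i) (conj_idx j) a c b d) =
    (if a > b \<and> c = 5 - a \<and> d = 5 - b then ?q powi (sp_rho a - sp_rho b) * sp_eps a * sp_eps b else 0)"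
    using assms fin by (subst sum_single_support[of _ "(a, b)"]) (auto simp: unit_tens_def mat_unit_def conj_idx_def split: if_splits)
  moreover have "\<not> (a = c \<and> a = 5 - c)"
    by presburger
  ultimately show ?thesis
    unfolding sp_R_def Let_def by (auto simp: algebra_simps)
qed

text \<open>
  The entry \<open>w\<^sub>i\<^sup>k\<close> of the block diagonal matrix \<open>w\<close> is \<open>levi_coef q i k\<close> times the generator \<open>levi_gen i k\<close>.
  The two \<open>2 \<times> 2\<close> blocks come from a Levi subgroup of the symplectic group: the first block determines the
  second one through \<open>w C w\<^sup>t = C\<close>. Outside the blocks the coefficient vanishes and the generator is
  arbitrary.
\<close>

definition levi_gen :: "nat \<Rightarrow> nat \<Rightarrow> su_gen" where
  "levi_gen i k = (if odd i then (if odd k then Alpha else Gamma) else (if odd k then GammaBar else AlphaBar))"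

definition levi_coef :: "complex \<Rightarrow> nat \<Rightarrow> nat \<Rightarrow> complex" where
  "levi_coef q i k =
     (if i = k then 1 else if (i, k) = (1, 2) then q else if (i, k) = (2, 1) then - 1
      else if (i, k) = (3, 4) then - q else if (i, k) = (4, 3) then 1 else 0)"

text \<open>
  The relation \<open>R w\<^sub>1 w\<^sub>2 = w\<^sub>2 w\<^sub>1 R\<close> on the level of the coefficients of an ordered monomial \<open>n\<close>: a finite
  check over the quadruples of indices, where only identities between powers of \<open>q\<close> remain.
\<close>

lemma levi_RTT_coefs:
  assumes q: "q \<noteq> 0" and "i \<in> I4" "k \<in> I4" "j \<in> I4" "l \<in> I4"
  defines "Q \<equiv> complex_of_real q"
  shows "(\<Sum>a\<in>I4. \<Sum>b\<in>I4. sp_R q i k a b *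
      (levi_coef Q a j * levi_coef Q b l * su_nf Q (levi_gen a j) (levi_gen b l) n)) =
    (\<Sum>a\<in>I4. \<Sum>b\<in>I4. sp_R q b a j l *
      (levi_coef Q k a * levi_coef Q i b * su_nf Q (levi_gen k a) (levi_gen i b) n))"
proof -
  have Q: "Q \<noteq> 0"
    using q by (simp add: Q_def)
  have cases: "i = 1 \<or> i = 2 \<or> i = 3 \<or> i = 4" "j = 1 \<or> j = 2 \<or> j = 3 \<or> j = 4"
    "k = 1 \<or> k = 2 \<or> k = 3 \<or> k = 4" "l = 1 \<or> l = 2 \<or> l = 3 \<or> l = 4"
    using assms by auto
  show ?thesis
    using cases
    by (elim disjE; simp add: atLeastAtMost_1_4 sp_R_eq levi_coef_def levi_gen_def sp_rho_def sp_eps_def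
        power_int_minus Q_def[symmetric] del: One_nat_def;
        simp add: Q field_simps power2_eq_square power3_eq_cube power4_eq_xxxx del: One_nat_def)
qed

lemma levi_C_coefs:
  assumes q: "q \<noteq> 0" and "i \<in> I4" "j \<in> I4"
  defines "Q \<equiv> complex_of_real q"
  shows "(\<Sum>a\<in>I4. \<Sum>b\<in>I4. sp_C q a b *
      (levi_coef Q i a * levi_coef Q j b * su_nf Q (levi_gen i a) (levi_gen j b) n)) = sp_C q i j * kdelta [] n"
    and "(\<Sum>a\<in>I4. \<Sum>b\<in>I4. sp_C q a b *
      (levi_coef Q a i * levi_coef Q b j * su_nf Q (levi_gen a i) (levi_gen b j) n)) = sp_C q i j * kdelta [] n"
proof -
  have Q: "Q \<noteq> 0"
    using q by (simp add: Q_def)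
  have cases: "i = 1 \<or> i = 2 \<or> i = 3 \<or> i = 4" "j = 1 \<or> j = 2 \<or> j = 3 \<or> j = 4"
    using assms by auto
  show "(\<Sum>a\<in>I4. \<Sum>b\<in>I4. sp_C q a b *
      (levi_coef Q i a * levi_coef Q j b * su_nf Q (levi_gen i a) (levi_gen j b) n)) = sp_C q i j * kdelta [] n"
    "(\<Sum>a\<in>I4. \<Sum>b\<in>I4. sp_C q a b *
      (levi_coef Q a i * levi_coef Q b j * su_nf Q (levi_gen a i) (levi_gen b j) n)) = sp_C q i j * kdelta [] n"
    using cases
    by (elim disjE; simp add: atLeastAtMost_1_4 sp_C_def conj_idx_def levi_coef_def levi_gen_def sp_rho_def sp_eps_def
        power_int_minus Q_def[symmetric] del: One_nat_def;
        simp add: Q field_simps power2_eq_square power3_eq_cube power4_eq_xxxx del: One_nat_def)+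
qed

section \<open>Points of the quantum symplectic group\<close>

text \<open>
  Kept as a constant, so that the nested sums over matrix indices are rearranged by the lemmas below only.
\<close>

definition dsum :: "(complex, 'a) module \<Rightarrow> (nat \<Rightarrow> nat \<Rightarrow> 'a) \<Rightarrow> 'a" where
  "dsum A f = (\<Oplus>\<^bsub>A\<^esub>a\<in>I4. \<Oplus>\<^bsub>A\<^esub>b\<in>I4. f a b)"

context calg
begin

lemma dsum_closed: "(\<And>a b. a \<in> I4 \<Longrightarrow> b \<in> I4 \<Longrightarrow> f a b \<in> carrier A) \<Longrightarrow> dsum A f \<in> carrier A"
  unfolding dsum_def by (intro finsum_closed) (auto intro!: finsum_closed)

lemma dsum_cong:
  assumes "\<And>a b. a \<in> I4 \<Longrightarrow> b \<in> I4 \<Longrightarrow> f a b = g a b" "\<And>a b. a \<in> I4 \<Longrightarrow> b \<in> I4 \<Longrightarrow> g a b \<in> carrier A"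
  shows "dsum A f = dsum A g"
  unfolding dsum_def using assms by (intro finsum_cong' refl) (auto intro!: finsum_closed)

lemma dsum_flip:
  "(\<And>a b. a \<in> I4 \<Longrightarrow> b \<in> I4 \<Longrightarrow> f a b \<in> carrier A) \<Longrightarrow> dsum A f = dsum A (\<lambda>a b. f b a)"
  unfolding dsum_def by (rule finsum_swap) auto

lemma dsum_Times:
  assumes "\<And>a b. a \<in> I4 \<Longrightarrow> b \<in> I4 \<Longrightarrow> f a b \<in> carrier A"
  shows "dsum A f = (\<Oplus>p\<in>I4 \<times> I4. f (fst p) (snd p))"
  unfolding dsum_def using finsum_Times[of I4 I4 "\<lambda>p. f (fst p) (snd p)"] assms by simp

lemma dsum_swap:
  assumes "\<And>a b c d. a \<in> I4 \<Longrightarrow> b \<in> I4 \<Longrightarrow> c \<in> I4 \<Longrightarrow> d \<in> I4 \<Longrightarrow> f a b c d \<in> carrier A"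
  shows "dsum A (\<lambda>a b. dsum A (\<lambda>c d. f a b c d)) = dsum A (\<lambda>c d. dsum A (\<lambda>a b. f a b c d))"
proof -
  have Times: "dsum A (\<lambda>a b. dsum A (\<lambda>c d. g a b c d)) =
    (\<Oplus>p\<in>I4 \<times> I4. \<Oplus>r\<in>I4 \<times> I4. g (fst p) (snd p) (fst r) (snd r))"
    if g: "\<And>a b c d. a \<in> I4 \<Longrightarrow> b \<in> I4 \<Longrightarrow> c \<in> I4 \<Longrightarrow> d \<in> I4 \<Longrightarrow> g a b c d \<in> carrier A" for g
  proof -
    let ?h = "\<lambda>a b. \<Oplus>r\<in>I4 \<times> I4. g a b (fst r) (snd r)"
    have "dsum A (\<lambda>a b. dsum A (\<lambda>c d. g a b c d)) = dsum A ?h"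
      by (intro dsum_cong dsum_Times) (auto intro!: finsum_closed g)
    also have "\<dots> = (\<Oplus>p\<in>I4 \<times> I4. ?h (fst p) (snd p))"
      by (rule dsum_Times) (auto intro!: finsum_closed g)
    finally show ?thesis .
  qed
  have "(\<Oplus>p\<in>I4 \<times> I4. \<Oplus>r\<in>I4 \<times> I4. f (fst p) (snd p) (fst r) (snd r)) =
    (\<Oplus>r\<in>I4 \<times> I4. \<Oplus>p\<in>I4 \<times> I4. f (fst p) (snd p) (fst r) (snd r))"
    using assms by (intro finsum_swap) auto
  then show ?thesis
    using Times[of f, OF assms] Times[of "\<lambda>c d a b. f a b c d", OF assms] by simp
qed

lemma dsum_smult:
  assumes "\<And>a b. a \<in> I4 \<Longrightarrow> b \<in> I4 \<Longrightarrow> f a b \<in> carrier A"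
  shows "c \<odot> dsum A f = dsum A (\<lambda>a b. c \<odot> f a b)"
proof -
  have "c \<odot> dsum A f = (\<Oplus>a\<in>I4. c \<odot> (\<Oplus>b\<in>I4. f a b))"
    unfolding dsum_def using assms by (intro smult_finsum) (auto intro!: finsum_closed)
  also have "\<dots> = dsum A (\<lambda>a b. c \<odot> f a b)"
    unfolding dsum_def using assms by (intro finsum_cong') (auto intro!: finsum_closed smult_finsum)
  finally show ?thesis .
qed

lemma dsum_mult:
  assumes "\<And>a. a \<in> I4 \<Longrightarrow> x a \<in> carrier A" "\<And>b. b \<in> I4 \<Longrightarrow> y b \<in> carrier A"
  shows "(\<Oplus>a\<in>I4. x a) \<otimes> (\<Oplus>b\<in>I4. y b) = dsum A (\<lambda>a b. x a \<otimes> y b)"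
proof -
  have "(\<Oplus>a\<in>I4. x a) \<otimes> (\<Oplus>b\<in>I4. y b) = (\<Oplus>a\<in>I4. x a \<otimes> (\<Oplus>b\<in>I4. y b))"
    using assms by (intro finsum_ldistr) (auto intro!: finsum_closed)
  also have "\<dots> = dsum A (\<lambda>a b. x a \<otimes> y b)"
    unfolding dsum_def using assms by (intro finsum_cong' finsum_rdistr) (auto intro!: finsum_closed)
  finally show ?thesis .
qed

lemma dsum_lincomb:
  assumes "finite N" "e \<in> N \<rightarrow> carrier A"
  shows "dsum A (\<lambda>a b. lincomb A N e (k a b)) = lincomb A N e (\<lambda>n. \<Sum>a\<in>I4. \<Sum>b\<in>I4. k a b n)"
  unfolding dsum_def lincomb_sum[OF assms] ..

end

lemma sum_I4:
  assumes "calg A" "\<And>i. i \<in> I4 \<Longrightarrow> f i \<in> carrier A"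
  shows "(\<Oplus>\<^bsub>A\<^esub>i\<in>I4. f i) = f 1 \<oplus>\<^bsub>A\<^esub> (f 2 \<oplus>\<^bsub>A\<^esub> (f 3 \<oplus>\<^bsub>A\<^esub> f 4))"
proof -
  interpret calg A by fact
  show ?thesis
    using assms(2) unfolding atLeastAtMost_1_4 by (simp add: Pi_def)
qed

lemma lin_dsum:
  assumes "calg A" "calg B" "h \<in> lin A B" "\<And>a b. a \<in> I4 \<Longrightarrow> b \<in> I4 \<Longrightarrow> f a b \<in> carrier A"
  shows "h (dsum A f) = dsum B (\<lambda>a b. h (f a b))"
proof -
  interpret A: calg A by fact
  interpret B: calg B by fact
  have "h (dsum A f) = (\<Oplus>\<^bsub>B\<^esub>a\<in>I4. h (\<Oplus>\<^bsub>A\<^esub>b\<in>I4. f a b))"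
    unfolding dsum_def using assms(4) by (intro lin_finsum[OF assms(1-3)]) (auto intro!: A.finsum_closed)
  also have "\<dots> = dsum B (\<lambda>a b. h (f a b))"
    unfolding dsum_def using assms(4) lin_closed[OF assms(3)]
    by (intro B.finsum_cong' refl lin_finsum[OF assms(1-3)]) (auto intro!: B.finsum_closed)
  finally show ?thesis .
qed

text \<open>
  A quantum symplectic matrix over \<open>A\<close>: its entries satisfy \<open>R T\<^sub>1 T\<^sub>2 = T\<^sub>2 T\<^sub>1 R\<close>, \<open>T C T\<^sup>t = C\<close> and \<open>T\<^sup>t C T =
  C\<close>. The last two relations are equivalent to \<open>T C T\<^sup>t C\<inverse> = 1\<close> and, because of \<open>C\<inverse> = - C\<close>, to \<open>C T\<^sup>t C\<inverse> T =
  1\<close>; in this form they are preserved by products.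
\<close>

definition sp_point :: "(complex, 'a) module \<Rightarrow> real \<Rightarrow> (nat \<Rightarrow> nat \<Rightarrow> 'a) \<Rightarrow> bool" where
  "sp_point A q T \<longleftrightarrow>
     (\<forall>i\<in>I4. \<forall>j\<in>I4. T i j \<in> carrier A) \<and>
     (\<forall>i\<in>I4. \<forall>k\<in>I4. \<forall>j\<in>I4. \<forall>l\<in>I4.
       dsum A (\<lambda>a b. sp_R q i k a b \<odot>\<^bsub>A\<^esub> (T a j \<otimes>\<^bsub>A\<^esub> T b l)) =
       dsum A (\<lambda>a b. sp_R q b a j l \<odot>\<^bsub>A\<^esub> (T k a \<otimes>\<^bsub>A\<^esub> T i b))) \<and>
     (\<forall>i\<in>I4. \<forall>j\<in>I4. dsum A (\<lambda>a b. sp_C q a b \<odot>\<^bsub>A\<^esub> (T i a \<otimes>\<^bsub>A\<^esub> T j b)) = sp_C q i j \<odot>\<^bsub>A\<^esub> \<one>\<^bsub>A\<^esub>) \<and>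
     (\<forall>i\<in>I4. \<forall>j\<in>I4. dsum A (\<lambda>a b. sp_C q a b \<odot>\<^bsub>A\<^esub> (T a i \<otimes>\<^bsub>A\<^esub> T b j)) = sp_C q i j \<odot>\<^bsub>A\<^esub> \<one>\<^bsub>A\<^esub>)"

lemma sp_rels_closed: "sp_rels q \<subseteq> carrier (free_alg sp_gens)"
proof -
  have keys: "supp (monom w c) \<subseteq> lists sp_gens" if "w \<in> lists sp_gens"
    for w :: "(nat \<times> nat) list" and c :: complex
    using that by simp
  show ?thesis
    unfolding sp_rels_def free_alg_carrier
    by (intro Un_least subsetI; elim CollectE exE conjE; simp only: mem_Collect_eq;
        intro keys_minus_subset keys_sum_subset keys; simp add: sp_gens_def)
qed

context calg
begin

lemma lin_ext_double_sum:
  assumes \<beta>: "\<beta> \<in> K \<rightarrow> carrier A" and w: "\<And>a b. a \<in> I4 \<Longrightarrow> b \<in> I4 \<Longrightarrow> w a b \<in> K"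
  shows "lin_ext A \<beta> (\<Sum>a\<in>I4. \<Sum>b\<in>I4. monom (w a b) (c a b)) = dsum A (\<lambda>a b. c a b \<odot> \<beta> (w a b))"
proof -
  have "lin_ext A \<beta> (\<Sum>a\<in>I4. \<Sum>b\<in>I4. monom (w a b) (c a b)) =
      (\<Oplus>a\<in>I4. lin_ext A \<beta> (\<Sum>b\<in>I4. monom (w a b) (c a b)))"
    using w by (intro lin_ext_sum[OF \<beta>] keys_sum_subset) (auto split: if_splits)
  also have "\<dots> = (\<Oplus>a\<in>I4. \<Oplus>b\<in>I4. lin_ext A \<beta> (monom (w a b) (c a b)))"
    using w by (intro finsum_cong' refl lin_ext_sum[OF \<beta>]) (auto intro!: finsum_closed lin_ext_closed[OF \<beta>] split: if_splits)
  also have "\<dots> = dsum A (\<lambda>a b. c a b \<odot> \<beta> (w a b))"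
    unfolding dsum_def using w \<beta> lin_ext_single[OF \<beta>]
    by (intro finsum_cong' refl) (auto intro!: finsum_closed smult_closed)
  finally show ?thesis .
qed

lemma lin_ext_triple_sum:
  assumes \<beta>: "\<beta> \<in> K \<rightarrow> carrier A" and w: "\<And>a b c. a \<in> I4 \<Longrightarrow> b \<in> I4 \<Longrightarrow> c \<in> I4 \<Longrightarrow> w a b c \<in> K"
  shows "lin_ext A \<beta> (\<Sum>a\<in>I4. \<Sum>b\<in>I4. \<Sum>c\<in>I4. monom (w a b c) (k a b c)) =
    (\<Oplus>a\<in>I4. dsum A (\<lambda>b c. k a b c \<odot> \<beta> (w a b c)))"
proof -
  have "lin_ext A \<beta> (\<Sum>a\<in>I4. \<Sum>b\<in>I4. \<Sum>c\<in>I4. monom (w a b c) (k a b c)) =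
      (\<Oplus>a\<in>I4. lin_ext A \<beta> (\<Sum>b\<in>I4. \<Sum>c\<in>I4. monom (w a b c) (k a b c)))"
    using w by (intro lin_ext_sum[OF \<beta>] keys_sum_subset) (auto split: if_splits)
  also have "\<dots> = (\<Oplus>a\<in>I4. dsum A (\<lambda>b c. k a b c \<odot> \<beta> (w a b c)))"
    using w \<beta> by (intro finsum_cong' refl lin_ext_double_sum[OF \<beta>]) (auto intro!: dsum_closed smult_closed)
  finally show ?thesis .
qed

text \<open>
  Serves to cancel the scalar matrix \<open>C\<close> in \<open>T C T\<^sup>t C\<inverse> = 1\<close> and \<open>C T\<^sup>t C\<inverse> T = 1\<close>, one row or column at a time:
  \<open>M\<close> is that row or column of the remaining factor, \<open>P\<close> the cancelled matrix and \<open>Q\<close> its inverse.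
\<close>

lemma matrix_cancel:
  assumes inv: "\<And>c c'. c \<in> I4 \<Longrightarrow> c' \<in> I4 \<Longrightarrow> (\<Sum>j\<in>I4. Q j c * P c' j) = (if c = c' then 1 else 0)"
    and inv': "\<And>j j'. j \<in> I4 \<Longrightarrow> j' \<in> I4 \<Longrightarrow> (\<Sum>c\<in>I4. P c j * Q j' c) = (if j = j' then 1 else 0)"
    and M: "\<And>c. c \<in> I4 \<Longrightarrow> M c \<in> carrier A" and i: "i \<in> I4"
  shows "(\<forall>j\<in>I4. (\<Oplus>c\<in>I4. P c j \<odot> M c) = (if i = j then 1 else 0) \<odot> \<one>) \<longleftrightarrow> (\<forall>c\<in>I4. M c = Q i c \<odot> \<one>)"
proof
  assume *: "\<forall>c\<in>I4. M c = Q i c \<odot> \<one>"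
  show "\<forall>j\<in>I4. (\<Oplus>c\<in>I4. P c j \<odot> M c) = (if i = j then 1 else 0) \<odot> \<one>"
  proof
    fix j assume j: "j \<in> I4"
    have "(\<Oplus>c\<in>I4. P c j \<odot> M c) = (\<Oplus>c\<in>I4. (P c j * Q i c) \<odot> \<one>)"
      using * by (intro finsum_cong') auto
    also have "\<dots> = (\<Sum>c\<in>I4. P c j * Q i c) \<odot> \<one>"
      by (rule finsum_smult_left) simp
    finally show "(\<Oplus>c\<in>I4. P c j \<odot> M c) = (if i = j then 1 else 0) \<odot> \<one>"
      using inv'[OF j i] by (simp add: eq_commute)
  qed
next
  assume *: "\<forall>j\<in>I4. (\<Oplus>c\<in>I4. P c j \<odot> M c) = (if i = j then 1 else 0) \<odot> \<one>"
  show "\<forall>c\<in>I4. M c = Q i c \<odot> \<one>"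
  proof
    fix c assume c: "c \<in> I4"
    have "(\<Oplus>j\<in>I4. Q j c \<odot> (\<Oplus>c'\<in>I4. P c' j \<odot> M c')) = (\<Oplus>j\<in>I4. \<Oplus>c'\<in>I4. (Q j c * P c' j) \<odot> M c')"
      using M by (intro finsum_cong' refl) (auto simp: smult_finsum Pi_def intro!: finsum_closed finsum_cong')
    also have "\<dots> = (\<Oplus>c'\<in>I4. \<Oplus>j\<in>I4. (Q j c * P c' j) \<odot> M c')"
      using M by (intro finsum_swap) auto
    also have "\<dots> = (\<Oplus>c'\<in>I4. (if c = c' then 1 else 0) \<odot> M c')"
      using M inv[OF c] by (intro finsum_cong' refl) (auto simp: finsum_smult_left)
    also have "\<dots> = M c"
      using M c by (subst finsum_delta[of I4 _ c]) auto
    finally have "M c = (\<Oplus>j\<in>I4. Q j c \<odot> (\<Oplus>c'\<in>I4. P c' j \<odot> M c'))"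
      by simp
    also have "\<dots> = (\<Oplus>j\<in>I4. (Q j c * (if i = j then 1 else 0)) \<odot> \<one>)"
      using * by (intro finsum_cong' refl) auto
    also have "\<dots> = Q i c \<odot> \<one>"
      using i by (subst finsum_delta[of I4 _ i]) auto
    finally show "M c = Q i c \<odot> \<one>" .
  qed
qed

text \<open>
  The two sides differ by the position of \<open>C\<inverse>\<close>, and by the names of the summation indices in \<open>R T\<^sub>1 T\<^sub>2 = T\<^sub>2 T\<^sub>1
  R\<close>.
\<close>

lemma solves_sp_iff:
  assumes q: "q \<noteq> 0"
  shows "solves A sp_gens (sp_rels q) (\<lambda>(i, j). T i j) \<longleftrightarrow> sp_point A q T"
proof (cases "\<forall>i\<in>I4. \<forall>j\<in>I4. T i j \<in> carrier A")
  case True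
  let ?\<phi> = "\<lambda>(i, j). T i j"
  have \<phi>: "?\<phi> \<in> sp_gens \<rightarrow> carrier A"
    using True by (auto simp: sp_gens_def)
  have T: "T i j \<in> carrier A" if "i \<in> I4" "j \<in> I4" for i j
    using True that by blast
  let ?e = "lin_ext A (word_val A ?\<phi>)"
  let ?RT = "\<lambda>i k j l. \<Sum>a\<in>I4. \<Sum>b\<in>I4. monom [(a, j), (b, l)] (sp_R q i k a b)"
  let ?TR = "\<lambda>i k j l. \<Sum>a\<in>I4. \<Sum>b\<in>I4. monom [(k, b), (i, a)] (sp_R q a b j l)"
  let ?TCT = "\<lambda>i j. \<Sum>a\<in>I4. \<Sum>b\<in>I4. \<Sum>c\<in>I4. monom [(i, a), (c, b)] (sp_C q a b * sp_C_inv q c j)"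
  let ?CTT = "\<lambda>i j. \<Sum>a\<in>I4. \<Sum>b\<in>I4. \<Sum>c\<in>I4. monom [(b, a), (c, j)] (sp_C q i a * sp_C_inv q b c)"
  let ?unit = "\<lambda>i j :: nat. monom ([] :: (nat \<times> nat) list) (if i = j then 1 else 0 :: complex)"
  let ?rt = "\<lambda>i k j l. dsum A (\<lambda>a b. sp_R q i k a b \<odot> (T a j \<otimes> T b l))"
  let ?tr = "\<lambda>i k j l. dsum A (\<lambda>a b. sp_R q b a j l \<odot> (T k a \<otimes> T i b))"
  note maps = word_val_maps[OF \<phi>]
  have gens: "(i, j) \<in> sp_gens \<longleftrightarrow> i \<in> I4 \<and> j \<in> I4" for i j
    by (auto simp: sp_gens_def)
  have pair: "word_val A ?\<phi> [(i, j), (k, l)] = T i j \<otimes> T k l" if "i \<in> I4" "j \<in> I4" "k \<in> I4" "l \<in> I4" for i j k l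
    using word_val_pair[OF \<phi>, of "(i, j)" "(k, l)"] that by (simp add: gens)
  have words: "[(i, j), (k, l)] \<in> lists sp_gens" if "i \<in> I4" "j \<in> I4" "k \<in> I4" "l \<in> I4" for i j k l
    using that by (simp add: gens del: atLeastAtMost_iff)
  have keys: "supp (monom w (c :: complex)) \<subseteq> lists sp_gens" if "w \<in> lists sp_gens" for w c
    using that by simp
  have unit: "?e (monom [] c) = c \<odot> \<one>" for c
    using lin_ext_single[OF maps, of "[]" c] word_val_Nil[OF \<phi>] by simp
  have RTT: "?e (?RT i k j l - ?TR i k j l) = \<zero> \<longleftrightarrow> ?rt i k j l = ?tr i k j l"
    if ix: "i \<in> I4" "k \<in> I4" "j \<in> I4" "l \<in> I4" for i k j l
  proof -
    have *: "?e (?RT i k j l) = ?rt i k j l"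
    proof -
      have "?e (?RT i k j l) =
        dsum A (\<lambda>a b. sp_R q i k a b \<odot> word_val A ?\<phi> [(a, j), (b, l)])"
        by (rule lin_ext_double_sum[OF maps]) (intro words ix; assumption)
      also have "\<dots> = ?rt i k j l"
        using ix T by (intro dsum_cong) (simp_all add: pair)
      finally show ?thesis .
    qed
    have **: "?e (?TR i k j l) = ?tr i k j l"
    proof -
      have "?e (?TR i k j l) =
        dsum A (\<lambda>a b. sp_R q a b j l \<odot> word_val A ?\<phi> [(k, b), (i, a)])"
        by (rule lin_ext_double_sum[OF maps]) (intro words ix; assumption)
      also have "\<dots> = dsum A (\<lambda>a b. sp_R q a b j l \<odot> (T k b \<otimes> T i a))"
        using ix T by (intro dsum_cong) (simp_all add: pair)
      also have "\<dots> = ?tr i k j l"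
        using ix T by (intro dsum_flip) simp
      finally show ?thesis .
    qed
    have "?e (?RT i k j l - ?TR i k j l) = ?rt i k j l \<ominus> ?tr i k j l"
      unfolding *[symmetric] **[symmetric]
      by (rule lin_ext_diff[OF maps]) (intro keys_sum_subset keys words ix; assumption)+
    moreover have "?rt i k j l \<in> carrier A" "?tr i k j l \<in> carrier A"
      using ix T by (auto intro!: dsum_closed)
    ultimately show ?thesis
      by (simp only: diff_eq_zero_iff)
  qed
  have C1: "(\<forall>j\<in>I4. ?e (?TCT i j - ?unit i j) = \<zero>) \<longleftrightarrow>
    (\<forall>j\<in>I4. dsum A (\<lambda>a b. sp_C q a b \<odot> (T i a \<otimes> T j b)) = sp_C q i j \<odot> \<one>)" if i: "i \<in> I4" for i
  proof -
    let ?M = "\<lambda>c. dsum A (\<lambda>a b. sp_C q a b \<odot> (T i a \<otimes> T c b))"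
    have M: "?M c \<in> carrier A" if "c \<in> I4" for c
      using i T that by (auto intro!: dsum_closed)
    have sum: "(\<Oplus>c\<in>I4. k c \<odot> ?M c) \<in> carrier A" "k' \<odot> \<one> \<in> carrier A" for k k'
      using M by (auto intro!: finsum_closed)
    have eq: "?e (?TCT i j - ?unit i j) =
      (\<Oplus>c\<in>I4. sp_C_inv q c j \<odot> ?M c) \<ominus> (if i = j then 1 else 0) \<odot> \<one>" if j: "j \<in> I4" for j
    proof -
      have "?e (?TCT i j - ?unit i j) = ?e (?TCT i j) \<ominus> ?e (?unit i j)"
        by (rule lin_ext_diff[OF maps])
          (intro keys_sum_subset keys words lists.Nil i; assumption)+
      moreover have "?e (?TCT i j) =
        (\<Oplus>a\<in>I4. dsum A (\<lambda>b c. (sp_C q a b * sp_C_inv q c j) \<odot> word_val A ?\<phi> [(i, a), (c, b)]))"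
        by (rule lin_ext_triple_sum[OF maps]) (intro words i; assumption)
      moreover have "\<dots> = (\<Oplus>a\<in>I4. \<Oplus>c\<in>I4. \<Oplus>b\<in>I4. sp_C_inv q c j \<odot> (sp_C q a b \<odot> (T i a \<otimes> T c b)))"
      proof (intro finsum_cong' refl)
        fix a assume a: "a \<in> I4"
        have "dsum A (\<lambda>b c. (sp_C q a b * sp_C_inv q c j) \<odot> word_val A ?\<phi> [(i, a), (c, b)]) =
          dsum A (\<lambda>b c. sp_C_inv q c j \<odot> (sp_C q a b \<odot> (T i a \<otimes> T c b)))"
          using i a T by (intro dsum_cong) (simp_all add: pair mult.commute)
        also have "\<dots> = dsum A (\<lambda>c b. sp_C_inv q c j \<odot> (sp_C q a b \<odot> (T i a \<otimes> T c b)))"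
          using i a T by (intro dsum_flip) simp
        finally show "dsum A (\<lambda>b c. (sp_C q a b * sp_C_inv q c j) \<odot> word_val A ?\<phi> [(i, a), (c, b)]) =
          (\<Oplus>c\<in>I4. \<Oplus>b\<in>I4. sp_C_inv q c j \<odot> (sp_C q a b \<odot> (T i a \<otimes> T c b)))"
          by (simp add: dsum_def)
      qed (use i T in \<open>auto intro!: finsum_closed\<close>)
      moreover have "\<dots> = (\<Oplus>c\<in>I4. dsum A (\<lambda>a b. sp_C_inv q c j \<odot> (sp_C q a b \<odot> (T i a \<otimes> T c b))))"
        unfolding dsum_def using i T by (intro finsum_swap) (auto intro!: finsum_closed)
      moreover have "\<dots> = (\<Oplus>c\<in>I4. sp_C_inv q c j \<odot> ?M c)"
        using i T by (intro finsum_cong' refl dsum_smult[symmetric]) (auto intro!: dsum_closed)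
      ultimately show ?thesis
        by (simp only: unit)
    qed
    have "(\<forall>j\<in>I4. ?e (?TCT i j - ?unit i j) = \<zero>) \<longleftrightarrow>
      (\<forall>j\<in>I4. (\<Oplus>c\<in>I4. sp_C_inv q c j \<odot> ?M c) = (if i = j then 1 else 0) \<odot> \<one>)"
      by (intro ball_cong refl) (simp only: eq diff_eq_zero_iff[OF sum])
    also have "\<dots> \<longleftrightarrow> (\<forall>c\<in>I4. ?M c = sp_C q i c \<odot> \<one>)"
    proof (intro matrix_cancel M i)
      fix c c' assume c: "c \<in> I4" "c' \<in> I4"
      show "(\<Sum>j\<in>I4. sp_C q j c * sp_C_inv q c' j) = (if c = c' then 1 else 0)"
        using sp_C_inverse(2)[OF q c(2,1)] by (simp only: mult.commute[of "sp_C q _ _"] eq_commute[of c])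
      show "(\<Sum>j\<in>I4. sp_C_inv q j c * sp_C q c' j) = (if c = c' then 1 else 0)"
        using sp_C_inverse(1)[OF q c(2,1)] by (simp only: mult.commute[of "sp_C_inv q _ _"] eq_commute[of c])
    qed
    finally show ?thesis .
  qed
  have C2: "(\<forall>i\<in>I4. ?e (?CTT i j - ?unit i j) = \<zero>) \<longleftrightarrow>
    (\<forall>i\<in>I4. dsum A (\<lambda>a b. sp_C q a b \<odot> (T a i \<otimes> T b j)) = sp_C q i j \<odot> \<one>)" if j: "j \<in> I4" for j
  proof -
    let ?M = "\<lambda>a. dsum A (\<lambda>b c. sp_C q b c \<odot> (T b a \<otimes> T c j))"
    have M: "?M c \<in> carrier A" if "c \<in> I4" for c
      using j T that by (auto intro!: dsum_closed)
    have sum: "(\<Oplus>c\<in>I4. k c \<odot> ?M c) \<in> carrier A" "k' \<odot> \<one> \<in> carrier A" for k k'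
      using M by (auto intro!: finsum_closed)
    have eq: "?e (?CTT i j - ?unit i j) =
      (\<Oplus>a\<in>I4. (- sp_C q i a) \<odot> ?M a) \<ominus> (if j = i then 1 else 0) \<odot> \<one>" if i: "i \<in> I4" for i
    proof -
      have "?e (?CTT i j - ?unit i j) = ?e (?CTT i j) \<ominus> ?e (?unit i j)"
        by (rule lin_ext_diff[OF maps])
          (intro keys_sum_subset keys words lists.Nil j; assumption)+
      moreover have "?e (?CTT i j) =
        (\<Oplus>a\<in>I4. dsum A (\<lambda>b c. (sp_C q i a * sp_C_inv q b c) \<odot> word_val A ?\<phi> [(b, a), (c, j)]))"
        by (rule lin_ext_triple_sum[OF maps]) (intro words j; assumption)
      moreover have "\<dots> = (\<Oplus>a\<in>I4. (- sp_C q i a) \<odot> ?M a)"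
      proof (intro finsum_cong' refl)
        fix a assume a: "a \<in> I4"
        have "dsum A (\<lambda>b c. (sp_C q i a * sp_C_inv q b c) \<odot> word_val A ?\<phi> [(b, a), (c, j)]) =
          dsum A (\<lambda>b c. (- sp_C q i a) \<odot> (sp_C q b c \<odot> (T b a \<otimes> T c j)))"
          using j a T by (intro dsum_cong) (simp_all add: pair sp_C_inv_def)
        also have "\<dots> = (- sp_C q i a) \<odot> ?M a"
          using j a T by (intro dsum_smult[symmetric]) simp
        finally show "dsum A (\<lambda>b c. (sp_C q i a * sp_C_inv q b c) \<odot> word_val A ?\<phi> [(b, a), (c, j)]) =
          (- sp_C q i a) \<odot> ?M a" .
      qed (use j T in \<open>auto intro!: dsum_closed\<close>)
      moreover have "(if i = j then 1 else 0 :: complex) = (if j = i then 1 else 0)"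
        by simp
      ultimately show ?thesis
        by (simp only: unit)
    qed
    have "(\<forall>i\<in>I4. ?e (?CTT i j - ?unit i j) = \<zero>) \<longleftrightarrow>
      (\<forall>i\<in>I4. (\<Oplus>a\<in>I4. (- sp_C q i a) \<odot> ?M a) = (if j = i then 1 else 0) \<odot> \<one>)"
      by (intro ball_cong refl) (simp only: eq diff_eq_zero_iff[OF sum])
    also have "\<dots> \<longleftrightarrow> (\<forall>a\<in>I4. ?M a = sp_C q a j \<odot> \<one>)"
    proof (intro matrix_cancel[where Q = "\<lambda>j a. sp_C q a j"] M j)
      fix c c' assume c: "c \<in> I4" "c' \<in> I4"
      show "(\<Sum>j\<in>I4. sp_C q c j * (- sp_C q j c')) = (if c = c' then 1 else 0)"
        using sp_C_inverse(1)[OF q c] by (simp only: sp_C_inv_def)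
      show "(\<Sum>j\<in>I4. (- sp_C q c j) * sp_C q j c') = (if c = c' then 1 else 0)"
        using sp_C_inverse(2)[OF q c] by (simp only: sp_C_inv_def)
    qed
    finally show ?thesis .
  qed
  have "solves A sp_gens (sp_rels q) ?\<phi> \<longleftrightarrow>
    (\<forall>i\<in>I4. \<forall>k\<in>I4. \<forall>j\<in>I4. \<forall>l\<in>I4. ?e (?RT i k j l - ?TR i k j l) = \<zero>) \<and>
    (\<forall>i\<in>I4. \<forall>j\<in>I4. ?e (?TCT i j - ?unit i j) = \<zero>) \<and>
    (\<forall>j\<in>I4. \<forall>i\<in>I4. ?e (?CTT i j - ?unit i j) = \<zero>)"
    unfolding solves_def sp_rels_def using \<phi> by blast
  also have "\<dots> \<longleftrightarrow> sp_point A q T"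
    unfolding sp_point_def using True RTT C1 C2 by (auto simp del: atLeastAtMost_iff)
  finally show ?thesis .
next
  case False
  have "(\<lambda>(i, j). T i j) \<in> sp_gens \<rightarrow> carrier A \<longleftrightarrow> (\<forall>i\<in>I4. \<forall>j\<in>I4. T i j \<in> carrier A)"
    by (auto simp: sp_gens_def Pi_def simp del: atLeastAtMost_iff)
  with False show ?thesis
    unfolding solves_def sp_point_def by blast
qed

end


context two_calgs
begin

context
  fixes q T w \<tau>
  assumes T: "sp_point A q T" and w: "sp_point B q w"
  defines "\<tau> \<equiv> \<lambda>i j. \<Oplus>\<^bsub>AT\<^esub>k\<in>I4. tens A B (T k j) (w i k)"
begin

private lemma entries: "i \<in> I4 \<Longrightarrow> j \<in> I4 \<Longrightarrow> T i j \<in> carrier A" "i \<in> I4 \<Longrightarrow> j \<in> I4 \<Longrightarrow> w i j \<in> carrier B"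
  using T w unfolding sp_point_def by blast+

private lemma entry_closed: "i \<in> I4 \<Longrightarrow> j \<in> I4 \<Longrightarrow> \<tau> i j \<in> carrier AT"
  unfolding \<tau>_def by (intro T.finsum_closed) (auto simp del: atLeastAtMost_iff intro!: tens_closed entries)

private lemma entry_mult:
  assumes "i \<in> I4" "j \<in> I4" "k \<in> I4" "l \<in> I4"
  shows "\<tau> i j \<otimes>\<^bsub>AT\<^esub> \<tau> k l = dsum AT (\<lambda>c d. tens A B (T c j \<otimes>\<^bsub>A\<^esub> T d l) (w i c \<otimes>\<^bsub>B\<^esub> w k d))"
proof -
  have "\<tau> i j \<otimes>\<^bsub>AT\<^esub> \<tau> k l =
    dsum AT (\<lambda>c d. tens A B (T c j) (w i c) \<otimes>\<^bsub>AT\<^esub> tens A B (T d l) (w k d))"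
    unfolding \<tau>_def by (intro T.dsum_mult tens_closed entries assms)
  also have "\<dots> = dsum AT (\<lambda>c d. tens A B (T c j \<otimes>\<^bsub>A\<^esub> T d l) (w i c \<otimes>\<^bsub>B\<^esub> w k d))"
    by (intro T.dsum_cong tens_mult tens_closed entries assms A.m_closed B.m_closed)
  finally show ?thesis .
qed

private lemma entry_mult_dsum:
  assumes "i \<in> I4" "j \<in> I4" "k \<in> I4" "l \<in> I4"
  shows "r \<odot>\<^bsub>AT\<^esub> (\<tau> i j \<otimes>\<^bsub>AT\<^esub> \<tau> k l) =
    dsum AT (\<lambda>c d. r \<odot>\<^bsub>AT\<^esub> tens A B (T c j \<otimes>\<^bsub>A\<^esub> T d l) (w i c \<otimes>\<^bsub>B\<^esub> w k d))"
  unfolding entry_mult[OF assms]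
  by (intro T.dsum_smult tens_closed entries assms A.m_closed B.m_closed)

private lemma tens_dsum_right:
  assumes "x \<in> carrier A" "\<And>a b. a \<in> I4 \<Longrightarrow> b \<in> I4 \<Longrightarrow> f a b \<in> carrier B"
  shows "tens A B x (dsum B (\<lambda>a b. r a b \<odot>\<^bsub>B\<^esub> f a b)) =
    dsum AT (\<lambda>a b. r a b \<odot>\<^bsub>AT\<^esub> tens A B x (f a b))"
proof -
  have "tens A B x (dsum B (\<lambda>a b. r a b \<odot>\<^bsub>B\<^esub> f a b)) = dsum AT (\<lambda>a b. tens A B x (r a b \<odot>\<^bsub>B\<^esub> f a b))"
    using assms by (intro lin_dsum[OF B.calg_axioms T.calg_axioms tens_lin_right]) auto
  also have "\<dots> = dsum AT (\<lambda>a b. r a b \<odot>\<^bsub>AT\<^esub> tens A B x (f a b))"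
    using assms by (intro T.dsum_cong lin_smult[OF tens_lin_right]) auto
  finally show ?thesis .
qed

private lemma tens_dsum_left:
  assumes "\<And>a b. a \<in> I4 \<Longrightarrow> b \<in> I4 \<Longrightarrow> f a b \<in> carrier A" "y \<in> carrier B"
  shows "tens A B (dsum A (\<lambda>a b. r a b \<odot>\<^bsub>A\<^esub> f a b)) y =
    dsum AT (\<lambda>a b. r a b \<odot>\<^bsub>AT\<^esub> tens A B (f a b) y)"
proof -
  have "tens A B (dsum A (\<lambda>a b. r a b \<odot>\<^bsub>A\<^esub> f a b)) y = dsum AT (\<lambda>a b. tens A B (r a b \<odot>\<^bsub>A\<^esub> f a b) y)"
    using assms by (intro lin_dsum[OF A.calg_axioms T.calg_axioms tens_lin_left]) auto
  also have "\<dots> = dsum AT (\<lambda>a b. r a b \<odot>\<^bsub>AT\<^esub> tens A B (f a b) y)"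
    using assms by (intro T.dsum_cong lin_smult[OF tens_lin_left]) auto
  finally show ?thesis .
qed

text \<open>
  In an expression that is quadratic in the product matrix \<open>\<tau> = w T\<close> and summed over row indices, the sum
  moves to \<open>w\<close>; summed over column indices it moves to \<open>T\<close> (\<open>contract_columns\<close>).
\<close>

private lemma contract_rows:
  assumes "j \<in> I4" "l \<in> I4"
  shows "dsum AT (\<lambda>a b. r a b \<odot>\<^bsub>AT\<^esub> (\<tau> a j \<otimes>\<^bsub>AT\<^esub> \<tau> b l)) =
    dsum AT (\<lambda>c d. tens A B (T c j \<otimes>\<^bsub>A\<^esub> T d l) (dsum B (\<lambda>a b. r a b \<odot>\<^bsub>B\<^esub> (w a c \<otimes>\<^bsub>B\<^esub> w b d))))"
proof -
  let ?f = "\<lambda>a b c d. r a b \<odot>\<^bsub>AT\<^esub> tens A B (T c j \<otimes>\<^bsub>A\<^esub> T d l) (w a c \<otimes>\<^bsub>B\<^esub> w b d)"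
  note closed = tens_closed entries assms A.m_closed B.m_closed T.smult_closed
  have "dsum AT (\<lambda>a b. r a b \<odot>\<^bsub>AT\<^esub> (\<tau> a j \<otimes>\<^bsub>AT\<^esub> \<tau> b l)) =
    dsum AT (\<lambda>a b. dsum AT (\<lambda>c d. ?f a b c d))"
    by (intro T.dsum_cong entry_mult_dsum T.dsum_closed closed)
  also have "\<dots> = dsum AT (\<lambda>c d. dsum AT (\<lambda>a b. ?f a b c d))"
    by (intro T.dsum_swap closed)
  also have "\<dots> = dsum AT (\<lambda>c d. tens A B (T c j \<otimes>\<^bsub>A\<^esub> T d l) (dsum B (\<lambda>a b. r a b \<odot>\<^bsub>B\<^esub> (w a c \<otimes>\<^bsub>B\<^esub> w b d))))"
    by (intro T.dsum_cong tens_dsum_right[symmetric] B.dsum_closed B.smult_closed closed)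
  finally show ?thesis .
qed

private lemma contract_columns:
  assumes "i \<in> I4" "k \<in> I4"
  shows "dsum AT (\<lambda>a b. r a b \<odot>\<^bsub>AT\<^esub> (\<tau> i a \<otimes>\<^bsub>AT\<^esub> \<tau> k b)) =
    dsum AT (\<lambda>c d. tens A B (dsum A (\<lambda>a b. r a b \<odot>\<^bsub>A\<^esub> (T c a \<otimes>\<^bsub>A\<^esub> T d b))) (w i c \<otimes>\<^bsub>B\<^esub> w k d))"
proof -
  let ?f = "\<lambda>a b c d. r a b \<odot>\<^bsub>AT\<^esub> tens A B (T c a \<otimes>\<^bsub>A\<^esub> T d b) (w i c \<otimes>\<^bsub>B\<^esub> w k d)"
  note closed = tens_closed entries assms A.m_closed B.m_closed T.smult_closed
  have "dsum AT (\<lambda>a b. r a b \<odot>\<^bsub>AT\<^esub> (\<tau> i a \<otimes>\<^bsub>AT\<^esub> \<tau> k b)) =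
    dsum AT (\<lambda>a b. dsum AT (\<lambda>c d. ?f a b c d))"
    by (intro T.dsum_cong entry_mult_dsum T.dsum_closed closed)
  also have "\<dots> = dsum AT (\<lambda>c d. dsum AT (\<lambda>a b. ?f a b c d))"
    by (intro T.dsum_swap closed)
  also have "\<dots> = dsum AT (\<lambda>c d. tens A B (dsum A (\<lambda>a b. r a b \<odot>\<^bsub>A\<^esub> (T c a \<otimes>\<^bsub>A\<^esub> T d b))) (w i c \<otimes>\<^bsub>B\<^esub> w k d))"
    by (intro T.dsum_cong tens_dsum_left[symmetric] A.dsum_closed A.smult_closed closed)
  finally show ?thesis .
qed

text \<open>
  The product of two quantum symplectic matrices with commuting entries is one. Formally, \<open>R \<tau>\<^sub>1 \<tau>\<^sub>2 = R w\<^sub>1 w\<^sub>2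
  T\<^sub>1 T\<^sub>2 = w\<^sub>2 w\<^sub>1 R T\<^sub>1 T\<^sub>2 = w\<^sub>2 w\<^sub>1 T\<^sub>2 T\<^sub>1 R = \<tau>\<^sub>2 \<tau>\<^sub>1 R\<close>, and \<open>\<tau> C \<tau>\<^sup>t = w (T C T\<^sup>t) w\<^sup>t = C\<close>, similarly for \<open>\<tau>\<^sup>t C \<tau>\<close>.
\<close>

lemma sp_point_tensor: "sp_point AT q \<tau>"
proof -
  let ?T = "AT"
  note closed = tens_closed entries A.m_closed B.m_closed T.smult_closed A.smult_closed B.smult_closed
    A.dsum_closed B.dsum_closed T.dsum_closed A.one_closed B.one_closed
  have T_RTT: "dsum A (\<lambda>a b. sp_R q i k a b \<odot>\<^bsub>A\<^esub> (T a j \<otimes>\<^bsub>A\<^esub> T b l)) =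
      dsum A (\<lambda>a b. sp_R q b a j l \<odot>\<^bsub>A\<^esub> (T k a \<otimes>\<^bsub>A\<^esub> T i b))"
    and w_RTT: "dsum B (\<lambda>a b. sp_R q i k a b \<odot>\<^bsub>B\<^esub> (w a j \<otimes>\<^bsub>B\<^esub> w b l)) =
      dsum B (\<lambda>a b. sp_R q b a j l \<odot>\<^bsub>B\<^esub> (w k a \<otimes>\<^bsub>B\<^esub> w i b))"
    if "i \<in> I4" "k \<in> I4" "j \<in> I4" "l \<in> I4" for i k j l
    using T w that unfolding sp_point_def by blast+
  have T_C: "dsum A (\<lambda>a b. sp_C q a b \<odot>\<^bsub>A\<^esub> (T i a \<otimes>\<^bsub>A\<^esub> T j b)) = sp_C q i j \<odot>\<^bsub>A\<^esub> \<one>\<^bsub>A\<^esub>"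
    "dsum A (\<lambda>a b. sp_C q a b \<odot>\<^bsub>A\<^esub> (T a i \<otimes>\<^bsub>A\<^esub> T b j)) = sp_C q i j \<odot>\<^bsub>A\<^esub> \<one>\<^bsub>A\<^esub>"
    and w_C: "dsum B (\<lambda>a b. sp_C q a b \<odot>\<^bsub>B\<^esub> (w i a \<otimes>\<^bsub>B\<^esub> w j b)) = sp_C q i j \<odot>\<^bsub>B\<^esub> \<one>\<^bsub>B\<^esub>"
    "dsum B (\<lambda>a b. sp_C q a b \<odot>\<^bsub>B\<^esub> (w a i \<otimes>\<^bsub>B\<^esub> w b j)) = sp_C q i j \<odot>\<^bsub>B\<^esub> \<one>\<^bsub>B\<^esub>"
    if "i \<in> I4" "j \<in> I4" for i j
    using T w that unfolding sp_point_def by blast+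
  have one: "tens A B (c \<odot>\<^bsub>A\<^esub> \<one>\<^bsub>A\<^esub>) y = tens A B \<one>\<^bsub>A\<^esub> (c \<odot>\<^bsub>B\<^esub> y)" if "y \<in> carrier B" for c y
    using lin_smult[OF tens_lin_left[OF that] A.one_closed] lin_smult[OF tens_lin_right[OF A.one_closed] that] by simp
  have one': "tens A B x (c \<odot>\<^bsub>B\<^esub> \<one>\<^bsub>B\<^esub>) = tens A B (c \<odot>\<^bsub>A\<^esub> x) \<one>\<^bsub>B\<^esub>" if "x \<in> carrier A" for c x
    using lin_smult[OF tens_lin_left[OF B.one_closed] that] lin_smult[OF tens_lin_right[OF that] B.one_closed] by simp
  have one'': "tens A B (c \<odot>\<^bsub>A\<^esub> \<one>\<^bsub>A\<^esub>) \<one>\<^bsub>B\<^esub> = c \<odot>\<^bsub>?T\<^esub> \<one>\<^bsub>?T\<^esub>" for c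
    using lin_smult[OF tens_lin_left[OF B.one_closed] A.one_closed] by (simp add: tens_one)
  show ?thesis
    unfolding sp_point_def
  proof (intro conjI ballI)
    fix i j assume "i \<in> I4" "j \<in> I4"
    then show "\<tau> i j \<in> carrier ?T"
      by (rule entry_closed)
  next
    fix i k j l assume ix: "i \<in> I4" "k \<in> I4" "j \<in> I4" "l \<in> I4"
    let ?t = "\<lambda>a b c d. sp_R q b a c d \<odot>\<^bsub>?T\<^esub> tens A B (T c j \<otimes>\<^bsub>A\<^esub> T d l) (w k a \<otimes>\<^bsub>B\<^esub> w i b)"
    have "dsum ?T (\<lambda>a b. sp_R q i k a b \<odot>\<^bsub>?T\<^esub> (\<tau> a j \<otimes>\<^bsub>?T\<^esub> \<tau> b l)) =
      dsum ?T (\<lambda>c d. tens A B (T c j \<otimes>\<^bsub>A\<^esub> T d l) (dsum B (\<lambda>a b. sp_R q i k a b \<odot>\<^bsub>B\<^esub> (w a c \<otimes>\<^bsub>B\<^esub> w b d))))"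
      by (rule contract_rows[OF ix(3,4)])
    also have "\<dots> = dsum ?T (\<lambda>c d. tens A B (T c j \<otimes>\<^bsub>A\<^esub> T d l) (dsum B (\<lambda>a b. sp_R q b a c d \<odot>\<^bsub>B\<^esub> (w k a \<otimes>\<^bsub>B\<^esub> w i b))))"
      by (intro T.dsum_cong arg_cong[of _ _ "tens A B _"] w_RTT closed ix)
    also have "\<dots> = dsum ?T (\<lambda>c d. dsum ?T (\<lambda>a b. ?t a b c d))"
      by (intro T.dsum_cong tens_dsum_right closed ix)
    finally have left: "dsum ?T (\<lambda>a b. sp_R q i k a b \<odot>\<^bsub>?T\<^esub> (\<tau> a j \<otimes>\<^bsub>?T\<^esub> \<tau> b l)) =
      dsum ?T (\<lambda>c d. dsum ?T (\<lambda>a b. ?t a b c d))" .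
    have "dsum ?T (\<lambda>a b. sp_R q b a j l \<odot>\<^bsub>?T\<^esub> (\<tau> k a \<otimes>\<^bsub>?T\<^esub> \<tau> i b)) =
      dsum ?T (\<lambda>a b. tens A B (dsum A (\<lambda>c d. sp_R q d c j l \<odot>\<^bsub>A\<^esub> (T a c \<otimes>\<^bsub>A\<^esub> T b d))) (w k a \<otimes>\<^bsub>B\<^esub> w i b))"
      by (rule contract_columns[OF ix(2,1)])
    also have "\<dots> = dsum ?T (\<lambda>a b. tens A B (dsum A (\<lambda>c d. sp_R q b a c d \<odot>\<^bsub>A\<^esub> (T c j \<otimes>\<^bsub>A\<^esub> T d l))) (w k a \<otimes>\<^bsub>B\<^esub> w i b))"
      by (intro T.dsum_cong arg_cong[of _ _ "\<lambda>x. tens A B x _"] T_RTT[symmetric] closed ix)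
    also have "\<dots> = dsum ?T (\<lambda>a b. dsum ?T (\<lambda>c d. ?t a b c d))"
      by (intro T.dsum_cong tens_dsum_left closed ix)
    also have "\<dots> = dsum ?T (\<lambda>c d. dsum ?T (\<lambda>a b. ?t a b c d))"
      by (intro T.dsum_swap closed ix)
    finally show "dsum ?T (\<lambda>a b. sp_R q i k a b \<odot>\<^bsub>?T\<^esub> (\<tau> a j \<otimes>\<^bsub>?T\<^esub> \<tau> b l)) =
      dsum ?T (\<lambda>a b. sp_R q b a j l \<odot>\<^bsub>?T\<^esub> (\<tau> k a \<otimes>\<^bsub>?T\<^esub> \<tau> i b))"
      using left by simp
  next
    fix i j assume ix: "i \<in> I4" "j \<in> I4"
    have "dsum ?T (\<lambda>a b. sp_C q a b \<odot>\<^bsub>?T\<^esub> (\<tau> i a \<otimes>\<^bsub>?T\<^esub> \<tau> j b)) =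
      dsum ?T (\<lambda>c d. tens A B (dsum A (\<lambda>a b. sp_C q a b \<odot>\<^bsub>A\<^esub> (T c a \<otimes>\<^bsub>A\<^esub> T d b))) (w i c \<otimes>\<^bsub>B\<^esub> w j d))"
      by (rule contract_columns[OF ix])
    also have "\<dots> = dsum ?T (\<lambda>c d. tens A B (sp_C q c d \<odot>\<^bsub>A\<^esub> \<one>\<^bsub>A\<^esub>) (w i c \<otimes>\<^bsub>B\<^esub> w j d))"
      by (intro T.dsum_cong arg_cong[of _ _ "\<lambda>x. tens A B x _"] T_C(1) closed ix)
    also have "\<dots> = dsum ?T (\<lambda>c d. tens A B \<one>\<^bsub>A\<^esub> (sp_C q c d \<odot>\<^bsub>B\<^esub> (w i c \<otimes>\<^bsub>B\<^esub> w j d)))"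
      by (intro T.dsum_cong one closed ix)
    also have "\<dots> = tens A B \<one>\<^bsub>A\<^esub> (dsum B (\<lambda>c d. sp_C q c d \<odot>\<^bsub>B\<^esub> (w i c \<otimes>\<^bsub>B\<^esub> w j d)))"
      by (intro lin_dsum[OF B.calg_axioms T.calg_axioms tens_lin_right, symmetric] closed ix)
    also have "\<dots> = sp_C q i j \<odot>\<^bsub>?T\<^esub> \<one>\<^bsub>?T\<^esub>"
      by (simp only: w_C(1)[OF ix] one[symmetric] one'' B.one_closed)
    finally show "dsum ?T (\<lambda>a b. sp_C q a b \<odot>\<^bsub>?T\<^esub> (\<tau> i a \<otimes>\<^bsub>?T\<^esub> \<tau> j b)) = sp_C q i j \<odot>\<^bsub>?T\<^esub> \<one>\<^bsub>?T\<^esub>" .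
    have "dsum ?T (\<lambda>a b. sp_C q a b \<odot>\<^bsub>?T\<^esub> (\<tau> a i \<otimes>\<^bsub>?T\<^esub> \<tau> b j)) =
      dsum ?T (\<lambda>c d. tens A B (T c i \<otimes>\<^bsub>A\<^esub> T d j) (dsum B (\<lambda>a b. sp_C q a b \<odot>\<^bsub>B\<^esub> (w a c \<otimes>\<^bsub>B\<^esub> w b d))))"
      by (rule contract_rows[OF ix])
    also have "\<dots> = dsum ?T (\<lambda>c d. tens A B (T c i \<otimes>\<^bsub>A\<^esub> T d j) (sp_C q c d \<odot>\<^bsub>B\<^esub> \<one>\<^bsub>B\<^esub>))"
      by (intro T.dsum_cong arg_cong[of _ _ "tens A B _"] w_C(2) closed ix)
    also have "\<dots> = dsum ?T (\<lambda>c d. tens A B (sp_C q c d \<odot>\<^bsub>A\<^esub> (T c i \<otimes>\<^bsub>A\<^esub> T d j)) \<one>\<^bsub>B\<^esub>)"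
      by (intro T.dsum_cong one' closed ix)
    also have "\<dots> = tens A B (dsum A (\<lambda>c d. sp_C q c d \<odot>\<^bsub>A\<^esub> (T c i \<otimes>\<^bsub>A\<^esub> T d j))) \<one>\<^bsub>B\<^esub>"
      by (intro lin_dsum[OF A.calg_axioms T.calg_axioms tens_lin_left, symmetric] closed ix)
    also have "\<dots> = sp_C q i j \<odot>\<^bsub>?T\<^esub> \<one>\<^bsub>?T\<^esub>"
      by (simp only: T_C(2)[OF ix] one'')
    finally show "dsum ?T (\<lambda>a b. sp_C q a b \<odot>\<^bsub>?T\<^esub> (\<tau> a i \<otimes>\<^bsub>?T\<^esub> \<tau> b j)) = sp_C q i j \<odot>\<^bsub>?T\<^esub> \<one>\<^bsub>?T\<^esub>" .
  qed
qed

end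

end

definition levi :: "(complex, 'a) module \<Rightarrow> complex \<Rightarrow> (su_gen \<Rightarrow> 'a) \<Rightarrow> nat \<Rightarrow> nat \<Rightarrow> 'a" where
  "levi A q G i k = levi_coef q i k \<odot>\<^bsub>A\<^esub> G (levi_gen i k)"

lemma (in calg) levi_point:
  assumes q: "q \<noteq> 0" and G: "su_point A (complex_of_real q) G"
  shows "sp_point A q (levi A (complex_of_real q) G)"
proof -
  let ?q = "complex_of_real q" and ?w = "levi A (complex_of_real q) G"
  have [simp]: "G g \<in> carrier A" for g
    using G by (auto simp: su_point_def)
  then have G_closed: "G \<in> UNIV \<rightarrow> carrier A"
    by auto
  have e: "word_val A G \<in> su_words \<rightarrow> carrier A"
    using word_val_maps[OF G_closed] by auto
  note N = su_words_finite e
  let ?lc = "lincomb A su_words (word_val A G)"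
  have [simp]: "?w i j \<in> carrier A" for i j
    by (simp add: levi_def)
  have summand: "r \<odot> (?w i j \<otimes> ?w k l) =
      ?lc (\<lambda>n. r * (levi_coef ?q i j * levi_coef ?q k l * su_nf ?q (levi_gen i j) (levi_gen k l) n))" for r i j k l
    by (simp add: levi_def smult_mult_left smult_mult_right su_point_mult[OF G] lincomb_closed[OF N] lincomb_smult[OF N] mult_ac)
  have unit: "c \<odot> \<one> = ?lc (\<lambda>n. c * kdelta [] n)" for c
    using lincomb_kdelta[OF N, of "[]"] word_val_Nil[OF G_closed]
    by (simp add: lincomb_smult[OF N, symmetric] su_words_def[THEN eqset_imp_iff])
  show ?thesis
    unfolding sp_point_def summand unit dsum_lincomb[OF N]
    by (intro conjI ballI arg_cong[of _ _ ?lc] ext levi_RTT_coefs[OF q] levi_C_coefs[OF q]) simp_all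
qed


section \<open>The coaction\<close>

lemma Sp_calg: "calg (Sp_alg q)"
  unfolding Sp_alg_def by (rule calg.quot_calg[OF free_calg sp_rels_closed])

lemma Sp_T_point:
  assumes "q \<noteq> 0"
  shows "sp_point (Sp_alg q) q (Sp_T q)"
proof -
  have "(\<lambda>s. quot_class (free_alg sp_gens) (sp_rels q) (monom [s] 1)) = (\<lambda>(i, j). Sp_T q i j)"
    by (auto simp: Sp_T_def)
  then show ?thesis
    using presented_gens_solve[OF sp_rels_closed, of q] calg.solves_sp_iff[OF Sp_calg assms, of q "Sp_T q"]
    by (simp add: Sp_alg_def)
qed

lemma Sp_T_closed: "q \<noteq> 0 \<Longrightarrow> i \<in> I4 \<Longrightarrow> j \<in> I4 \<Longrightarrow> Sp_T q i j \<in> carrier (Sp_alg q)"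
  using Sp_T_point[of q] unfolding sp_point_def by blast

lemma Sp_hom:
  assumes q: "q \<noteq> 0" and A: "calg A" and T: "sp_point A q T"
  shows "\<exists>h. h \<in> alg_hom (Sp_alg q) A \<and> (\<forall>i\<in>I4. \<forall>j\<in>I4. h (Sp_T q i j) = T i j)"
proof -
  obtain h where h: "h \<in> alg_hom (Sp_alg q) A"
    "\<forall>s\<in>sp_gens. h (quot_class (free_alg sp_gens) (sp_rels q) (monom [s] 1)) = (case s of (i, j) \<Rightarrow> T i j)"
    using calg.presented_hom[OF A sp_rels_closed iffD2[OF calg.solves_sp_iff[OF A q] T]] unfolding Sp_alg_def by blast
  have "\<forall>i\<in>I4. \<forall>j\<in>I4. h (Sp_T q i j) = T i j"
    unfolding Sp_T_def
  proof (intro ballI)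
    fix i j assume "i \<in> I4" "j \<in> I4"
    then have "(i, j) \<in> sp_gens"
      by (simp add: sp_gens_def)
    from bspec[OF h(2) this] show "h (quot_class (free_alg sp_gens) (sp_rels q) (monom [(i, j)] 1)) = T i j"
      by simp
  qed
  with h(1) show ?thesis
    by blast
qed

text \<open>
  The scalar that relates the conjugate of \<open>x\<^sub>i\<close> to the entry \<open>T\<^sub>i\<^sub>'\<^sup>1\<close>.
\<close>

definition xbar_coef :: "complex \<Rightarrow> nat \<Rightarrow> complex" where
  "xbar_coef q i = (if i = 1 then - (q ^ 4) else if i = 2 then - (q ^ 3) else if i = 3 then q else 1)"

lemma S7_xbar_T:
  assumes q: "q \<noteq> 0" and i: "i \<in> I4"
  shows "S7_xbar q i = xbar_coef (complex_of_real q) i \<odot>\<^bsub>Sp_alg q\<^esub> Sp_T q (5 - i) 1"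
proof -
  let ?q = "complex_of_real q"
  interpret F: calg "free_alg sp_gens" by (rule free_calg)
  have coef: "?q powi (2 + sp_rho i) * sp_eps (conj_idx i) = xbar_coef ?q i"
  proof -
    have "i = 1 \<or> i = 2 \<or> i = 3 \<or> i = 4"
      using i by auto
    then show ?thesis
      by (elim disjE; simp add: sp_rho_def sp_eps_def conj_idx_def xbar_coef_def del: One_nat_def)
  qed
  have "monom [(5 - i, 1)] 1 \<in> carrier (free_alg sp_gens)"
    using i by (auto simp: free_alg_carrier sp_gens_def)
  from lin_smult[OF alg_hom_lin[OF F.quot_class_alg_hom[OF sp_rels_closed]] this, of q "xbar_coef ?q i"]
  show ?thesis
    unfolding S7_xbar_eq[OF q i] coef by (simp add: Sp_T_def Sp_alg_def conj_idx_def free_alg_def)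
qed

lemma xbar_coef_nonzero: "q \<noteq> 0 \<Longrightarrow> xbar_coef q i \<noteq> 0"
  by (simp add: xbar_coef_def)

abbreviation S7_gens :: "real \<Rightarrow> ((nat \<times> nat) list \<Rightarrow>\<^sub>0 complex) set set" where
  "S7_gens q \<equiv> S7_x q ` {1..4} \<union> S7_xbar q ` {1..4}"

lemma S7_alg_subalg: "S7_alg q = subalg (Sp_alg q) (S7_gens q)"
  by (simp add: S7_alg_def)

context
  fixes q :: real
  assumes q: "q \<noteq> 0"
begin

private abbreviation (input) "Q \<equiv> complex_of_real q"
private abbreviation (input) "P \<equiv> Sp_alg q"
private abbreviation (input) "H \<equiv> SU_alg q"
private abbreviation (input) "S \<equiv> S7_alg q"
private abbreviation (input) "P_H \<equiv> tensor_alg (Sp_alg q) (SU_alg q)"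
private abbreviation (input) "S_H \<equiv> tensor_alg (S7_alg q) (SU_alg q)"
private abbreviation (input) "H_H \<equiv> tensor_alg (SU_alg q) (SU_alg q)"
private abbreviation (input) "w \<equiv> levi (SU_alg q) (complex_of_real q) (SU_gen q)"

interpretation P: calg P by (rule Sp_calg)
interpretation H: calg H by (rule SU_calg)
interpretation PH: two_calgs P H ..

lemma S7_gens_closed: "S7_gens q \<subseteq> carrier P"
proof -
  have "S7_x q i \<in> carrier P" "S7_xbar q i \<in> carrier P" if i: "i \<in> I4" for i
  proof -
    have "5 - i \<in> I4"
      using i by auto
    then show "S7_x q i \<in> carrier P" "S7_xbar q i \<in> carrier P"
      using Sp_T_closed[OF q i, of 4] Sp_T_closed[OF q, of "5 - i" 1] by (simp_all add: S7_x_def S7_xbar_T[OF q i])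
  qed
  then show ?thesis
    by blast
qed

interpretation S: calg S
  unfolding S7_alg_subalg by (rule P.subalg_calg[OF S7_gens_closed])
interpretation SH: two_calgs S H ..

lemma S7_ops [simp]:
  "x \<otimes>\<^bsub>S\<^esub> y = x \<otimes>\<^bsub>P\<^esub> y" "x \<oplus>\<^bsub>S\<^esub> y = x \<oplus>\<^bsub>P\<^esub> y" "c \<odot>\<^bsub>S\<^esub> x = c \<odot>\<^bsub>P\<^esub> x" "\<one>\<^bsub>S\<^esub> = \<one>\<^bsub>P\<^esub>"
  by (simp_all add: S7_alg_def)

lemma levi_closed [simp]: "w i k \<in> carrier H"
  by (simp add: levi_def)

text \<open>
  The first and the last column of the matrix lie in the algebra of the sphere; the first one because the
  scalars in the conjugates are invertible.
\<close>

lemma T_in_S7: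
  assumes i: "i \<in> I4" and j: "j = 1 \<or> j = 4"
  shows "Sp_T q i j \<in> carrier S"
proof -
  have 4: "Sp_T q i 4 \<in> carrier S"
    using i by (auto simp: S7_alg_def S7_x_def intro!: gen_subalg.incl)
  have i': "5 - i \<in> I4" "5 - (5 - i) = i"
    using i by auto
  have "S7_xbar q (5 - i) \<in> carrier S"
    using i' by (auto simp: S7_alg_def intro!: gen_subalg.incl)
  then have "inverse (xbar_coef Q (5 - i)) \<odot>\<^bsub>P\<^esub> S7_xbar q (5 - i) \<in> carrier S"
    by (auto simp: S7_alg_def intro: gen_subalg.smult)
  then have "Sp_T q i 1 \<in> carrier S"
    using xbar_coef_nonzero[of Q "5 - i"] q Sp_T_closed[OF q i, of 1]
    by (simp add: S7_xbar_T[OF q i'(1)] i'(2))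
  with 4 j show ?thesis
    by auto
qed

text \<open>
  The homomorphism \<open>T \<mapsto> w T\<close> on the whole of \<open>A(Sp\<^sub>q(2))\<close>.
\<close>

definition Sp_coact where
  "Sp_coact = (SOME h. h \<in> alg_hom P P_H \<and>
    (\<forall>i\<in>I4. \<forall>j\<in>I4. h (Sp_T q i j) = (\<Oplus>\<^bsub>P_H\<^esub>k\<in>I4. tens P H (Sp_T q k j) (w i k))))"

lemma Sp_coact:
  shows "Sp_coact \<in> alg_hom P P_H"
    and "\<And>i j. i \<in> I4 \<Longrightarrow> j \<in> I4 \<Longrightarrow>
      Sp_coact (Sp_T q i j) = (\<Oplus>\<^bsub>P_H\<^esub>k\<in>I4. tens P H (Sp_T q k j) (w i k))"
proof -
  have "sp_point P_H q (\<lambda>i j. \<Oplus>\<^bsub>P_H\<^esub>k\<in>I4. tens P H (Sp_T q k j) (w i k))"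
    by (rule PH.sp_point_tensor[OF Sp_T_point[OF q] H.levi_point[OF q SU_gen_point]])
  from someI_ex[OF Sp_hom[OF q PH.T.calg_axioms this], folded Sp_coact_def]
  show "Sp_coact \<in> alg_hom P P_H"
    "\<And>i j. i \<in> I4 \<Longrightarrow> j \<in> I4 \<Longrightarrow>
      Sp_coact (Sp_T q i j) = (\<Oplus>\<^bsub>P_H\<^esub>k\<in>I4. tens P H (Sp_T q k j) (w i k))"
    by blast+
qed

private abbreviation (input) "\<iota> \<equiv> tensor_map P H id id"

lemma incl: "id \<in> alg_hom S P"
  unfolding S7_alg_subalg by (rule P.subalg_incl[OF S7_gens_closed])

lemmas incl_tensor = tensor_map_lin[OF Sp_calg SU_calg S.calg_axioms SU_calg alg_hom_lin[OF incl] id_lin]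
  tensor_map_tens[OF Sp_calg SU_calg S.calg_axioms SU_calg alg_hom_lin[OF incl] id_lin]
  tensor_map_alg_hom[OF Sp_calg SU_calg S.calg_axioms SU_calg alg_hom_lin[OF incl] id_lin incl id_alg_hom]

lemma incl_tensor_inj: "inj_on \<iota> (carrier S_H)"
  unfolding S7_alg_subalg by (rule P.subalg_tensor_inj[OF S7_gens_closed SU_calg])

text \<open>
  Multiplication by \<open>w\<close> from the left does not mix columns, so the image of an entry in the first or last
  column only involves entries of that column.
\<close>

lemma S7_coact_T_preimage:
  assumes i: "i \<in> I4" and j: "j = 1 \<or> j = 4"
  shows "(\<Oplus>\<^bsub>S_H\<^esub>k\<in>I4. tens S H (Sp_T q k j) (w i k)) \<in> carrier S_H"
    and "\<iota> (\<Oplus>\<^bsub>S_H\<^esub>k\<in>I4. tens S H (Sp_T q k j) (w i k)) = Sp_coact (Sp_T q i j)"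
proof -
  have j': "j \<in> I4"
    using j by auto
  have closed: "tens S H (Sp_T q k j) (w i k) \<in> carrier S_H" if "k \<in> I4" for k
    using T_in_S7[OF that j] by simp
  then show "(\<Oplus>\<^bsub>S_H\<^esub>k\<in>I4. tens S H (Sp_T q k j) (w i k)) \<in> carrier S_H"
    by (intro SH.T.finsum_closed) auto
  have "\<iota> (\<Oplus>\<^bsub>S_H\<^esub>k\<in>I4. tens S H (Sp_T q k j) (w i k)) =
    (\<Oplus>\<^bsub>P_H\<^esub>k\<in>I4. \<iota> (tens S H (Sp_T q k j) (w i k)))"
    using closed by (intro lin_finsum[OF SH.T.calg_axioms PH.T.calg_axioms incl_tensor(1)]) auto
  also have "\<dots> = (\<Oplus>\<^bsub>P_H\<^esub>k\<in>I4. tens P H (Sp_T q k j) (w i k))"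
  proof (intro PH.T.finsum_cong' refl)
    show "(\<lambda>k. tens P H (Sp_T q k j) (w i k)) \<in> I4 \<rightarrow> carrier P_H"
      using Sp_T_closed[OF q _ j'] by (intro Pi_I PH.tens_closed levi_closed)
  next
    fix k assume "k \<in> I4"
    then show "\<iota> (tens S H (Sp_T q k j) (w i k)) = tens P H (Sp_T q k j) (w i k)"
      using incl_tensor(2)[OF T_in_S7[OF _ j] levi_closed] by simp
  qed
  also have "\<dots> = Sp_coact (Sp_T q i j)"
    by (rule Sp_coact(2)[OF i j', symmetric])
  finally show "\<iota> (\<Oplus>\<^bsub>S_H\<^esub>k\<in>I4. tens S H (Sp_T q k j) (w i k)) = Sp_coact (Sp_T q i j)" .
qed

lemma Sp_coact_range:
  assumes "a \<in> carrier S"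
  shows "Sp_coact a \<in> \<iota> ` carrier S_H"
proof (rule gen_subalg_image[OF Sp_calg SH.T.calg_axioms PH.T.calg_axioms S7_gens_closed Sp_coact(1) incl_tensor(3)])
  show "a \<in> gen_subalg P (S7_gens q)"
    using assms by (simp add: S7_alg_def)
  have T: "Sp_coact (Sp_T q i j) \<in> \<iota> ` carrier S_H" if "i \<in> I4" "j = 1 \<or> j = 4" for i j
    by (rule image_eqI[where f = \<iota>, OF S7_coact_T_preimage(2)[OF that, symmetric] S7_coact_T_preimage(1)[OF that]])
  fix x assume "x \<in> S7_gens q"
  then consider i where "i \<in> I4" "x = S7_x q i" | i where "i \<in> I4" "x = S7_xbar q i"
    by blast
  then show "Sp_coact x \<in> \<iota> ` carrier S_H"
  proof cases
    case (1 i)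
    then show ?thesis
      using T[of i 4] by (simp add: S7_x_def)
  next
    case (2 i)
    then have i: "5 - i \<in> I4"
      by auto
    have T_closed: "Sp_T q (5 - i) 1 \<in> carrier P"
      using Sp_T_closed[OF q i, of 1] by simp
    show ?thesis
      unfolding 2(2) S7_xbar_T[OF q 2(1)] lin_smult[OF alg_hom_lin[OF Sp_coact(1)] T_closed]
      by (rule lin_image_smult[OF SH.T.calg_axioms incl_tensor(1) T[OF i disjI1[OF refl]]])
  qed
qed

text \<open>
  The preimage under \<open>\<iota>\<close>, which is injective and has the values of \<^term>\<open>Sp_coact\<close> on the sphere in its range.
\<close>

definition S7_coact where
  "S7_coact a = inv_into (carrier S_H) \<iota> (Sp_coact a)"

lemma S7_coact_alg_hom: "S7_coact \<in> alg_hom S S_H"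
  and S7_coact_T: "i \<in> I4 \<Longrightarrow> j = 1 \<or> j = 4 \<Longrightarrow>
    S7_coact (Sp_T q i j) = (\<Oplus>\<^bsub>S_H\<^esub>k\<in>I4. tens S H (Sp_T q k j) (w i k))"
proof -
  have h: "Sp_coact \<in> alg_hom S P_H"
    using alg_hom_comp[OF Sp_coact(1) incl] by simp
  note c = alg_hom_corestrict[OF S.calg_axioms SH.T.calg_axioms PH.T.calg_axioms h incl_tensor(3) incl_tensor_inj Sp_coact_range]
  show "S7_coact \<in> alg_hom S S_H"
    using c(1) by (simp add: S7_coact_def[abs_def])
  assume ij: "i \<in> I4" "j = 1 \<or> j = 4"
  show "S7_coact (Sp_T q i j) = (\<Oplus>\<^bsub>S_H\<^esub>k\<in>I4. tens S H (Sp_T q k j) (w i k))"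
    unfolding S7_coact_def by (rule c(2)[OF _ T_in_S7[OF ij] S7_coact_T_preimage[OF ij]])
qed

text \<open>
  The conjugates are multiples of entries in the first column, so these two columns determine a homomorphism
  on the sphere.
\<close>

lemma S7_hom_eqI:
  assumes B: "calg B" and f: "f \<in> alg_hom S B" and g: "g \<in> alg_hom S B"
    and eq: "\<And>i j. i \<in> I4 \<Longrightarrow> j = 1 \<or> j = 4 \<Longrightarrow> f (Sp_T q i j) = g (Sp_T q i j)" and a: "a \<in> carrier S"
  shows "f a = g a"
proof (rule alg_hom_eq_on_subalg[OF Sp_calg B S7_gens_closed f[unfolded S7_alg_subalg] g[unfolded S7_alg_subalg]])
  show "a \<in> gen_subalg P (S7_gens q)"
    using a by (simp add: S7_alg_def)
  fix x assume "x \<in> S7_gens q"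
  then consider i where "i \<in> I4" "x = Sp_T q i 4"
    | i where "i \<in> I4" "x = xbar_coef Q i \<odot>\<^bsub>S\<^esub> Sp_T q (5 - i) 1"
    using S7_xbar_T[OF q] by (auto simp: S7_x_def)
  then show "f x = g x"
  proof cases
    case 2
    then have i: "5 - i \<in> I4"
      by auto
    show ?thesis
      unfolding 2 lin_smult[OF alg_hom_lin[OF f] T_in_S7[OF i disjI1[OF refl]]]
        lin_smult[OF alg_hom_lin[OF g] T_in_S7[OF i disjI1[OF refl]]]
      using eq[OF i, of 1] by simp
  qed (simp add: eq)
qed

text \<open>
  The transpose of \<open>w\<close> is conjugate by diagonal scalar matrices to two copies of \<open>u\<close>, whence the reversed
  order of the factors.
\<close>

lemma levi_comult:
  assumes "i \<in> I4" "m \<in> I4"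
  shows "SU_comult q (w i m) = (\<Oplus>\<^bsub>H_H\<^esub>k\<in>I4. tens H H (w k m) (w i k))"
proof -
  interpret HH: two_calgs H H ..
  note \<Delta> = SU_comult[OF q]
  have cases: "i = 1 \<or> i = 2 \<or> i = 3 \<or> i = 4" "m = 1 \<or> m = 2 \<or> m = 3 \<or> m = 4"
    using assms by auto
  have tens_smult: "tens H H (c \<odot>\<^bsub>H\<^esub> x) (d \<odot>\<^bsub>H\<^esub> y) = (c * d) \<odot>\<^bsub>H_H\<^esub> tens H H x y"
    if "x \<in> carrier H" "y \<in> carrier H" for c d x y
    using that lin_smult[OF HH.tens_lin_left] lin_smult[OF HH.tens_lin_right] by (simp add: mult.commute)
  have summand: "tens H H (w k m) (w i k) =
    (levi_coef Q k m * levi_coef Q i k) \<odot>\<^bsub>H_H\<^esub> tens H H (SU_gen q (levi_gen k m)) (SU_gen q (levi_gen i k))" for k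
    by (simp only: levi_def tens_smult SU_gen_closed)
  have left: "SU_comult q (w i m) =
    levi_coef Q i m \<odot>\<^bsub>H_H\<^esub> su_cop H H Q (SU_gen q) (SU_gen q) (levi_gen i m)"
    by (simp only: levi_def lin_smult[OF alg_hom_lin[OF \<Delta>(1)] SU_gen_closed] \<Delta>(2))
  have right: "(\<Oplus>\<^bsub>H_H\<^esub>k\<in>I4. tens H H (w k m) (w i k)) =
    tens H H (w 1 m) (w i 1) \<oplus>\<^bsub>H_H\<^esub> (tens H H (w 2 m) (w i 2) \<oplus>\<^bsub>H_H\<^esub>
    (tens H H (w 3 m) (w i 3) \<oplus>\<^bsub>H_H\<^esub> tens H H (w 4 m) (w i 4)))"
    by (rule sum_I4[OF HH.T.calg_axioms]) (intro HH.tens_closed levi_closed)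
  show ?thesis
    unfolding left right unfolding summand using cases
    by (elim disjE; simp add: levi_coef_def levi_gen_def su_cop_def HH.T.smult_r_distr HH.T.a_comm del: One_nat_def)
qed

lemma levi_counit:
  assumes "i \<in> I4" "k \<in> I4"
  shows "SU_counit q (w i k) = (if i = k then 1 else 0)"
proof -
  note \<epsilon> = SU_counit[OF q]
  have cases: "i = 1 \<or> i = 2 \<or> i = 3 \<or> i = 4" "k = 1 \<or> k = 2 \<or> k = 3 \<or> k = 4"
    using assms by auto
  have "SU_counit q (w i k) = levi_coef Q i k * SU_counit q (SU_gen q (levi_gen i k))"
    by (simp add: levi_def lin_smult[OF alg_hom_lin[OF \<epsilon>(1)]])
  then show ?thesis
    using cases by (elim disjE; simp add: \<epsilon>(2) levi_coef_def levi_gen_def del: One_nat_def)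
qed

text \<open>
  On \<open>T\<^sub>i\<^sup>j\<close> both sides are the sum of all \<open>T\<^sub>m\<^sup>j \<otimes> (w\<^sub>k\<^sup>m \<otimes> w\<^sub>i\<^sup>k)\<close>.
\<close>

lemma S7_coact_coassoc:
  assumes a: "a \<in> carrier S"
  shows "tensor_assoc S H H (tensor_map S_H H S7_coact id (S7_coact a)) =
    tensor_map S H_H id (SU_comult q) (S7_coact a)"
proof -
  interpret HH: two_calgs H H ..
  interpret SH_H: two_calgs "S_H" H ..
  interpret S_HH: two_calgs S "H_H" ..
  let ?\<delta> = S7_coact and ?W = "tensor_alg S H_H"
  let ?a = "tensor_assoc S H H" and ?l = "tensor_map S_H H S7_coact id"
    and ?r = "tensor_map S H_H id (SU_comult q)"
  note \<delta> = S7_coact_alg_hom and \<Delta> = SU_comult(1)[OF q]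
  note l = tensor_map_alg_hom[OF SH.T.calg_axioms SU_calg S.calg_axioms SU_calg alg_hom_lin[OF \<delta>] id_lin \<delta> id_alg_hom]
    tensor_map_tens[OF SH.T.calg_axioms SU_calg S.calg_axioms SU_calg alg_hom_lin[OF \<delta>] id_lin]
  note r = tensor_map_alg_hom[OF S.calg_axioms HH.T.calg_axioms S.calg_axioms SU_calg id_lin alg_hom_lin[OF \<Delta>] id_alg_hom \<Delta>]
    tensor_map_tens[OF S.calg_axioms HH.T.calg_axioms S.calg_axioms SU_calg id_lin alg_hom_lin[OF \<Delta>]]
  note as = tensor_assoc_alg_hom[OF S.calg_axioms SU_calg SU_calg] tensor_assoc_tens[OF S.calg_axioms SU_calg SU_calg]
  have al: "(\<lambda>t. ?a (?l t)) \<in> alg_hom S_H ?W"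
    by (rule alg_hom_comp[OF as(1) l(1)])
  show ?thesis
  proof (rule S7_hom_eqI[OF S_HH.T.calg_axioms alg_hom_comp[OF al \<delta>] alg_hom_comp[OF r(1) \<delta>] _ a])
    fix i j assume i: "i \<in> I4" and j: "j = 1 \<or> j = (4::nat)"
    let ?T = "\<lambda>k. Sp_T q k j"
    note T = T_in_S7[OF _ j]
    have "?a (?l (?\<delta> (?T i))) = (\<Oplus>\<^bsub>?W\<^esub>k\<in>I4. ?a (?l (tens S H (?T k) (w i k))))"
      unfolding S7_coact_T[OF i j]
      by (rule lin_finsum[OF SH.T.calg_axioms S_HH.T.calg_axioms alg_hom_lin[OF al]]) (intro Pi_I SH.tens_closed levi_closed T)
    also have "\<dots> = (\<Oplus>\<^bsub>?W\<^esub>k\<in>I4. \<Oplus>\<^bsub>?W\<^esub>m\<in>I4. tens S H_H (?T m) (tens H H (w k m) (w i k)))"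
    proof (intro S_HH.T.finsum_cong' refl)
      fix k assume k: "k \<in> I4"
      have ins: "(\<lambda>x. ?a (tens S_H H x (w i k))) \<in> lin S_H ?W"
        by (rule lin_comp[OF alg_hom_lin[OF as(1)] SH_H.tens_lin_left]) simp
      have "?a (?l (tens S H (?T k) (w i k))) = ?a (tens S_H H (?\<delta> (?T k)) (w i k))"
        using T[OF k] by (simp add: l(2))
      also have "\<dots> = (\<Oplus>\<^bsub>?W\<^esub>m\<in>I4. ?a (tens S_H H (tens S H (?T m) (w k m)) (w i k)))"
        unfolding S7_coact_T[OF k j]
        by (rule lin_finsum[OF SH.T.calg_axioms S_HH.T.calg_axioms ins]) (intro Pi_I SH.tens_closed levi_closed T)
      also have "\<dots> = (\<Oplus>\<^bsub>?W\<^esub>m\<in>I4. tens S H_H (?T m) (tens H H (w k m) (w i k)))"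
        by (intro S_HH.T.finsum_cong' refl Pi_I as(2) T levi_closed S_HH.tens_closed HH.tens_closed)
      finally show "?a (?l (tens S H (?T k) (w i k))) =
        (\<Oplus>\<^bsub>?W\<^esub>m\<in>I4. tens S H_H (?T m) (tens H H (w k m) (w i k)))" .
    qed (intro Pi_I S_HH.T.finsum_closed S_HH.tens_closed HH.tens_closed levi_closed T)
    also have "\<dots> = (\<Oplus>\<^bsub>?W\<^esub>m\<in>I4. \<Oplus>\<^bsub>?W\<^esub>k\<in>I4. tens S H_H (?T m) (tens H H (w k m) (w i k)))"
      by (intro S_HH.T.finsum_swap S_HH.tens_closed HH.tens_closed levi_closed T) auto
    also have "\<dots> = (\<Oplus>\<^bsub>?W\<^esub>m\<in>I4. ?r (tens S H (?T m) (w i m)))"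
    proof (intro S_HH.T.finsum_cong' refl)
      fix m assume m: "m \<in> I4"
      have "?r (tens S H (?T m) (w i m)) = tens S H_H (?T m) (\<Oplus>\<^bsub>H_H\<^esub>k\<in>I4. tens H H (w k m) (w i k))"
        using T[OF m] by (simp add: r(2) levi_comult[OF i m])
      also have "\<dots> = (\<Oplus>\<^bsub>?W\<^esub>k\<in>I4. tens S H_H (?T m) (tens H H (w k m) (w i k)))"
        using T[OF m] by (intro lin_finsum[OF HH.T.calg_axioms S_HH.T.calg_axioms S_HH.tens_lin_right]) auto
      finally show "(\<Oplus>\<^bsub>?W\<^esub>k\<in>I4. tens S H_H (?T m) (tens H H (w k m) (w i k))) = ?r (tens S H (?T m) (w i m))" ..
    qed (intro Pi_I lin_closed[OF alg_hom_lin[OF r(1)]] SH.tens_closed levi_closed T)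
    also have "\<dots> = ?r (?\<delta> (?T i))"
      unfolding S7_coact_T[OF i j]
      by (rule lin_finsum[OF SH.T.calg_axioms S_HH.T.calg_axioms alg_hom_lin[OF r(1)], symmetric])
        (intro Pi_I SH.tens_closed levi_closed T)
    finally show "?a (?l (?\<delta> (?T i))) = ?r (?\<delta> (?T i))" .
  qed
qed

lemma S7_coact_counit:
  assumes a: "a \<in> carrier S"
  shows "tensor_runit S (tensor_map S complex_alg id (SU_counit q) (S7_coact a)) = a"
proof -
  interpret C: calg complex_alg by (rule complex_calg)
  interpret SC: two_calgs S complex_alg ..
  let ?e = "tensor_map S complex_alg id (SU_counit q)"
  note \<delta> = S7_coact_alg_hom and \<epsilon> = SU_counit(1)[OF q]
  note e = tensor_map_alg_hom[OF S.calg_axioms complex_calg S.calg_axioms SU_calg id_lin alg_hom_lin[OF \<epsilon>] id_alg_hom \<epsilon>]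
    tensor_map_tens[OF S.calg_axioms complex_calg S.calg_axioms SU_calg id_lin alg_hom_lin[OF \<epsilon>]]
  have re: "(\<lambda>t. tensor_runit S (?e t)) \<in> alg_hom S_H S"
    by (rule alg_hom_comp[OF S.tensor_runit_alg_hom e(1)])
  have "tensor_runit S (?e (S7_coact a)) = id a"
  proof (rule S7_hom_eqI[OF S.calg_axioms alg_hom_comp[OF re \<delta>] id_alg_hom _ a])
    fix i j assume i: "i \<in> I4" and j: "j = 1 \<or> j = (4::nat)"
    note T = T_in_S7[OF _ j]
    have "tensor_runit S (?e (S7_coact (Sp_T q i j))) = (\<Oplus>\<^bsub>S\<^esub>k\<in>I4. tensor_runit S (?e (tens S H (Sp_T q k j) (w i k))))"
      unfolding S7_coact_T[OF i j]
      by (rule lin_finsum[OF SH.T.calg_axioms S.calg_axioms alg_hom_lin[OF re]]) (intro Pi_I SH.tens_closed levi_closed T)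
    also have "\<dots> = (\<Oplus>\<^bsub>S\<^esub>k\<in>I4. (if i = k then 1 else 0) \<odot>\<^bsub>S\<^esub> Sp_T q k j)"
    proof (intro S.finsum_cong' refl Pi_I S.smult_closed T)
      fix k assume k: "k \<in> I4"
      show "tensor_runit S (?e (tens S H (Sp_T q k j) (w i k))) = (if i = k then 1 else 0) \<odot>\<^bsub>S\<^esub> Sp_T q k j"
        unfolding e(2)[OF T[OF k] levi_closed] id_apply S.tensor_runit_tens[OF T[OF k]] levi_counit[OF i k] ..
    qed
    also have "\<dots> = (if i = i then 1 else 0) \<odot>\<^bsub>S\<^esub> Sp_T q i j"
      by (rule S.finsum_delta) (use T i in \<open>auto simp del: S7_ops simp add: S.smult_zero_left\<close>)
    also have "\<dots> = id (Sp_T q i j)"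
      using S.smult_one[OF T[OF i]] by simp
    finally show "tensor_runit S (?e (S7_coact (Sp_T q i j))) = id (Sp_T q i j)" .
  qed
  then show ?thesis
    by simp
qed

text \<open>
  The four rows of \<open>w\<close> give the values on the \<open>x\<^sub>i\<close>. For the conjugates, the scalars \<open>- q\<^sup>4, - q\<^sup>3, q, 1\<close> of
  \<open>xbar_coef\<close> change the coefficients of the same formula into the prescribed ones.
\<close>

lemma S7_coact_values: "deltaR_values q S7_coact"
proof -
  let ?P = "S_H"
  let ?t = "tens S H" and ?T = "Sp_T q" and ?g = "SU_gen q"
  have T [simp]: "?T 1 j \<in> carrier S" "?T 2 j \<in> carrier S" "?T 3 j \<in> carrier S" "?T 4 j \<in> carrier S"
    if "j = 1 \<or> j = 4" for j
    using T_in_S7[OF _ that] by simp_all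
  have tens_right: "?t x (c \<odot>\<^bsub>H\<^esub> y) = c \<odot>\<^bsub>?P\<^esub> ?t x y" if "x \<in> carrier S" "y \<in> carrier H" for c x y
    using lin_smult[OF SH.tens_lin_right] that by simp
  have tens_left: "?t (c \<odot>\<^bsub>P\<^esub> x) y = c \<odot>\<^bsub>?P\<^esub> ?t x y" if "x \<in> carrier S" "y \<in> carrier H" for c x y
    using lin_smult[OF SH.tens_lin_left, of y x c] that by simp
  have tens_zero: "?t x \<zero>\<^bsub>H\<^esub> = \<zero>\<^bsub>?P\<^esub>" if "x \<in> carrier S" for x
    by (rule lin_zero[OF SU_calg SH.T.calg_axioms SH.tens_lin_right[OF that]])
  have sum: "S7_coact (?T i j) = ?t (?T 1 j) (w i 1) \<oplus>\<^bsub>?P\<^esub> (?t (?T 2 j) (w i 2) \<oplus>\<^bsub>?P\<^esub>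
      (?t (?T 3 j) (w i 3) \<oplus>\<^bsub>?P\<^esub> ?t (?T 4 j) (w i 4)))" if "i \<in> I4" "j = 1 \<or> j = 4" for i j
    unfolding S7_coact_T[OF that] using T_in_S7[OF _ that(2)] by (intro sum_I4[OF SH.T.calg_axioms]) simp
  have val: "S7_coact (?T 1 j) = ?t (?T 1 j) (?g Alpha) \<oplus>\<^bsub>?P\<^esub> Q \<odot>\<^bsub>?P\<^esub> ?t (?T 2 j) (?g Gamma)"
    "S7_coact (?T 2 j) = (- 1) \<odot>\<^bsub>?P\<^esub> ?t (?T 1 j) (?g GammaBar) \<oplus>\<^bsub>?P\<^esub> ?t (?T 2 j) (?g AlphaBar)"
    "S7_coact (?T 3 j) = ?t (?T 3 j) (?g Alpha) \<oplus>\<^bsub>?P\<^esub> (- Q) \<odot>\<^bsub>?P\<^esub> ?t (?T 4 j) (?g Gamma)"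
    "S7_coact (?T 4 j) = ?t (?T 3 j) (?g GammaBar) \<oplus>\<^bsub>?P\<^esub> ?t (?T 4 j) (?g AlphaBar)"
    if "j = 1 \<or> j = 4" for j
    using that by (simp_all add: sum levi_def tens_right tens_zero levi_coef_def levi_gen_def del: One_nat_def)
  have bar: "S7_xbar q 1 = (- (Q ^ 4)) \<odot>\<^bsub>P\<^esub> ?T 4 1" "S7_xbar q 2 = (- (Q ^ 3)) \<odot>\<^bsub>P\<^esub> ?T 3 1"
    "S7_xbar q 3 = Q \<odot>\<^bsub>P\<^esub> ?T 2 1" "S7_xbar q 4 = 1 \<odot>\<^bsub>P\<^esub> ?T 1 1"
    using S7_xbar_T[OF q, of 1] S7_xbar_T[OF q, of 2] S7_xbar_T[OF q, of 3] S7_xbar_T[OF q, of 4]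
    by (simp_all add: xbar_coef_def)
  have coact_smult: "S7_coact (c \<odot>\<^bsub>P\<^esub> x) = c \<odot>\<^bsub>?P\<^esub> S7_coact x" if "x \<in> carrier S" for c x
    using lin_smult[OF alg_hom_lin[OF S7_coact_alg_hom] that, of c] by simp
  have neg: "\<ominus>\<^bsub>?P\<^esub> z = (- 1) \<odot>\<^bsub>?P\<^esub> z" if "z \<in> carrier ?P" for z
    using SH.T.smult_minus_one[OF that] by simp
  show ?thesis
    unfolding deltaR_values_def Let_def S7_x_def bar
    by (simp add: val coact_smult tens_left neg a_minus_def SH.T.smult_r_distr power4_eq_xxxx power3_eq_cube mult_ac
        del: One_nat_def)
qed

lemma deltaR_values_unique:
  assumes \<delta>: "\<delta> \<in> alg_hom S S_H" "deltaR_values q \<delta>"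
    and \<delta>': "\<delta>' \<in> alg_hom S S_H" "deltaR_values q \<delta>'" and a: "a \<in> carrier S"
  shows "\<delta>' a = \<delta> a"
proof (rule alg_hom_eq_on_subalg[OF Sp_calg SH.T.calg_axioms S7_gens_closed])
  show "\<delta>' \<in> alg_hom (subalg P (S7_gens q)) S_H" "\<delta> \<in> alg_hom (subalg P (S7_gens q)) S_H"
    using \<delta>(1) \<delta>'(1) by (simp_all add: S7_alg_subalg)
  show "a \<in> gen_subalg P (S7_gens q)"
    using a by (simp add: S7_alg_def)
  fix x assume "x \<in> S7_gens q"
  then have "x \<in> S7_x q ` {1, 2, 3, 4} \<union> S7_xbar q ` {1, 2, 3, 4}"
    by (simp only: atLeastAtMost_1_4)
  then show "\<delta>' x = \<delta> x"
    using \<delta>(2) \<delta>'(2) unfolding deltaR_values_def Let_def by (elim UnE imageE insertE emptyE) simp_all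
qed

end

theorem proposition4:
  fixes q :: real
  assumes "q \<noteq> 0"
  shows "\<exists>\<delta>. \<delta> \<in> alg_hom (S7_alg q) (tensor_alg (S7_alg q) (SU_alg q)) \<and>
             deltaR_values q \<delta> \<and>
             (\<forall>\<delta>'\<in>alg_hom (S7_alg q) (tensor_alg (S7_alg q) (SU_alg q)).
                deltaR_values q \<delta>' \<longrightarrow> (\<forall>a\<in>carrier (S7_alg q). \<delta>' a = \<delta> a)) \<and>
             right_coaction (S7_alg q) (SU_alg q) (SU_comult q) (SU_counit q) \<delta>"
  using S7_coact_alg_hom[OF assms] S7_coact_values[OF assms] deltaR_values_unique[OF assms]
    S7_coact_coassoc[OF assms] S7_coact_counit[OF assms]
  by (intro exI[of _ "S7_coact q"]) (auto simp: right_coaction_def)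

end
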